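(* Let $\mathfrak g=\mathfrak f_4$, let $V$ be its $26$-dimensional irreducible representation, and let $I=I_{(\mathfrak f_4,V)}$ be the associated invariant of framed coloured $3$-tangles. Denote by $X_+,\mathrm{Id},\mathrm{S},\mathrm{H},\mathrm{I},\mathrm{H}_{da}$ the elementary tangles described in the context. Then there exist coefficients $\lambda,\mu,\nu,\rho,\sigma\in\mathbf C((\hat h))$ such that the following skein relation, involving only one crossing, holds in $\mathrm{End}_{\mathfrak f_4}(V\otimes V)\otimes_{\mathbf C}\mathbf C((\hat h))$: $$I(X_+)=\lambda\, I(\mathrm{Id})+\mu\, I(\mathrm S)+\nu\, I(\mathrm H)+\rho\, I(\mathrm I)+\sigma\, I(\mathrm H_{da}).$$
   Context: A framed coloured $3$-tangle is a framed tangle in which trivalent branching points are allowed and whose edges are coloured by solid, dashed or dotted. The invariant $I_{(\mathfrak g,V)}=\Psi_{\mathfrak g}\circ\hat Z_f$ is the composite of the universal Vassiliev–Kontsevich invariant $\hat Z_f$ (extended to coloured $3$-tangles) with the $(\mathfrak g,V)$-weight system $\Psi_{\mathfrak g}$; it is a monoidal functor, invariant under isotopy, with values in $\mathfrak g$-linear maps between tensor products of representations, with coefficients in $\mathbf C[[\hat h]]$ ($\hat h$ a formal parameter). For $\mathfrak g=\mathfrak f_4$, a solid strand is sent to $V$ and a dashed strand to the adjoint representation $L$; all these representations are selfdual, so orientations may be ignored. Decomposition: $V\otimes V\cong\mathbf C\oplus V\oplus U\oplus L\oplus W$ with highest weights (Bourbaki/Humphreys numbering) $V:(0,0,0,1)$,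 $L:(1,0,0,0)$, $U:(0,0,0,2)$, $W:(0,0,1,0)$. The summands are pairwise non-isomorphic; $\pi_Y$ denotes the projection of $V\otimes V$ onto the summand $Y$. Weight system normalisation: $h$ is a fixed non-zero complex number, the pairing on $L$ is $h\kappa$ with $\kappa$ the Killing form, and every trivalent vertex meeting a dashed edge carries a factor $\hat h$. Thus a dashed chord joining two solid strands is sent to $\Theta=\frac{\hat h^2}{h}\,\Omega\in\mathrm{End}_{\mathfrak g}(V\otimes V)[[\hat h]]$, where $\Omega=\sum_a x_a\otimes x^a$ for dual bases $(x_a),(x^a)$ of $\mathfrak g$ with respect to $\kappa$. Changes of parenthesization are sent to the Knizhnik–Zamolodchikov associator $\Phi$, evaluated through the chord operators and compatible (hexagon identities) with the braiding $\tau e^{-\Theta/2}$, where $\tau(x\otimes y)=y\otimes x$. Let $p:V\otimes V\to\mathbf C$ be a non-zero invariant symmetric bilinear form and $b:\mathbf C\to V\otimes V$ the invariant map with $(p\otimes \mathrm{id})(\mathrm{id}\otimes b)=\mathrm{id}_V$ (so $p\circ b=26$). Let $c\in\mathbf C[[\hat h]]$ be such that $c^{-1}$ is the scalar by which $(p\otimes\mathrm{id})\circ\Phi\circ(\mathrm{id}\otimes b)$ acts on $V$. The cap and cup tangles are sent to $c^{1/2}p$ and $c^{1/2}b$. Values of $I$ on the elementary tangles with four solid ends (all viewed as endomorphisms of $V\otimes V$): - $X_+$ (positive crossing): $I(X_+)=\tau\circ e^{-\Theta/2}$. - $\mathrm{Id}$ (two parallel strands): $I(\mathrm{Id})=\mathrm{id}_{V\otimes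 V}$. - $\mathrm S$ (a cap followed by a cup): $I(\mathrm S)=26c\,\pi_{\mathbf C}$. - $\mathrm H$ (two solid ends merging at a trivalent vertex into a solid edge, which splits again into two solid ends): $I(\mathrm H)=r\,\pi_V$. - $\mathrm H_{da}$ (the same with a dashed middle edge): $I(\mathrm H_{da})=s\,\pi_L$. - $\mathrm I$ is the tangle $\mathrm H$ rotated by $90^\circ$ in the plane, i.e. (two parallel solid strands joined by a solid edge) $I(\mathrm I)=(\mathrm{id}\otimes \mathrm{id}\otimes c^{1/2}p)\circ(\mathrm{id}\otimes I(\mathrm H)\otimes\mathrm{id})\circ(c^{1/2}b\otimes\mathrm{id}\otimes\mathrm{id})$, with the associativity isomorphisms given by $\Phi$ inserted wherever the parenthesization changes. The factors $r,s\in\mathbf C[[\hat h]]$ depend on the freely chosen non-zero normalisation constants of the trivalent vertices and are non-zero. *)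

theory Defs
  imports "HOL-Analysis.Analysis" "HOL-Computational_Algebra.Formal_Laurent_Series"
begin

section \<open>Matrices and tensor products\<close>

text \<open>
  Finite-dimensional spaces are coordinate spaces over finite index types. The tensor product of the
  spaces with index types \<open>'a\<close> and \<open>'b\<close> has index type \<open>'a \<times> 'b\<close>, so the parenthesization of an iterated
  tensor product is recorded by its type; the ground field is the space with index type \<^typ>\<open>unit\<close>.
  A matrix \<open>A :: 'k^'s^'t\<close> is a linear map from the \<open>'s\<close>-space to the \<open>'t\<close>-space.
\<close>

definition smul :: "'k::semiring_1 \<Rightarrow> 'k^'s^'t \<Rightarrow> 'k^'s^'t" (infixr \<open>\<odot>\<close> 74) where
  "c \<odot> A = (\<chi> i j. c * A $ i $ j)"

definition kron :: "'k::semiring_1^'s^'t \<Rightarrow> 'k^'u^'w \<Rightarrow> 'k^('s \<times> 'u)^('t \<times> 'w)" (infixr \<open>\<otimes>\<close> 76) where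
  "A \<otimes> B = (\<chi> i j. A $ fst i $ fst j * B $ snd i $ snd j)"

definition reindex :: "('s \<Rightarrow> 't) \<Rightarrow> 'k::semiring_1^'s^'t" where
  "reindex g = (\<chi> i j. if i = g j then 1 else 0)"

definition reassoc :: "'k::semiring_1^(('a::finite \<times> 'b::finite) \<times> 'c::finite)^('a \<times> ('b \<times> 'c))" where
  "reassoc = reindex (\<lambda>((a, b), c). (a, (b, c)))"

definition reassoc_inv :: "'k::semiring_1^('a::finite \<times> ('b::finite \<times> 'c::finite))^(('a \<times> 'b) \<times> 'c)" where
  "reassoc_inv = reindex (\<lambda>(a, (b, c)). ((a, b), c))"

definition lunit :: "'k::semiring_1^(unit \<times> 'a::finite)^'a" where "lunit = reindex snd"
definition lunit_inv :: "'k::semiring_1^'a::finite^(unit \<times> 'a)" where "lunit_inv = reindex (Pair ())"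
definition runit :: "'k::semiring_1^('a::finite \<times> unit)^'a" where "runit = reindex fst"
definition runit_inv :: "'k::semiring_1^'a::finite^('a \<times> unit)" where "runit_inv = reindex (\<lambda>a. (a, ()))"

definition flip :: "'k::semiring_1^('a::finite \<times> 'a)^('a \<times> 'a)" where
  "flip = reindex prod.swap"

definition fps_mat :: "complex^'s^'t \<Rightarrow> complex fps^'s^'t" where
  "fps_mat A = (\<chi> i j. fps_const (A $ i $ j))"

definition fls_mat :: "complex fps^'s^'t \<Rightarrow> complex fls^'s^'t" where
  "fls_mat A = (\<chi> i j. fps_to_fls (A $ i $ j))"


section \<open>The Lie algebra of type F4 and its representations\<close>

definition lie_algebra :: "(complex^'l \<Rightarrow> complex^'l \<Rightarrow> complex^'l) \<Rightarrow> bool" where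
  "lie_algebra br \<longleftrightarrow>
     (\<forall>x. Vector_Spaces.linear (*s) (*s) (br x)) \<and>
     (\<forall>y. Vector_Spaces.linear (*s) (*s) (\<lambda>x. br x y)) \<and>
     (\<forall>x. br x x = 0) \<and>
     (\<forall>x y z. br x (br y z) + br y (br z x) + br z (br x y) = 0)"

definition simple_lie_algebra :: "(complex^'l \<Rightarrow> complex^'l \<Rightarrow> complex^'l) \<Rightarrow> bool" where
  "simple_lie_algebra br \<longleftrightarrow>
     lie_algebra br \<and> (\<exists>x y. br x y \<noteq> 0) \<and>
     (\<forall>J. vec.subspace J \<and> (\<forall>x. \<forall>y\<in>J. br x y \<in> J) \<longrightarrow> J = {0} \<or> J = UNIV)"

text \<open>
  The Cartan matrix of F4 in Bourbaki's and Humphreys' numbering, shifted to the indices 0 to 3. Entry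
  \<open>(i, j)\<close> is \<open>\<langle>\<alpha>\<^sub>i, \<alpha>\<^sub>j\<rangle> = \<alpha>\<^sub>i(h\<^sub>j) = 2 (\<alpha>\<^sub>i, \<alpha>\<^sub>j) / (\<alpha>\<^sub>j, \<alpha>\<^sub>j)\<close>; the first two simple roots are long.
\<close>

definition cartan_F4 :: "nat \<Rightarrow> nat \<Rightarrow> int" where
  "cartan_F4 i j =
     [[ 2, -1,  0,  0],
      [-1,  2, -2,  0],
      [ 0, -1,  2, -1],
      [ 0,  0, -1,  2]] ! i ! j"

text \<open>
  \<open>br\<close> is the simple complex Lie algebra of type F4, with Chevalley generators \<open>e i\<close>, \<open>f i\<close>, \<open>k i\<close>
  for \<open>i < 4\<close> subject to the Serre relations.
\<close>

definition lie_algebra_F4 ::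
  "(complex^'l \<Rightarrow> complex^'l \<Rightarrow> complex^'l) \<Rightarrow>
   (nat \<Rightarrow> complex^'l) \<Rightarrow> (nat \<Rightarrow> complex^'l) \<Rightarrow> (nat \<Rightarrow> complex^'l) \<Rightarrow> bool" where
  "lie_algebra_F4 br e f k \<longleftrightarrow>
     simple_lie_algebra br \<and>
     (\<forall>S. vec.subspace S \<and> (\<forall>x\<in>S. \<forall>y\<in>S. br x y \<in> S) \<and>
          (\<forall>i<4. e i \<in> S \<and> f i \<in> S \<and> k i \<in> S) \<longrightarrow> S = UNIV) \<and>
     (\<forall>i<4. \<forall>j<4.
        br (k i) (k j) = 0 \<and>
        br (e i) (f j) = (if i = j then k i else 0) \<and>
        br (k i) (e j) = of_int (cartan_F4 j i) *s e j \<and>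
        br (k i) (f j) = - (of_int (cartan_F4 j i) *s f j) \<and>
        (i \<noteq> j \<longrightarrow>
           (br (e i) ^^ nat (1 - cartan_F4 j i)) (e j) = 0 \<and>
           (br (f i) ^^ nat (1 - cartan_F4 j i)) (f j) = 0))"

definition adjoint_rep ::
  "(complex^'l \<Rightarrow> complex^'l \<Rightarrow> complex^'l) \<Rightarrow> complex^'l \<Rightarrow> complex^'l^'l" where
  "adjoint_rep br x = matrix (br x)"

definition killing ::
  "(complex^'l \<Rightarrow> complex^'l \<Rightarrow> complex^'l) \<Rightarrow> complex^'l \<Rightarrow> complex^'l \<Rightarrow> complex" where
  "killing br x y = trace (adjoint_rep br x ** adjoint_rep br y)"

text \<open>
  Both families have the size of the coordinate basis, so they are automatically bases.
\<close>

definition dual_bases ::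
  "(complex^'l \<Rightarrow> complex^'l \<Rightarrow> complex^'l) \<Rightarrow> ('l \<Rightarrow> complex^'l) \<Rightarrow> ('l \<Rightarrow> complex^'l) \<Rightarrow> bool" where
  "dual_bases br x y \<longleftrightarrow> (\<forall>a b. killing br (x a) (y b) = (if a = b then 1 else 0))"

definition representation ::
  "(complex^'l \<Rightarrow> complex^'l \<Rightarrow> complex^'l) \<Rightarrow> (complex^'l \<Rightarrow> complex^'v^'v) \<Rightarrow> bool" where
  "representation br R \<longleftrightarrow>
     Vector_Spaces.linear (*s) smul R \<and>
     (\<forall>x y. R (br x y) = R x ** R y - R y ** R x)"

definition irreducible_rep :: "(complex^'l \<Rightarrow> complex^'v^'v) \<Rightarrow> bool" where
  "irreducible_rep R \<longleftrightarrow>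
     (\<forall>S. vec.subspace S \<and> (\<forall>x. \<forall>v\<in>S. R x *v v \<in> S) \<longrightarrow> S = {0} \<or> S = UNIV)"

definition has_highest_weight ::
  "(nat \<Rightarrow> complex^'l) \<Rightarrow> (nat \<Rightarrow> complex^'l) \<Rightarrow> (complex^'l \<Rightarrow> complex^'v^'v) \<Rightarrow> nat list \<Rightarrow> bool" where
  "has_highest_weight e k R w \<longleftrightarrow>
     (\<exists>v. v \<noteq> 0 \<and> (\<forall>i<4. R (e i) *v v = 0 \<and> R (k i) *v v = of_nat (w ! i) *s v))"

definition trivial_rep :: "complex^'l \<Rightarrow> complex^unit^unit" where
  "trivial_rep x = 0"

definition tensor_rep ::
  "(complex^'l \<Rightarrow> complex^'a^'a) \<Rightarrow> (complex^'l \<Rightarrow> complex^'b^'b) \<Rightarrow>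
   complex^'l \<Rightarrow> complex^('a \<times> 'b)^('a \<times> 'b)" where
  "tensor_rep R T x = R x \<otimes> mat 1 + mat 1 \<otimes> T x"

definition intertwiner ::
  "(complex^'l \<Rightarrow> complex^'a^'a) \<Rightarrow> (complex^'l \<Rightarrow> complex^'b^'b) \<Rightarrow> complex^'a^'b \<Rightarrow> bool" where
  "intertwiner R T A \<longleftrightarrow> (\<forall>x. A ** R x = T x ** A)"

text \<open>
  \<open>P\<close> is an equivariant projection of the representation \<open>T\<close> onto a summand isomorphic to \<open>R\<close>.
  It is unique when \<open>R\<close> is irreducible of multiplicity one in the completely reducible \<open>T\<close>.
\<close>

definition summand_projection ::
  "(complex^'l \<Rightarrow> complex^'a^'a) \<Rightarrow> (complex^'l \<Rightarrow> complex^'b^'b) \<Rightarrow> complex^'b^'b \<Rightarrow> bool" where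
  "summand_projection R T P \<longleftrightarrow>
     intertwiner T T P \<and> P ** P = P \<and>
     (\<exists>\<iota>. intertwiner R T \<iota> \<and> inj ((*v) \<iota>) \<and> range ((*v) P) = range ((*v) \<iota>))"

text \<open>
  \<open>p\<close> is a non-zero invariant symmetric bilinear form on \<open>V\<close> and \<open>b\<close> the copairing with
  \<open>(p \<otimes> id) (id \<otimes> b) = id\<close>.
\<close>

definition invariant_pairing ::
  "(complex^'l \<Rightarrow> complex^'v^'v) \<Rightarrow> complex^('v \<times> 'v)^unit \<Rightarrow> complex^unit^('v \<times> 'v) \<Rightarrow> bool" where
  "invariant_pairing R p b \<longleftrightarrow>
     p \<noteq> 0 \<and> p ** flip = p \<and>
     intertwiner (tensor_rep R R) trivial_rep p \<and> intertwiner trivial_rep (tensor_rep R R) b \<and>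
     lunit ** (p \<otimes> mat 1) ** reassoc_inv ** (mat 1 \<otimes> b) ** runit_inv = (mat 1 :: complex^'v^'v)"


section \<open>The Knizhnik-Zamolodchikov associator\<close>

text \<open>
  Words in two non-commuting letters \<open>A\<close> and \<open>B\<close> are lists of booleans, \<^const>\<open>False\<close> standing for \<open>A\<close> and
  \<^const>\<open>True\<close> for \<open>B\<close>. A non-commutative formal power series is its coefficient function.
\<close>

definition ncs_mult :: "(bool list \<Rightarrow> real) \<Rightarrow> (bool list \<Rightarrow> real) \<Rightarrow> bool list \<Rightarrow> real" where
  "ncs_mult F G w = (\<Sum>n\<le>length w. F (take n w) * G (drop n w))"

text \<open>The series \<open>exp (s a)\<close> for a letter \<open>a\<close>.\<close>

definition ncs_exp :: "bool \<Rightarrow> real \<Rightarrow> bool list \<Rightarrow> real" where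
  "ncs_exp a s w = (if set w \<subseteq> {a} then s ^ length w / fact (length w) else 0)"

text \<open>
  The coefficients at \<open>u\<close> of the solution of \<open>G' = (A / t + B / (t - 1)) G\<close> with \<open>G(\<epsilon>) = 1\<close>.
\<close>

primrec kz_transport :: "real \<Rightarrow> bool list \<Rightarrow> real \<Rightarrow> real" where
  "kz_transport \<epsilon> [] u = 1"
| "kz_transport \<epsilon> (a # w) u =
     integral {\<epsilon>..u} (\<lambda>t. (if a then 1 / (t - 1) else 1 / t) * kz_transport \<epsilon> w t)"

text \<open>
  \<open>\<Phi>(A, B)\<close> is the limit of \<open>\<epsilon>\<^bsup>-B\<^esup> G(1 - \<epsilon>) \<epsilon>\<^bsup>A\<^esup>\<close> as \<open>\<epsilon>\<close> decreases to 0, with \<open>A\<close> and \<open>B\<close> replaced by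
  \<open>A / 2\<pi>i\<close> and \<open>B / 2\<pi>i\<close>. This is Drinfeld's \<open>G\<^sub>1\<^bsup>-1\<^esup> G\<^sub>0\<close>, where \<open>G\<^sub>0 ~ t\<^bsup>A\<^esup>\<close> at 0 and
  \<open>G\<^sub>1 ~ (1 - t)\<^bsup>B\<^esup>\<close> at 1. It begins with \<open>1 + (AB - BA) / 24\<close>, and satisfies the hexagon identities with
  both braidings \<open>\<tau> e\<^bsup>t/2\<^esup>\<close> and \<open>\<tau> e\<^bsup>-t/2\<^esup>\<close>.
\<close>

definition KZ_coeff :: "bool list \<Rightarrow> complex" where
  "KZ_coeff w =
     of_real (Lim (at_right 0) (\<lambda>\<epsilon>.
       ncs_mult (ncs_exp True (- ln \<epsilon>))
         (ncs_mult (\<lambda>v. kz_transport \<epsilon> v (1 - \<epsilon>)) (ncs_exp False (ln \<epsilon>))) w))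
     / (2 * of_real pi * \<i>) ^ length w"

text \<open>
  The sum of the matrices \<open>F n\<close>, provided that \<open>F n\<close> is divisible by the \<open>n\<close>-th power of the formal
  parameter: then only the terms with \<open>n \<le> m\<close> contribute to the coefficient of degree \<open>m\<close>.
\<close>

definition formal_sum :: "(nat \<Rightarrow> complex fps^'s^'t) \<Rightarrow> complex fps^'s^'t" where
  "formal_sum F = (\<chi> i j. Abs_fps (\<lambda>m. \<Sum>n\<le>m. fps_nth (F n $ i $ j) m))"

primrec word_eval :: "'k::semiring_1^'s^'s \<Rightarrow> 'k^'s^'s \<Rightarrow> bool list \<Rightarrow> 'k^'s^'s" where
  "word_eval A B [] = mat 1"
| "word_eval A B (a # w) = (if a then B else A) ** word_eval A B w"

definition KZ_eval :: "complex fps^'s^'s \<Rightarrow> complex fps^'s^'s \<Rightarrow> complex fps^'s^'s" where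
  "KZ_eval A B =
     formal_sum (\<lambda>n. \<Sum>w | length w = n. fps_const (KZ_coeff w) \<odot> word_eval A B w)"

definition mat_exp :: "complex fps^'s^'s \<Rightarrow> complex fps^'s^'s" where
  "mat_exp A = formal_sum (\<lambda>n. fps_const (1 / fact n) \<odot> word_eval A A (replicate n False))"

definition chord ::
  "complex \<Rightarrow> ('l \<Rightarrow> complex^'l) \<Rightarrow> ('l \<Rightarrow> complex^'l) \<Rightarrow>
   (complex^'l \<Rightarrow> complex^'a^'a) \<Rightarrow> (complex^'l \<Rightarrow> complex^'b^'b) \<Rightarrow>
   complex fps^('a \<times> 'b)^('a \<times> 'b)" where
  "chord h x y R T =
     (fps_X ^ 2 * fps_const (1 / h)) \<odot> fps_mat (\<Sum>a\<in>UNIV. R (x a) \<otimes> T (y a))"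

text \<open>
  The associativity isomorphism from \<open>(R \<otimes> S) \<otimes> T\<close> to \<open>R \<otimes> (S \<otimes> T)\<close>. For a tensor product of strands,
  \<open>chord\<close> with the tensor product representation is the sum of the chords ending on these strands.
\<close>

definition associator ::
  "complex \<Rightarrow> ('l \<Rightarrow> complex^'l) \<Rightarrow> ('l \<Rightarrow> complex^'l) \<Rightarrow>
   (complex^'l \<Rightarrow> complex^'a^'a) \<Rightarrow> (complex^'l \<Rightarrow> complex^'b^'b) \<Rightarrow> (complex^'l \<Rightarrow> complex^'c^'c) \<Rightarrow>
   complex fps^(('a \<times> 'b) \<times> 'c)^('a \<times> ('b \<times> 'c))" where
  "associator h x y R S T =
     reassoc ** KZ_eval (chord h x y R S \<otimes> mat 1)
                        (reassoc_inv ** (mat 1 \<otimes> chord h x y S T) ** reassoc)"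

text \<open>The endomorphism \<open>(p \<otimes> id) \<Phi> (id \<otimes> b)\<close> of \<open>V\<close>; here \<open>\<Phi>\<close> goes from \<open>V \<otimes> (V \<otimes> V)\<close> to \<open>(V \<otimes> V) \<otimes> V\<close>.\<close>

definition zigzag ::
  "complex \<Rightarrow> ('l \<Rightarrow> complex^'l) \<Rightarrow> ('l \<Rightarrow> complex^'l) \<Rightarrow> (complex^'l \<Rightarrow> complex^'v^'v) \<Rightarrow>
   complex^('v \<times> 'v)^unit \<Rightarrow> complex^unit^('v \<times> 'v) \<Rightarrow> complex fps^'v^'v" where
  "zigzag h x y R p b =
     lunit ** (fps_mat p \<otimes> mat 1) ** matrix_inv (associator h x y R R R)
       ** (mat 1 \<otimes> fps_mat b) ** runit_inv"


section \<open>The invariant on elementary tangles\<close>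

text \<open>
  The elementary tangles with four solid ends: positive crossing, two parallel strands, cap followed by
  cup, solid H, solid H rotated by 90 degrees, and H with dashed middle edge.
\<close>

datatype elementary_tangle = X_plus | Id_tangle | S_tangle | H_tangle | I_tangle | H_da

text \<open>
  The rotation of an endomorphism \<open>M\<close> of \<open>V \<otimes> V\<close>. The cup creates strands 1 and 2 to the left of the
  two incoming strands 3 and 4, \<open>M\<close> acts on strands 2 and 3, and the cap closes strands 3 and 4.
  \<open>q\<close> is the square root of \<open>c\<close> in the values of cap and cup. The parenthesizations
  are \<open>(12)(34)\<close>, \<open>1(2(34))\<close>, \<open>1((23)4)\<close> and back.
\<close>

definition rotate_endo ::
  "complex \<Rightarrow> ('l \<Rightarrow> complex^'l) \<Rightarrow> ('l \<Rightarrow> complex^'l) \<Rightarrow> (complex^'l \<Rightarrow> complex^'v^'v) \<Rightarrow>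
   complex^('v \<times> 'v)^unit \<Rightarrow> complex^unit^('v \<times> 'v) \<Rightarrow> complex fps \<Rightarrow>
   complex fps^('v \<times> 'v)^('v \<times> 'v) \<Rightarrow> complex fps^('v \<times> 'v)^('v \<times> 'v)" where
  "rotate_endo h x y R p b q M =
     runit ** (mat 1 \<otimes> (q \<odot> fps_mat p))
       ** matrix_inv (associator h x y R R (tensor_rep R R))
       ** (mat 1 \<otimes> associator h x y R R R)
       ** (mat 1 \<otimes> (M \<otimes> mat 1))
       ** (mat 1 \<otimes> matrix_inv (associator h x y R R R))
       ** associator h x y R R (tensor_rep R R)
       ** ((q \<odot> fps_mat b) \<otimes> mat 1) ** lunit_inv"

primrec tangle_invariant ::
  "complex \<Rightarrow> ('l \<Rightarrow> complex^'l) \<Rightarrow> ('l \<Rightarrow> complex^'l) \<Rightarrow> (complex^'l \<Rightarrow> complex^'v^'v) \<Rightarrow>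
   complex^('v \<times> 'v)^unit \<Rightarrow> complex^unit^('v \<times> 'v) \<Rightarrow> complex fps \<Rightarrow> complex fps \<Rightarrow>
   complex fps \<Rightarrow> complex fps \<Rightarrow>
   complex^('v \<times> 'v)^('v \<times> 'v) \<Rightarrow> complex^('v \<times> 'v)^('v \<times> 'v) \<Rightarrow> complex^('v \<times> 'v)^('v \<times> 'v) \<Rightarrow>
   elementary_tangle \<Rightarrow> complex fps^('v \<times> 'v)^('v \<times> 'v)" where
  "tangle_invariant h x y R p b c q r s \<pi>C \<pi>V \<pi>L X_plus =
     flip ** mat_exp (fps_const (- 1 / 2) \<odot> chord h x y R R)"
| "tangle_invariant h x y R p b c q r s \<pi>C \<pi>V \<pi>L Id_tangle = mat 1"
| "tangle_invariant h x y R p b c q r s \<pi>C \<pi>V \<pi>L S_tangle = (26 * c) \<odot> fps_mat \<pi>C"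
| "tangle_invariant h x y R p b c q r s \<pi>C \<pi>V \<pi>L H_tangle = r \<odot> fps_mat \<pi>V"
| "tangle_invariant h x y R p b c q r s \<pi>C \<pi>V \<pi>L I_tangle =
     rotate_endo h x y R p b q (r \<odot> fps_mat \<pi>V)"
| "tangle_invariant h x y R p b c q r s \<pi>C \<pi>V \<pi>L H_da = s \<odot> fps_mat \<pi>L"

end

theory Submission
  imports Defs
begin

text \<open>
  Why the relation holds: \<open>End(V \<otimes> V)\<close> has dimension at most 5, because an intertwiner is determined by the
  image of \<open>s = v\<^sub>- \<otimes> v\<^sub>+\<close> (lowest and highest weight vector), and that image corresponds to an endomorphism
  of \<open>V\<close> that commutes with the subalgebra \<open>B\<^sub>3\<close> and satisfies one further linear condition. The classical
  limits of \<open>Id\<close>, \<open>S\<close>, \<open>H\<close>, \<open>I\<close> and \<open>H\<^sub>d\<^sub>a\<close> are linearly independent: the projections vanish on the highest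
  weight vectors of the summands \<open>U\<close> and \<open>W\<close>, and crossing symmetry expresses the eigenvalues of the rotated
  \<open>\<pi>\<^sub>V\<close> there through \<open>n = (\<pi>\<^sub>V s, s)\<close> and \<open>n' = (f\<^sub>4 e\<^sub>4 \<pi>\<^sub>V s, s)\<close> (with \<open>e\<^sub>4 = e 3\<close>): up to a common
  factor they are \<open>n\<close> and \<open>n - 2 n'\<close>, and \<open>n' \<noteq> 0\<close>. Associators, braidings and rotations are equivariant coefficient by
  coefficient, whatever the coefficients of the associator are, so every value of the invariant is a
  combination of these five maps over the power series; in \<open>I\<close> the coefficient of the rotated \<open>\<pi>\<^sub>V\<close> is a
  non-zero multiple of a series with constant term 1.
\<close>

text \<open>\<open>unbundle no fps_syntax\<close> would refer to the bundle of that name for Laurent series.\<close>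

no_notation fps_nth (infixl \<open>$\<close> 75)

lemma smul_nth [simp]: "(c \<odot> A) $ i $ j = c * A $ i $ j"
  by (simp add: smul_def)

lemma kron_nth [simp]: "(A \<otimes> B) $ i $ j = A $ fst i $ fst j * B $ snd i $ snd j"
  by (simp add: kron_def)

lemma sum_UNIV_prod:
  fixes g :: "'a::finite \<times> 'b::finite \<Rightarrow> 'c::comm_monoid_add"
  shows "(\<Sum>k\<in>UNIV. g k) = (\<Sum>i\<in>UNIV. \<Sum>j\<in>UNIV. g (i, j))"
  by (simp add: sum.cartesian_product)

lemma matrix_add_rdistrib: "(A + B) ** C = A ** C + B ** (C :: 'k::semiring_1^'s^'t)"
  by (simp add: vec_eq_iff matrix_matrix_mult_def distrib_right sum.distrib)

lemma kron_mult:
  fixes A :: "'k::comm_semiring_1^'s^'t"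
  shows "(A \<otimes> B) ** (C \<otimes> D) = (A ** C) \<otimes> (B ** D)"
  by (simp add: vec_eq_iff matrix_matrix_mult_def sum_UNIV_prod sum_product mult.assoc mult.left_commute)

lemma kron_add_left: "(A + B) \<otimes> C = A \<otimes> C + B \<otimes> (C :: 'k::comm_semiring_1^'s^'t)"
  by (simp add: vec_eq_iff distrib_right)

lemma kron_add_right: "C \<otimes> (A + B) = C \<otimes> A + C \<otimes> (B :: 'k::comm_semiring_1^'s^'t)"
  by (simp add: vec_eq_iff distrib_left)

lemma kron_sum_left: "(\<Sum>a\<in>S. A a) \<otimes> C = (\<Sum>a\<in>S. A a \<otimes> (C :: 'k::comm_semiring_1^'s^'t))"
  by (induction S rule: infinite_finite_induct) (simp_all add: kron_add_left vec_eq_iff)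

lemma kron_sum_right: "C \<otimes> (\<Sum>a\<in>S. A a) = (\<Sum>a\<in>S. (C :: 'k::comm_semiring_1^'s^'t) \<otimes> A a)"
  by (induction S rule: infinite_finite_induct) (simp_all add: kron_add_right vec_eq_iff)

lemma kron_one: "mat 1 \<otimes> mat 1 = (mat 1 :: 'k::comm_semiring_1^('a::finite \<times> 'b::finite)^('a \<times> 'b))"
  by (auto simp: vec_eq_iff mat_def prod_eq_iff)

lemma smul_mult_left: "(c \<odot> A) ** B = c \<odot> (A ** (B :: 'k::comm_semiring_1^'s^'t))"
  by (simp add: vec_eq_iff matrix_matrix_mult_def sum_distrib_left mult.assoc)

lemma smul_mult_right: "A ** (c \<odot> B) = c \<odot> (A ** (B :: 'k::comm_semiring_1^'s^'t))"
  by (simp add: vec_eq_iff matrix_matrix_mult_def sum_distrib_left mult.left_commute)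

lemma smul_kron_left: "(c \<odot> A) \<otimes> B = c \<odot> (A \<otimes> (B :: 'k::comm_semiring_1^'s^'t))"
  by (simp add: vec_eq_iff mult.assoc)

lemma smul_kron_right: "A \<otimes> (c \<odot> B) = c \<odot> (A \<otimes> (B :: 'k::comm_semiring_1^'s^'t))"
  by (simp add: vec_eq_iff mult.left_commute)

lemma smul_smul: "c \<odot> (d \<odot> A) = (c * d) \<odot> A"
  by (simp add: vec_eq_iff mult.assoc)

lemma smul_one [simp]: "1 \<odot> A = A"
  by (simp add: vec_eq_iff)

lemma smul_add_right: "c \<odot> (A + B) = c \<odot> A + c \<odot> B"
  by (simp add: vec_eq_iff distrib_left)

lemma smul_sum_right: "c \<odot> (\<Sum>a\<in>S. A a) = (\<Sum>a\<in>S. c \<odot> A a)"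
  by (induction S rule: infinite_finite_induct) (simp_all add: smul_add_right vec_eq_iff)

lemma smul_matrix_vector: "(c \<odot> A) *v x = c *s (A *v (x :: 'k::comm_semiring_1^'s))"
  by (simp add: vec_eq_iff matrix_vector_mult_def sum_distrib_left mult.assoc)

lemma reindex_mult_right:
  fixes A :: "'k::semiring_1^'t^'w" and g :: "'s::finite \<Rightarrow> 't::finite"
  shows "(A ** reindex g) $ i $ j = A $ i $ g j"
  by (simp add: matrix_matrix_mult_def reindex_def if_distrib cong: if_cong)

lemma reindex_comp:
  fixes f :: "'s::finite \<Rightarrow> 't::finite" and g :: "'w::finite \<Rightarrow> 's"
  shows "reindex f ** reindex g = (reindex (f \<circ> g) :: 'k::semiring_1^'w^'t)"
  by (simp add: vec_eq_iff reindex_mult_right) (simp add: reindex_def)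

lemma reindex_id: "reindex (\<lambda>x. x) = (mat 1 :: 'k::semiring_1^'s^'s)"
  by (simp add: vec_eq_iff reindex_def mat_def)

lemma reassoc_inverse:
  shows "reassoc ** reassoc_inv = (mat 1 :: 'k::semiring_1^('a::finite \<times> ('b::finite \<times> 'c::finite))^('a \<times> ('b \<times> 'c)))"
    and "reassoc_inv ** reassoc = (mat 1 :: 'k^(('a \<times> 'b) \<times> 'c)^(('a \<times> 'b) \<times> 'c))"
  by (simp_all add: reassoc_def reassoc_inv_def reindex_comp reindex_id[symmetric] o_def case_prod_unfold)

lemma matrix_inv_works:
  assumes "invertible A"
  shows "A ** matrix_inv A = mat 1" "matrix_inv A ** A = mat 1"
  using assms unfolding invertible_def matrix_inv_def by (metis (mono_tags, lifting) someI_ex)+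

lemma matrix_inv_eqI:
  assumes "A ** B = mat 1" "B ** A = mat 1"
  shows "invertible A" "matrix_inv A = B"
proof -
  show inv: "invertible A"
    using assms unfolding invertible_def by blast
  have "matrix_inv A = matrix_inv A ** (A ** B)"
    by (simp add: assms)
  also have "\<dots> = B"
    by (simp add: matrix_mul_assoc matrix_inv_works[OF inv])
  finally show "matrix_inv A = B" .
qed

section \<open>Elementary tensors\<close>

definition tens :: "'k::semiring_1^'a \<Rightarrow> 'k^'b \<Rightarrow> 'k^('a \<times> 'b)" where
  "tens x y = (\<chi> i. x $ fst i * y $ snd i)"

lemma tens_nth [simp]: "tens x y $ i = x $ fst i * y $ snd i"
  by (simp add: tens_def)

lemma kron_tens: "(A \<otimes> B) *v tens x y = tens (A *v x) (B *v (y :: 'k::comm_semiring_1^'t))"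
  by (simp add: vec_eq_iff matrix_vector_mult_def sum_UNIV_prod sum_product mult.assoc mult.left_commute)

lemma tens_add_left: "tens (x + x') y = tens x y + tens x' y"
  by (simp add: vec_eq_iff distrib_right)

lemma tens_add_right: "tens x (y + y') = tens x y + tens x y'"
  by (simp add: vec_eq_iff distrib_left)

lemma tens_smult_left: "tens (c *s x) y = c *s tens x y"
  by (simp add: vec_eq_iff mult.assoc)

lemma tens_smult_right: "tens x (c *s y) = c *s tens x (y :: 'k::comm_semiring_1^'t)"
  by (simp add: vec_eq_iff mult.left_commute)

lemma tens_zero [simp]: "tens 0 y = 0" "tens x 0 = 0"
  by (simp_all add: vec_eq_iff)

lemma tensor_rep_tens: "tensor_rep R T g *v tens x y = tens (R g *v x) y + tens x (T g *v y)"
  by (simp add: tensor_rep_def matrix_vector_mult_add_rdistrib kron_tens)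

lemma flip_tens: "flip *v tens x y = tens y (x :: 'k::comm_semiring_1^'a)"
proof -
  have *: "(i = prod.swap j) \<longleftrightarrow> (j = prod.swap i)" for i j :: "'a \<times> 'a" by auto
  show ?thesis
    by (simp add: vec_eq_iff flip_def reindex_def matrix_vector_mult_def * mult.commute
             if_distrib if_distribR cong: if_cong)
qed

section \<open>Matrices of formal power series\<close>

definition coefm :: "nat \<Rightarrow> complex fps^'s^'t \<Rightarrow> complex^'s^'t" where
  "coefm n M = (\<chi> i j. fps_nth (M $ i $ j) n)"

lemma coefm_nth [simp]: "coefm n M $ i $ j = fps_nth (M $ i $ j) n"
  by (simp add: coefm_def)

lemma coefm_eqI: "(\<And>n. coefm n A = coefm n B) \<Longrightarrow> A = B"
  by (simp add: vec_eq_iff fps_eq_iff)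

lemma coefm_mult: "coefm n (A ** B) = (\<Sum>k=0..n. coefm k A ** coefm (n - k) B)"
proof -
  have "(\<Sum>k\<in>UNIV. \<Sum>m=0..n. fps_nth (A $ i $ k) m * fps_nth (B $ k $ j) (n - m)) =
      (\<Sum>m=0..n. \<Sum>k\<in>UNIV. fps_nth (A $ i $ k) m * fps_nth (B $ k $ j) (n - m))" for i j
    by (rule sum.swap)
  then show ?thesis
    by (simp add: vec_eq_iff matrix_matrix_mult_def fps_sum_nth fps_mult_nth)
qed

lemma coefm_kron: "coefm n (A \<otimes> B) = (\<Sum>k=0..n. coefm k A \<otimes> coefm (n - k) B)"
  by (simp add: vec_eq_iff fps_mult_nth)

lemma coefm_smul: "coefm n (c \<odot> A) = (\<Sum>k=0..n. fps_nth c k \<odot> coefm (n - k) A)"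
  by (simp add: vec_eq_iff fps_mult_nth)

lemma coefm_add [simp]: "coefm n (A + B) = coefm n A + coefm n B"
  by (simp add: vec_eq_iff)

lemma coefm_sum: "coefm n (\<Sum>a\<in>S. A a) = (\<Sum>a\<in>S. coefm n (A a))"
  by (induction S rule: infinite_finite_induct) (simp_all add: vec_eq_iff)

lemma coefm_fps_mat: "coefm n (fps_mat A) = (if n = 0 then A else 0)"
  by (simp add: vec_eq_iff fps_mat_def)

lemma sum_coefm_fps_mat:
  assumes "\<And>M. g M 0 = 0"
  shows "(\<Sum>k=0..n. g (f k) (coefm (n - k) (fps_mat A))) = (g (f n) A :: 'a::comm_monoid_add)"
proof -
  have "(\<Sum>k=0..n. g (f k) (coefm (n - k) (fps_mat A))) = (\<Sum>k=0..n. if k = n then g (f n) A else 0)"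
    by (intro sum.cong) (auto simp: coefm_fps_mat assms)
  then show ?thesis by simp
qed

lemma sum_coefm_fps_mat':
  assumes "\<And>M. g 0 M = 0"
  shows "(\<Sum>k=0..n. g (coefm k (fps_mat A)) (f (n - k))) = (g A (f n) :: 'a::comm_monoid_add)"
proof -
  have "(\<Sum>k=0..n. g (coefm k (fps_mat A)) (f (n - k))) = (\<Sum>k=0..n. if k = 0 then g A (f n) else 0)"
    by (intro sum.cong) (auto simp: coefm_fps_mat assms)
  then show ?thesis by simp
qed

lemma kron_zero [simp]: "(A :: 'k::semiring_1^'s^'t) \<otimes> 0 = 0" "0 \<otimes> (A :: 'k::semiring_1^'s^'t) = 0"
  by (simp_all add: vec_eq_iff)

lemma coefm_mult_fps_mat [simp]: "coefm n (M ** fps_mat A) = coefm n M ** A"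
  unfolding coefm_mult
  by (rule sum_coefm_fps_mat[where g = "\<lambda>x y. x ** y"], simp)

lemma coefm_fps_mat_mult [simp]: "coefm n (fps_mat A ** M) = A ** coefm n M"
  unfolding coefm_mult
  by (rule sum_coefm_fps_mat'[where g = "\<lambda>x y. x ** y"], simp)

lemma coefm_kron_fps_mat [simp]:
  "coefm n (M \<otimes> fps_mat A) = coefm n M \<otimes> A" "coefm n (fps_mat A \<otimes> M) = A \<otimes> coefm n M"
  unfolding coefm_kron
  by (rule sum_coefm_fps_mat[where g = "\<lambda>x y. x \<otimes> y"], simp)
    (rule sum_coefm_fps_mat'[where g = "\<lambda>x y. x \<otimes> y"], simp)

lemma fps_mat_mat: "fps_mat (mat 1) = mat 1"
  by (simp add: vec_eq_iff fps_mat_def mat_def)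

lemma fps_mat_reindex: "fps_mat (reindex g) = reindex g"
  by (simp add: vec_eq_iff fps_mat_def reindex_def)

lemma coefm_mat: "coefm n (mat 1) = (if n = 0 then mat 1 else 0)"
  by (simp add: fps_mat_mat[symmetric] coefm_fps_mat)

lemma coefm_0_mult: "coefm 0 (A ** B) = coefm 0 A ** coefm 0 B"
  by (simp add: coefm_mult)

lemma coefm_0_kron: "coefm 0 (A \<otimes> B) = coefm 0 A \<otimes> coefm 0 B"
  by (simp add: coefm_kron)

lemma coefm_0_smul: "coefm 0 (c \<odot> A) = fps_nth c 0 \<odot> coefm 0 A"
  by (simp add: coefm_smul)

text \<open>The coefficients of the right inverse of \<open>\<Sum>\<^sub>n M n X\<^sup>n\<close>, given an inverse \<open>J\<close> of \<open>M 0\<close>.\<close>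

fun inv_coeff :: "(nat \<Rightarrow> complex^'s^'s) \<Rightarrow> complex^'s^'s \<Rightarrow> nat \<Rightarrow> complex^'s^'s" where
  "inv_coeff M J n = J ** ((if n = 0 then mat 1 else 0) - (\<Sum>k\<in>{1..n}. M k ** inv_coeff M J (n - k)))"

declare inv_coeff.simps [simp del]

lemma fps_matrix_right_inverse:
  fixes M :: "complex fps^'s^'s"
  assumes J: "coefm 0 M ** J = mat 1"
  shows "\<exists>N. M ** N = mat 1 \<and> coefm 0 N = J"
proof -
  define N :: "complex fps^'s^'s" where "N = (\<chi> i j. Abs_fps (\<lambda>n. inv_coeff (\<lambda>k. coefm k M) J n $ i $ j))"
  have N: "coefm n N = inv_coeff (\<lambda>k. coefm k M) J n" for n
    by (simp add: N_def vec_eq_iff)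
  have "coefm n (M ** N) = coefm n (mat 1)" for n
  proof -
    have "coefm n (M ** N) = coefm 0 M ** coefm n N + (\<Sum>k\<in>{1..n}. coefm k M ** coefm (n - k) N)"
      by (simp add: coefm_mult sum.atLeast_Suc_atMost)
    also have "coefm 0 M ** coefm n N =
        (if n = 0 then mat 1 else 0) - (\<Sum>k\<in>{1..n}. coefm k M ** coefm (n - k) N)"
      by (subst N, subst inv_coeff.simps) (simp add: N matrix_mul_assoc J)
    finally show ?thesis by (simp add: coefm_mat)
  qed
  then have "M ** N = mat 1" by (rule coefm_eqI)
  moreover have "coefm 0 N = J"
    by (subst N, subst inv_coeff.simps) simp
  ultimately show ?thesis by blast
qed

lemma fps_matrix_inverse:
  fixes M :: "complex fps^'s^'s"
  assumes "coefm 0 M = mat 1"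
  shows "\<exists>N. M ** N = mat 1 \<and> N ** M = mat 1 \<and> coefm 0 N = mat 1"
proof -
  obtain N where N: "M ** N = mat 1" "coefm 0 N = mat 1"
    using fps_matrix_right_inverse[of M "mat 1"] assms by auto
  obtain N' where N': "N ** N' = mat 1"
    using fps_matrix_right_inverse[of N "mat 1"] N(2) by auto
  have "M = M ** (N ** N')" by (simp add: N')
  also have "\<dots> = N'" by (simp add: matrix_mul_assoc N(1))
  finally have "N ** M = mat 1" using N' by simp
  with N show ?thesis by blast
qed

section \<open>Equivariant matrices of formal power series\<close>

lemma intertwiner_comp:
  "intertwiner R S A \<Longrightarrow> intertwiner S T B \<Longrightarrow> intertwiner R T (B ** A)"
  unfolding intertwiner_def by (metis matrix_mul_assoc)

lemma intertwiner_kron: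
  assumes "intertwiner R R' A" "intertwiner S S' B"
  shows "intertwiner (tensor_rep R S) (tensor_rep R' S') (A \<otimes> B)"
  using assms unfolding intertwiner_def tensor_rep_def
  by (simp add: matrix_add_ldistrib matrix_add_rdistrib kron_mult)

lemma intertwiner_zero: "intertwiner R S 0"
  by (simp add: intertwiner_def)

lemma intertwiner_add: "intertwiner R S A \<Longrightarrow> intertwiner R S B \<Longrightarrow> intertwiner R S (A + B)"
  by (simp add: intertwiner_def matrix_add_ldistrib matrix_add_rdistrib)

lemma intertwiner_smul: "intertwiner R S A \<Longrightarrow> intertwiner R S (c \<odot> A)"
  by (simp add: intertwiner_def smul_mult_left smul_mult_right)

lemma intertwiner_sum: "(\<And>a. a \<in> I \<Longrightarrow> intertwiner R S (A a)) \<Longrightarrow> intertwiner R S (\<Sum>a\<in>I. A a)"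
  by (induction I rule: infinite_finite_induct) (auto intro: intertwiner_zero intertwiner_add)

lemma intertwiner_id: "intertwiner R R (mat 1)"
  by (simp add: intertwiner_def)

lemma reindex_mult_left:
  fixes A :: "'k::semiring_1^'w^'s::finite" and g :: "'s \<Rightarrow> 't::finite"
  assumes "\<And>i. g (f i) = i" "\<And>j. f (g j) = j"
  shows "(reindex g ** A) $ i $ j = A $ f i $ j"
proof -
  have "(i = g k) \<longleftrightarrow> (k = f i)" for k using assms by metis
  then show ?thesis
    by (simp add: matrix_matrix_mult_def reindex_def if_distribR if_distrib cong: if_cong)
qed

lemma intertwiner_reindex:
  fixes R :: "complex^'l \<Rightarrow> complex^'a^'a" and S :: "complex^'l \<Rightarrow> complex^'b^'b"
    and g :: "'a::finite \<Rightarrow> 'b::finite"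
  assumes "\<And>i. g (f i) = i" "\<And>j. f (g j) = j"
    and "\<And>x i j. R x $ i $ j = S x $ g i $ g j"
  shows "intertwiner R S (reindex g)"
  unfolding intertwiner_def vec_eq_iff
  using assms by (simp add: reindex_mult_right reindex_mult_left[of g f])

lemma intertwiner_reassoc:
  "intertwiner (tensor_rep (tensor_rep R S) T) (tensor_rep R (tensor_rep S T)) reassoc"
  unfolding reassoc_def
  by (rule intertwiner_reindex[where f = "\<lambda>(a, (b, c)). ((a, b), c)"])
    (auto simp: tensor_rep_def mat_def algebra_simps)

lemma intertwiner_reassoc_inv:
  "intertwiner (tensor_rep R (tensor_rep S T)) (tensor_rep (tensor_rep R S) T) reassoc_inv"
  unfolding reassoc_inv_def
  by (rule intertwiner_reindex[where f = "\<lambda>((a, b), c). (a, (b, c))"])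
    (auto simp: tensor_rep_def mat_def algebra_simps)

lemma intertwiner_lunit_inv: "intertwiner R (tensor_rep trivial_rep R) lunit_inv"
  unfolding lunit_inv_def
  by (rule intertwiner_reindex[where f = snd]) (auto simp: tensor_rep_def trivial_rep_def mat_def)

lemma intertwiner_runit: "intertwiner (tensor_rep R trivial_rep) R runit"
  unfolding runit_def
  by (rule intertwiner_reindex[where f = "\<lambda>a. (a, ())"]) (auto simp: tensor_rep_def trivial_rep_def mat_def)

lemma intertwiner_flip: "intertwiner (tensor_rep R R) (tensor_rep R R) flip"
  unfolding flip_def
  by (rule intertwiner_reindex[where f = prod.swap]) (auto simp: tensor_rep_def mat_def algebra_simps)

definition equivariant ::
  "(complex^'l \<Rightarrow> complex^'a^'a) \<Rightarrow> (complex^'l \<Rightarrow> complex^'b^'b) \<Rightarrow> complex fps^'a^'b \<Rightarrow> bool" where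
  "equivariant R S M \<longleftrightarrow> (\<forall>n. intertwiner R S (coefm n M))"

lemma equivariant_alt: "equivariant R S M \<longleftrightarrow> (\<forall>x. M ** fps_mat (R x) = fps_mat (S x) ** M)"
proof
  assume "equivariant R S M"
  then show "\<forall>x. M ** fps_mat (R x) = fps_mat (S x) ** M"
    by (auto intro!: coefm_eqI simp: equivariant_def intertwiner_def)
next
  assume *: "\<forall>x. M ** fps_mat (R x) = fps_mat (S x) ** M"
  have "coefm n M ** R x = S x ** coefm n M" for n x
    using arg_cong[OF *[rule_format, of x], of "coefm n"] by simp
  then show "equivariant R S M" by (simp add: equivariant_def intertwiner_def)
qed

lemma equivariant_comp:
  "equivariant S T B \<Longrightarrow> equivariant R S A \<Longrightarrow> equivariant R T (B ** A)"
  by (auto simp: equivariant_def coefm_mult intro!: intertwiner_sum intertwiner_comp)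

lemma equivariant_kron:
  "equivariant R R' A \<Longrightarrow> equivariant S S' B \<Longrightarrow>
   equivariant (tensor_rep R S) (tensor_rep R' S') (A \<otimes> B)"
  by (auto simp: equivariant_def coefm_kron intro!: intertwiner_sum intertwiner_kron)

lemma equivariant_smul: "equivariant R S A \<Longrightarrow> equivariant R S (c \<odot> A)"
  by (auto simp: equivariant_def coefm_smul intro!: intertwiner_sum intertwiner_smul)

lemma equivariant_sum: "(\<And>a. a \<in> I \<Longrightarrow> equivariant R S (A a)) \<Longrightarrow> equivariant R S (\<Sum>a\<in>I. A a)"
  by (auto simp: equivariant_def coefm_sum intro!: intertwiner_sum)

lemma equivariant_fps_mat: "intertwiner R S A \<Longrightarrow> equivariant R S (fps_mat A)"
  by (simp add: equivariant_def coefm_fps_mat intertwiner_zero)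

lemma equivariant_id: "equivariant R R (mat 1)"
  by (simp add: fps_mat_mat[symmetric] equivariant_fps_mat intertwiner_id)

lemma equivariant_matrix_inv:
  assumes "invertible M" "equivariant R S M"
  shows "equivariant S R (matrix_inv M)"
  unfolding equivariant_alt
proof
  fix x
  note M = matrix_inv_works[OF assms(1)]
  have "matrix_inv M ** fps_mat (S x) = matrix_inv M ** (fps_mat (S x) ** M) ** matrix_inv M"
    by (simp add: matrix_mul_assoc[symmetric] M)
  also have "\<dots> = matrix_inv M ** (M ** fps_mat (R x)) ** matrix_inv M"
    using assms(2) by (simp add: equivariant_alt)
  also have "\<dots> = fps_mat (R x) ** matrix_inv M"
    by (simp add: matrix_mul_assoc M)
  finally show "matrix_inv M ** fps_mat (S x) = fps_mat (R x) ** matrix_inv M" .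
qed

lemma equivariant_reassoc:
  "equivariant (tensor_rep (tensor_rep R S) T) (tensor_rep R (tensor_rep S T)) reassoc"
  "equivariant (tensor_rep R (tensor_rep S T)) (tensor_rep (tensor_rep R S) T) reassoc_inv"
  using equivariant_fps_mat[OF intertwiner_reassoc[of R S T]]
    equivariant_fps_mat[OF intertwiner_reassoc_inv[of R S T]]
  by (simp_all add: reassoc_def reassoc_inv_def fps_mat_reindex)

lemma equivariant_units:
  "equivariant R (tensor_rep trivial_rep R) lunit_inv" "equivariant (tensor_rep R trivial_rep) R runit"
  using equivariant_fps_mat[OF intertwiner_lunit_inv[of R]] equivariant_fps_mat[OF intertwiner_runit[of R]]
  by (simp_all add: lunit_inv_def runit_def fps_mat_reindex)

lemma equivariant_flip: "equivariant (tensor_rep R R) (tensor_rep R R) flip"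
  using equivariant_fps_mat[OF intertwiner_flip[of R]] by (simp add: flip_def fps_mat_reindex)

lemma coefm_formal_sum: "coefm m (formal_sum F) = (\<Sum>n\<le>m. coefm m (F n))"
  by (simp add: vec_eq_iff formal_sum_def)

lemma equivariant_formal_sum:
  "(\<And>n. equivariant R S (F n)) \<Longrightarrow> equivariant R S (formal_sum F)"
  by (auto simp: equivariant_def coefm_formal_sum intro!: intertwiner_sum)

lemma equivariant_word_eval:
  "equivariant R R A \<Longrightarrow> equivariant R R B \<Longrightarrow> equivariant R R (word_eval A B w)"
  by (induction w) (auto intro: equivariant_id equivariant_comp)

lemma equivariant_KZ_eval:
  "equivariant R R A \<Longrightarrow> equivariant R R B \<Longrightarrow> equivariant R R (KZ_eval A B)"
  unfolding KZ_eval_def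
  by (intro equivariant_formal_sum equivariant_sum equivariant_smul equivariant_word_eval)

lemma equivariant_mat_exp: "equivariant R R A \<Longrightarrow> equivariant R R (mat_exp A)"
  unfolding mat_exp_def by (intro equivariant_formal_sum equivariant_smul equivariant_word_eval)

lemma KZ_coeff_Nil: "KZ_coeff [] = 1"
proof -
  have "ncs_mult (ncs_exp True (- ln \<epsilon>)) (ncs_mult (\<lambda>v. kz_transport \<epsilon> v (1 - \<epsilon>)) (ncs_exp False (ln \<epsilon>))) [] = 1"
    for \<epsilon> :: real by (simp add: ncs_mult_def ncs_exp_def)
  then have "KZ_coeff [] = of_real (Lim (at_right (0::real)) (\<lambda>\<epsilon>. 1 :: real))"
    unfolding KZ_coeff_def by simp
  also have "Lim (at_right (0::real)) (\<lambda>\<epsilon>. 1 :: real) = 1"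
    by (rule tendsto_Lim) simp_all
  finally show ?thesis by simp
qed

lemma coefm_0_KZ_eval: "coefm 0 (KZ_eval A B) = mat 1"
proof -
  have "{w :: bool list. w = []} = {[]}" by auto
  then show ?thesis
    by (simp add: KZ_eval_def coefm_formal_sum KZ_coeff_Nil coefm_mat fps_mat_mat)
qed

section \<open>The Casimir operator\<close>

lemma rep_add: "representation br R \<Longrightarrow> R (x + y) = R x + R y"
  unfolding representation_def Vector_Spaces.linear_def module_hom_iff by blast

lemma rep_smult: "representation br R \<Longrightarrow> R (c *s x) = c \<odot> R x"
  unfolding representation_def Vector_Spaces.linear_def module_hom_iff by blast

lemma rep_bracket: "representation br R \<Longrightarrow> R (br x y) = R x ** R y - R y ** R x"
  by (simp add: representation_def)

lemma rep_zero: "representation br R \<Longrightarrow> R 0 = 0"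
  using rep_smult[of br R 0 0] by (simp add: vec_eq_iff)

lemma rep_minus: "representation br R \<Longrightarrow> R (- x) = - R x"
  using rep_smult[of br R "-1" x] by (simp add: vec_eq_iff)

lemma rep_sum: "representation br R \<Longrightarrow> R (\<Sum>a\<in>I. c a *s x a) = (\<Sum>a\<in>I. c a \<odot> R (x a))"
  by (induction I rule: infinite_finite_induct) (simp_all add: rep_add rep_smult rep_zero)

lemma vector_space_smul: "vector_space (smul :: complex \<Rightarrow> complex^'s^'t \<Rightarrow> _)"
  by unfold_locales (simp_all add: vec_eq_iff algebra_simps)

lemma representationI:
  assumes "\<And>x y. R (x + y) = R x + R y" "\<And>c x. R (c *s x) = c \<odot> R x"
    and "\<And>x y. R (br x y) = R x ** R y - R y ** R x"
  shows "representation br R"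
proof -
  have "Vector_Spaces.linear (*s) smul R"
    unfolding Vector_Spaces.linear_def module_hom_iff
    using vector_space_smul vec.vector_space_axioms by (simp add: module_iff_vector_space assms)
  then show ?thesis by (simp add: representation_def assms)
qed

lemma matrix_diff_ldistrib: "A ** (B - C) = A ** B - A ** (C :: 'k::ring_1^'s^'t)"
  by (simp add: vec_eq_iff matrix_matrix_mult_def right_diff_distrib sum_subtractf)

lemma matrix_diff_rdistrib: "(A - B) ** C = A ** C - B ** (C :: 'k::ring_1^'s^'t)"
  by (simp add: vec_eq_iff matrix_matrix_mult_def left_diff_distrib sum_subtractf)

lemma kron_diff_left: "(A - B) \<otimes> C = A \<otimes> C - B \<otimes> (C :: 'k::comm_ring_1^'s^'t)"
  by (simp add: vec_eq_iff left_diff_distrib)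

lemma kron_diff_right: "C \<otimes> (A - B) = C \<otimes> A - C \<otimes> (B :: 'k::comm_ring_1^'s^'t)"
  by (simp add: vec_eq_iff right_diff_distrib)

lemma representation_tensor:
  assumes R: "representation br R" and T: "representation br T"
  shows "representation br (tensor_rep R T)"
proof (rule representationI)
  fix x y c
  show "tensor_rep R T (x + y) = tensor_rep R T x + tensor_rep R T y"
    by (simp add: tensor_rep_def rep_add[OF R] rep_add[OF T] kron_add_left kron_add_right)
  show "tensor_rep R T (c *s x) = c \<odot> tensor_rep R T x"
    by (simp add: tensor_rep_def rep_smult[OF R] rep_smult[OF T] smul_kron_left smul_kron_right smul_add_right)
  show "tensor_rep R T (br x y) = tensor_rep R T x ** tensor_rep R T y - tensor_rep R T y ** tensor_rep R T x"
    by (simp add: tensor_rep_def rep_bracket[OF R] rep_bracket[OF T] matrix_add_ldistrib matrix_add_rdistrib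
        kron_mult kron_diff_left kron_diff_right)
qed

context
  fixes br :: "complex^'l \<Rightarrow> complex^'l \<Rightarrow> complex^'l"
  assumes lie: "lie_algebra br"
begin

lemma br_linear:
  "br x (y + z) = br x y + br x z" "br (x + y) z = br x z + br y z"
  "br x (c *s y) = c *s br x y" "br (c *s x) y = c *s br x y"
proof -
  have r: "Vector_Spaces.linear (*s) (*s) (br x)" and l: "Vector_Spaces.linear (*s) (*s) (\<lambda>x. br x y)" for x y
    using lie by (simp_all add: lie_algebra_def)
  show "br x (y + z) = br x y + br x z" using r by (rule vec.linear_add)
  show "br x (c *s y) = c *s br x y" using r by (rule vec.linear_scale)
  show "br (x + y) z = br x z + br y z" using l by (rule vec.linear_add)
  show "br (c *s x) y = c *s br x y" using l by (rule vec.linear_scale)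
qed

lemma br_self: "br x x = 0"
  using lie by (simp add: lie_algebra_def)

lemma br_swap: "br x y = - br y x"
proof -
  have "br (x + y) (x + y) = 0" by (rule br_self)
  then have "br x x + br y x + (br x y + br y y) = 0"
    unfolding br_linear .
  then have "br x y + br y x = 0"
    by (simp add: br_self add.commute)
  then show ?thesis by (simp add: eq_neg_iff_add_eq_0)
qed

lemma br_minus: "br x (- y) = - br x y" "br (- x) y = - br x y"
  using br_linear(3)[of x "-1" y] br_linear(4)[of "-1" x y] by simp_all

lemma jacobi: "br (br x y) z = br x (br y z) - br y (br x z)"
proof -
  have "br x (br y z) + br y (br z x) + br z (br x y) = 0"
    using lie by (simp add: lie_algebra_def)
  moreover have "br y (br z x) = - br y (br x z)" by (simp add: br_swap[of z x] br_minus)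
  moreover have "br z (br x y) = - br (br x y) z" by (rule br_swap)
  ultimately show ?thesis by (simp add: algebra_simps)
qed

lemma adjoint_rep_apply: "adjoint_rep br x *v y = br x y"
  using lie by (simp add: adjoint_rep_def lie_algebra_def matrix_works)

lemma representation_adjoint: "representation br (adjoint_rep br)"
  by (rule representationI)
    (auto intro!: matrix_eq[THEN iffD2] simp: adjoint_rep_apply br_linear jacobi
       matrix_vector_mult_add_rdistrib matrix_vector_mult_diff_rdistrib smul_matrix_vector
       matrix_vector_mul_assoc[symmetric])

lemma killing_swap: "killing br x y = killing br y x"
  unfolding killing_def by (rule trace_mul_sym)

lemma killing_add: "killing br (x + y) z = killing br x z + killing br y z"
  by (simp add: killing_def rep_add[OF representation_adjoint] matrix_add_rdistrib trace_add)

lemma trace_smul: "trace (c \<odot> A) = c * trace (A :: complex^'s^'s)"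
  by (simp add: trace_def sum_distrib_left)

lemma killing_smult: "killing br (c *s x) z = c * killing br x z"
  by (simp add: killing_def rep_smult[OF representation_adjoint] smul_mult_left trace_smul)

lemma killing_zero: "killing br 0 z = 0"
  using killing_smult[of 0 0 z] by simp

lemma killing_sum: "killing br (\<Sum>a\<in>I. c a *s x a) z = (\<Sum>a\<in>I. c a * killing br (x a) z)"
  by (induction I rule: infinite_finite_induct) (simp_all add: killing_add killing_smult killing_zero)

lemma killing_invariant: "killing br (br g x) y = - killing br x (br g y)"
proof -
  let ?a = "adjoint_rep br"
  have "trace (?a g ** ?a x ** ?a y) = trace (?a x ** ?a y ** ?a g)"
    by (metis matrix_mul_assoc trace_mul_sym)
  then show ?thesis
    by (simp add: killing_def rep_bracket[OF representation_adjoint] matrix_diff_ldistrib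
        matrix_diff_rdistrib matrix_mul_assoc trace_sub)
qed

lemma dual_bases_swap: "dual_bases br x y \<Longrightarrow> dual_bases br y x"
  unfolding dual_bases_def by (metis killing_swap)

lemma dual_bases_expansion:
  assumes "dual_bases br x y"
  shows "z = (\<Sum>b\<in>UNIV. killing br z (y b) *s x b)"
proof -
  define X :: "complex^'l^'l" where "X = (\<chi> i b. x b $ i)"
  define Y :: "complex^'l^'l" where "Y = (\<chi> b i. killing br (axis i 1) (y b))"
  have Y: "(Y *v z) $ b = killing br z (y b)" for z b
  proof -
    have "killing br z (y b) = killing br (\<Sum>i\<in>UNIV. z $ i *s axis i 1) (y b)"
      by (simp add: basis_expansion)
    then show ?thesis
      by (simp add: Y_def matrix_vector_mult_def killing_sum mult.commute)
  qed
  have "Y ** X = mat 1"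
  proof -
    have "(Y ** X) $ b $ a = (Y *v x a) $ b" for a b
      by (simp add: matrix_matrix_mult_def matrix_vector_mult_def X_def)
    then show ?thesis
      using assms by (auto simp: vec_eq_iff Y mat_def dual_bases_def)
  qed
  then have "X ** Y = mat 1" by (simp add: matrix_left_right_inverse)
  then have "z = X *v (Y *v z)" by (simp add: matrix_vector_mul_assoc)
  also have "\<dots> = (\<Sum>b\<in>UNIV. killing br z (y b) *s x b)"
    unfolding matrix_vector_mult_def[of X] by (simp add: vec_eq_iff Y X_def mult.commute)
  finally show ?thesis .
qed

lemma intertwiner_casimir:
  assumes dual: "dual_bases br x y" and R: "representation br R" and T: "representation br T"
  shows "intertwiner (tensor_rep R T) (tensor_rep R T) (\<Sum>a\<in>UNIV. R (x a) \<otimes> T (y a))"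
  unfolding intertwiner_def
proof
  fix g
  let ?\<Omega> = "\<Sum>a\<in>UNIV. R (x a) \<otimes> T (y a)"
  let ?k = "killing br"
  have "tensor_rep R T g ** ?\<Omega> - ?\<Omega> ** tensor_rep R T g =
      (\<Sum>a\<in>UNIV. tensor_rep R T g ** (R (x a) \<otimes> T (y a)) - (R (x a) \<otimes> T (y a)) ** tensor_rep R T g)"
  proof -
    have "A ** (\<Sum>a\<in>UNIV. F a) - (\<Sum>a\<in>UNIV. F a) ** A = (\<Sum>a\<in>UNIV. A ** F a - F a ** A)"
      for A :: "complex^('a \<times> 'b)^('a \<times> 'b)" and F :: "'l \<Rightarrow> complex^('a \<times> 'b)^('a \<times> 'b)"
    proof -
      have "A ** sum F I - sum F I ** A = (\<Sum>a\<in>I. A ** F a - F a ** A)" for I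
        by (induction I rule: infinite_finite_induct)
          (simp_all add: matrix_add_ldistrib matrix_add_rdistrib algebra_simps)
      then show ?thesis .
    qed
    then show ?thesis .
  qed
  also have "\<dots> = (\<Sum>a\<in>UNIV. R (br g (x a)) \<otimes> T (y a) + R (x a) \<otimes> T (br g (y a)))"
    by (simp add: tensor_rep_def rep_bracket[OF R] rep_bracket[OF T] matrix_add_ldistrib
        matrix_add_rdistrib kron_mult kron_diff_left kron_diff_right algebra_simps)
  also have "\<dots> = (\<Sum>a\<in>UNIV. \<Sum>b\<in>UNIV. ?k (br g (x a)) (y b) \<odot> (R (x b) \<otimes> T (y a))) +
      (\<Sum>a\<in>UNIV. \<Sum>b\<in>UNIV. ?k (br g (y a)) (x b) \<odot> (R (x a) \<otimes> T (y b)))"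
  proof -
    have "R (br g (x a)) = (\<Sum>b\<in>UNIV. ?k (br g (x a)) (y b) \<odot> R (x b))"
      "T (br g (y a)) = (\<Sum>b\<in>UNIV. ?k (br g (y a)) (x b) \<odot> T (y b))" for a
      by (subst dual_bases_expansion[OF dual, of "br g (x a)"], rule rep_sum[OF R])
        (subst dual_bases_expansion[OF dual_bases_swap[OF dual], of "br g (y a)"], rule rep_sum[OF T])
    then show ?thesis
      by (simp add: sum.distrib kron_sum_left kron_sum_right smul_kron_left smul_kron_right)
  qed
  also have "(\<Sum>a\<in>UNIV. \<Sum>b\<in>UNIV. ?k (br g (y a)) (x b) \<odot> (R (x a) \<otimes> T (y b))) =
      (\<Sum>a\<in>UNIV. \<Sum>b\<in>UNIV. - (?k (br g (x a)) (y b) \<odot> (R (x b) \<otimes> T (y a))))"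
  proof (subst sum.swap, intro sum.cong refl)
    fix a b
    have "?k (br g (y b)) (x a) = - ?k (br g (x a)) (y b)"
      by (metis killing_invariant killing_swap)
    then show "?k (br g (y b)) (x a) \<odot> (R (x b) \<otimes> T (y a)) =
        - (?k (br g (x a)) (y b) \<odot> (R (x b) \<otimes> T (y a)))"
      by (simp add: vec_eq_iff)
  qed
  finally show "?\<Omega> ** tensor_rep R T g = tensor_rep R T g ** ?\<Omega>"
    by (simp add: sum_negf)
qed

lemma equivariant_chord:
  assumes "dual_bases br x y" "representation br R" "representation br T"
  shows "equivariant (tensor_rep R T) (tensor_rep R T) (chord h x y R T)"
  unfolding chord_def
  by (intro equivariant_smul equivariant_fps_mat intertwiner_casimir assms)

end

section \<open>Associators and rotations\<close>

lemma associator_inverse: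
  "invertible (associator h x y R S T)"
  "coefm 0 (associator h x y R S T) = reassoc"
  "coefm 0 (matrix_inv (associator h x y R S T)) = reassoc_inv"
proof -
  define K where "K = KZ_eval (chord h x y R S \<otimes> mat 1) (reassoc_inv ** (mat 1 \<otimes> chord h x y S T) ** reassoc)"
  have K: "associator h x y R S T = reassoc ** K"
    by (simp add: associator_def K_def)
  have r: "coefm 0 reassoc = reassoc" "coefm 0 reassoc_inv = reassoc_inv"
    unfolding reassoc_def reassoc_inv_def by (simp_all add: fps_mat_reindex[symmetric] coefm_fps_mat)
  show "coefm 0 (associator h x y R S T) = reassoc"
    unfolding K K_def by (simp add: coefm_0_mult coefm_0_KZ_eval r)
  have K0: "coefm 0 K = mat 1"
    by (simp add: K_def coefm_0_KZ_eval)
  obtain N where N: "K ** N = mat 1" "N ** K = mat 1" "coefm 0 N = mat 1"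
    using fps_matrix_inverse[OF K0] by (elim exE conjE)
  have 1: "associator h x y R S T ** (N ** reassoc_inv) = mat 1"
  proof -
    have "reassoc ** K ** (N ** reassoc_inv) = reassoc ** (K ** N) ** reassoc_inv"
      by (simp only: matrix_mul_assoc)
    then show ?thesis by (simp add: K N(1) reassoc_inverse)
  qed
  have 2: "(N ** reassoc_inv) ** associator h x y R S T = mat 1"
  proof -
    have "N ** reassoc_inv ** (reassoc ** K) = N ** (reassoc_inv ** reassoc) ** K"
      by (simp only: matrix_mul_assoc)
    then show ?thesis by (simp add: K N(2) reassoc_inverse)
  qed
  show "invertible (associator h x y R S T)" by (rule matrix_inv_eqI(1)[OF 1 2])
  show "coefm 0 (matrix_inv (associator h x y R S T)) = reassoc_inv"
    by (simp add: matrix_inv_eqI(2)[OF 1 2] coefm_0_mult N(3) r)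
qed

lemma equivariant_associator:
  assumes "lie_algebra br" "dual_bases br x y"
    and "representation br R" "representation br S" "representation br T"
  shows "equivariant (tensor_rep (tensor_rep R S) T) (tensor_rep R (tensor_rep S T)) (associator h x y R S T)"
    and "equivariant (tensor_rep R (tensor_rep S T)) (tensor_rep (tensor_rep R S) T)
           (matrix_inv (associator h x y R S T))"
proof -
  note ch = equivariant_chord[OF assms(1,2,3,4)] equivariant_chord[OF assms(1,2,4,5)]
  show "equivariant (tensor_rep (tensor_rep R S) T) (tensor_rep R (tensor_rep S T)) (associator h x y R S T)"
    unfolding associator_def
    by (intro equivariant_comp[OF equivariant_reassoc(1)] equivariant_KZ_eval
        equivariant_comp[OF _ equivariant_reassoc(1)] equivariant_comp[OF equivariant_reassoc(2)]
        equivariant_kron ch equivariant_id)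
  then show "equivariant (tensor_rep R (tensor_rep S T)) (tensor_rep (tensor_rep R S) T)
           (matrix_inv (associator h x y R S T))"
    by (rule equivariant_matrix_inv[OF associator_inverse(1)])
qed

lemma equivariant_rotate_endo:
  assumes "lie_algebra br" "dual_bases br x y" and R: "representation br R"
    and p: "intertwiner (tensor_rep R R) trivial_rep p" and b: "intertwiner trivial_rep (tensor_rep R R) b"
    and M: "equivariant (tensor_rep R R) (tensor_rep R R) M"
  shows "equivariant (tensor_rep R R) (tensor_rep R R) (rotate_endo h x y R p b q M)"
proof -
  let ?R2 = "tensor_rep R R"
  let ?a = "associator h x y R R R" and ?a' = "associator h x y R R ?R2"
  note as = equivariant_associator[OF assms(1,2) R R R]
    and as' = equivariant_associator[OF assms(1,2) R R representation_tensor[OF R R]]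
  note id = equivariant_id[of R]
  have 2: "equivariant (tensor_rep ?R2 ?R2) (tensor_rep ?R2 trivial_rep) (mat 1 \<otimes> (q \<odot> fps_mat p))"
    by (rule equivariant_kron[OF equivariant_id equivariant_smul[OF equivariant_fps_mat[OF p]]])
  have 8: "equivariant (tensor_rep trivial_rep ?R2) (tensor_rep ?R2 ?R2) ((q \<odot> fps_mat b) \<otimes> mat 1)"
    by (rule equivariant_kron[OF equivariant_smul[OF equivariant_fps_mat[OF b]] equivariant_id])
  note c = equivariant_comp
  show ?thesis
    unfolding rotate_endo_def
    by (rule c[OF c[OF c[OF c[OF c[OF c[OF c[OF c[OF equivariant_units(2) 2] as'(2)] equivariant_kron[OF id as(1)]]
      equivariant_kron[OF id equivariant_kron[OF M id]]] equivariant_kron[OF id as(2)]] as'(1)] 8] equivariant_units(1)])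
qed

lemma rotate_endo_smul:
  fixes R :: "complex^'l \<Rightarrow> complex^'v^'v"
  shows "rotate_endo h x y R p b q (r \<odot> M) = r \<odot> rotate_endo h x y R p b q M"
proof -
  have "(mat 1 :: complex fps^'v^'v) \<otimes> ((r \<odot> M) \<otimes> (mat 1 :: complex fps^'v^'v)) = r \<odot> (mat 1 \<otimes> (M \<otimes> mat 1))"
    by (simp only: smul_kron_left smul_kron_right)
  then show ?thesis
    unfolding rotate_endo_def by (simp only: smul_mult_left smul_mult_right)
qed

definition rotation ::
  "complex^('v \<times> 'v)^unit \<Rightarrow> complex^unit^('v \<times> 'v) \<Rightarrow>
   complex^('v \<times> 'v)^('v \<times> 'v) \<Rightarrow> complex^('v::finite \<times> 'v)^('v \<times> 'v)" where
  "rotation p b M = runit ** (mat 1 \<otimes> p) ** reassoc_inv ** (mat 1 \<otimes> reassoc) ** (mat 1 \<otimes> (M \<otimes> mat 1))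
     ** (mat 1 \<otimes> reassoc_inv) ** reassoc ** (b \<otimes> mat 1) ** lunit_inv"

lemma coefm_0_reindex [simp]: "coefm 0 (reindex g) = reindex g"
  by (simp add: fps_mat_reindex[symmetric] coefm_fps_mat)

lemma coefm_0_rotate_endo:
  "coefm 0 (rotate_endo h x y R p b q (fps_mat M)) = (fps_nth q 0)\<^sup>2 \<odot> rotation p b M"
proof -
  have r: "coefm 0 runit = runit" "coefm 0 lunit_inv = lunit_inv"
    by (simp_all add: runit_def lunit_inv_def)
  show ?thesis
    unfolding rotate_endo_def rotation_def
    by (simp add: coefm_0_mult coefm_0_kron coefm_0_smul associator_inverse r coefm_fps_mat coefm_mat
        smul_mult_left smul_mult_right smul_kron_left smul_kron_right smul_smul power2_eq_square)
qed

lemma matrix_vector_mult_smult: "A *v (c *s x) = c *s (A *v (x :: 'k::comm_semiring_1^'s))"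
  by (simp add: vec_eq_iff matrix_vector_mult_def sum_distrib_left mult.left_commute)

lemma kron_id_reindex: "mat 1 \<otimes> reindex g = (reindex (map_prod (\<lambda>x. x) g) :: 'k::comm_semiring_1^('a::finite \<times> 'b::finite)^('a \<times> 'c::finite))"
  by (auto simp: vec_eq_iff mat_def reindex_def)

lemma sum_delta_pair:
  fixes f :: "'a::finite \<Rightarrow> 'b::finite \<Rightarrow> 'c::comm_monoid_add"
  shows "(\<Sum>i\<in>UNIV. \<Sum>j\<in>UNIV. if a = i \<and> b = j then f i j else 0) = f a b"
proof -
  have "(\<Sum>j\<in>UNIV. if a = i \<and> b = j then f i j else 0) = (if a = i then f i b else 0)" for i
    by simp
  then show ?thesis by simp
qed

lemma sum_delta_pair1:
  fixes f :: "'a::finite \<Rightarrow> 'b::finite \<Rightarrow> 'd::finite \<Rightarrow> 'e::finite \<Rightarrow> 'c::comm_monoid_add"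
  shows "(\<Sum>i\<in>UNIV. \<Sum>j\<in>UNIV. \<Sum>k\<in>UNIV. \<Sum>l\<in>UNIV. if a = i \<and> b = j then f i j k l else 0)
    = (\<Sum>k\<in>UNIV. \<Sum>l\<in>UNIV. f a b k l)"
proof -
  have "(\<Sum>k\<in>UNIV. \<Sum>l\<in>UNIV. if a = i \<and> b = j then f i j k l else 0)
      = (if a = i \<and> b = j then \<Sum>k\<in>UNIV. \<Sum>l\<in>UNIV. f i j k l else 0)" for i j
    by (cases "a = i \<and> b = j") auto
  then show ?thesis by (simp only: sum_delta_pair)
qed

lemma rotation_nth:
  fixes p :: "complex^('v::finite \<times> 'v)^unit"
  shows "rotation p b M $ (i, j) $ (k, l) = (\<Sum>a\<in>UNIV. \<Sum>c\<in>UNIV. b $ (i, a) $ () * M $ (j, c) $ (a, k) * p $ () $ (c, l))"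
proof -
  define L :: "complex^('v \<times> (('v \<times> 'v) \<times> 'v))^('v \<times> 'v)" where "L = runit ** (mat 1 \<otimes> p) ** reassoc_inv ** (mat 1 \<otimes> reassoc)"
  define N :: "complex^('v \<times> 'v)^('v \<times> (('v \<times> 'v) \<times> 'v))" where "N = (mat 1 \<otimes> reassoc_inv) ** (reassoc ** ((b \<otimes> mat 1) ** lunit_inv))"
  have L: "L $ (i, j) $ (i', ((j', c), l')) = (if i = i' \<and> j = j' then p $ () $ (c, l') else 0)" for i j i' j' c l'
    unfolding L_def reassoc_def reassoc_inv_def kron_id_reindex reindex_mult_right runit_def
    by (subst reindex_mult_left[where f = "\<lambda>a. (a, ())"]) (auto simp: mat_def)
  have N: "N $ (i', ((a, k'), l')) $ (k, l) = (if k = k' \<and> l = l' then b $ (i', a) $ () else 0)" for i' a k' l' k l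
  proof -
    have "N $ (i', ((a, k'), l')) $ (k, l) = ((b \<otimes> mat 1) ** lunit_inv) $ ((i', a), (k', l')) $ (k, l)"
      unfolding N_def kron_id_reindex reassoc_inv_def reassoc_def
      by (subst reindex_mult_left[where f = "map_prod (\<lambda>x. x) (\<lambda>((a, b), c). (a, (b, c)))"], force, force,
          subst reindex_mult_left[where f = "\<lambda>(a, (b, c)). ((a, b), c)"], force, force) simp
    then show ?thesis
      by (auto simp: lunit_inv_def reindex_mult_right mat_def)
  qed
  define X :: "complex^('v \<times> (('v \<times> 'v) \<times> 'v))^('v \<times> (('v \<times> 'v) \<times> 'v))"
    where "X = mat 1 \<otimes> (M \<otimes> mat 1)"
  have X: "X $ (i1, ((j1, c), l1)) $ (i2, ((a, k2), l2)) =
      (if l1 = l2 then if i1 = i2 then M $ (j1, c) $ (a, k2) else 0 else 0)" for i1 j1 c l1 i2 a k2 l2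
    by (simp add: X_def mat_def)
  have LX: "(L ** X) $ (i, j) $ (i2, ((a, k2), l2)) =
      (if i = i2 then \<Sum>c\<in>UNIV. M $ (j, c) $ (a, k2) * p $ () $ (c, l2) else 0)" for i2 a k2 l2
  proof -
    have "(L ** X) $ (i, j) $ (i2, ((a, k2), l2)) = (\<Sum>i1\<in>UNIV. \<Sum>j1\<in>UNIV. \<Sum>c\<in>UNIV. \<Sum>l1\<in>UNIV.
        if i = i1 \<and> j = j1 then p $ () $ (c, l1) * X $ (i1, ((j1, c), l1)) $ (i2, ((a, k2), l2)) else 0)"
      unfolding matrix_matrix_mult_def vec_lambda_beta sum_UNIV_prod L by (intro sum.cong refl) simp
    also have "\<dots> = (\<Sum>c\<in>UNIV. \<Sum>l1\<in>UNIV. p $ () $ (c, l1) * X $ (i, ((j, c), l1)) $ (i2, ((a, k2), l2)))"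
      by (rule sum_delta_pair1)
    also have "\<dots> = (if i = i2 then \<Sum>c\<in>UNIV. M $ (j, c) $ (a, k2) * p $ () $ (c, l2) else 0)"
      by (simp add: X if_distrib mult.commute cong: if_cong)
    finally show ?thesis .
  qed
  have "rotation p b M = L ** X ** N"
    by (simp add: rotation_def L_def N_def X_def matrix_mul_assoc)
  then have "rotation p b M $ (i, j) $ (k, l) = (\<Sum>i2\<in>UNIV. \<Sum>a\<in>UNIV. \<Sum>k2\<in>UNIV. \<Sum>l2\<in>UNIV.
      if k = k2 \<and> l = l2 then (L ** X) $ (i, j) $ (i2, ((a, k2), l2)) * b $ (i2, a) $ () else 0)"
    by (simp only: matrix_matrix_mult_def[of "L ** X"] vec_lambda_beta sum_UNIV_prod)
      (intro sum.cong refl, simp add: N)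
  also have "\<dots> = (\<Sum>i2\<in>UNIV. \<Sum>a\<in>UNIV. (L ** X) $ (i, j) $ (i2, ((a, k), l)) * b $ (i2, a) $ ())"
    by (intro sum.cong refl) (rule sum_delta_pair)
  also have "\<dots> = (\<Sum>i2\<in>UNIV. if i = i2 then \<Sum>a\<in>UNIV. (\<Sum>c\<in>UNIV. M $ (j, c) $ (a, k) * p $ () $ (c, l)) * b $ (i2, a) $ () else 0)"
    unfolding LX by (intro sum.cong refl) simp
  also have "\<dots> = (\<Sum>a\<in>UNIV. (\<Sum>c\<in>UNIV. M $ (j, c) $ (a, k) * p $ () $ (c, l)) * b $ (i, a) $ ())"
    by simp
  finally show ?thesis
    by (simp add: sum_distrib_left mult_ac)
qed

section \<open>Bilinear forms\<close>

definition bil :: "'k::comm_ring_1^'t^'s \<Rightarrow> 'k^'s \<Rightarrow> 'k^'t \<Rightarrow> 'k" where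
  "bil P u v = (\<Sum>i\<in>UNIV. u $ i * (P *v v) $ i)"

lemma bil_add: "bil P (u + u') v = bil P u v + bil P u' v" "bil P u (v + v') = bil P u v + bil P u v'"
  by (simp_all add: bil_def distrib_right matrix_vector_right_distrib distrib_left sum.distrib)

lemma bil_diff: "bil P (u - u') v = bil P u v - bil P u' v" "bil P u (v - v') = bil P u v - bil P u v'"
  by (simp_all add: bil_def left_diff_distrib matrix_vector_mult_diff_distrib right_diff_distrib sum_subtractf)

lemma bil_smult: "bil P (c *s u) v = c * bil P u v" "bil P u (c *s v) = c * bil P u v"
  by (simp_all add: bil_def sum_distrib_left mult.assoc mult.left_commute matrix_vector_mult_smult)

lemma bil_zero [simp]: "bil P 0 v = 0" "bil P u 0 = 0"
  by (simp_all add: bil_def)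

lemma bil_minus: fixes P :: "'k::comm_ring_1^'t^'s" shows "bil P (- u) v = - bil P u v" "bil P u (- v) = - bil P u v"
  using bil_diff(1)[of P 0 u v] bil_diff(2)[of P u 0 v] by simp_all

lemma bil_tens: "bil (P \<otimes> Q) (tens x y) (tens x' y') = bil P x x' * bil Q y y'"
  by (simp add: bil_def kron_tens sum_UNIV_prod sum_product mult.assoc mult.left_commute)

lemma bil_mult_left: "bil P (A *v u) v = bil (transpose A ** P) u v"
proof -
  have "bil P (A *v u) v = (\<Sum>i\<in>UNIV. \<Sum>j\<in>UNIV. A $ i $ j * u $ j * (P *v v) $ i)"
    by (simp add: bil_def matrix_vector_mult_def[of A] sum_distrib_right)
  also have "\<dots> = (\<Sum>j\<in>UNIV. u $ j * (transpose A *v (P *v v)) $ j)"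
    unfolding matrix_vector_mult_def[of "transpose A"]
    by (subst sum.swap) (simp add: transpose_def sum_distrib_left mult_ac)
  finally show ?thesis by (simp add: bil_def matrix_vector_mul_assoc)
qed

lemma bil_mult_right: "bil P u (A *v v) = bil (P ** A) u v"
  by (simp add: bil_def matrix_vector_mul_assoc)

lemma bil_skew: "transpose A ** P = - (P ** A) \<Longrightarrow> bil P (A *v u) v = - bil P u (A *v v)"
  by (simp add: bil_mult_left bil_mult_right)
    (simp add: bil_def matrix_vector_mult_def sum_negf)

lemma bil_nondegenerate:
  assumes "P ** B = mat 1" "\<And>v. bil P u v = 0"
  shows "u = 0"
proof -
  have "u $ i = 0" for i
  proof -
    have "bil P u (B *v axis i 1) = u $ i"
      by (simp add: bil_mult_right assms(1)) (simp add: bil_def axis_def if_distrib cong: if_cong)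
    then show ?thesis by (simp add: assms(2))
  qed
  then show ?thesis by (simp add: vec_eq_iff)
qed

definition form_matrix :: "complex^('v \<times> 'v)^unit \<Rightarrow> complex^'v^'v" where
  "form_matrix p = (\<chi> i j. p $ () $ (i, j))"

definition coform_matrix :: "complex^unit^('v \<times> 'v) \<Rightarrow> complex^'v^'v" where
  "coform_matrix b = (\<chi> i j. b $ (i, j) $ ())"

lemma form_skew:
  assumes "intertwiner (tensor_rep R R) trivial_rep p"
  shows "transpose (R x) ** form_matrix p = - (form_matrix p ** R x)"
proof -
  have 0: "p ** tensor_rep R R x = 0"
    using assms by (simp add: intertwiner_def trivial_rep_def)
  have "(transpose (R x) ** form_matrix p + form_matrix p ** R x) $ i $ j = (p ** tensor_rep R R x) $ () $ (i, j)" for i j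
  proof -
    have "(p ** (R x \<otimes> mat 1)) $ () $ (i, j) = (\<Sum>k\<in>UNIV. p $ () $ (k, j) * R x $ k $ i)"
      "(p ** (mat 1 \<otimes> R x)) $ () $ (i, j) = (\<Sum>k\<in>UNIV. p $ () $ (i, k) * R x $ k $ j)"
      by (simp add: matrix_matrix_mult_def sum_UNIV_prod mat_def if_distrib if_distribR cong: if_cong)
        (simp add: matrix_matrix_mult_def sum_UNIV_prod, subst sum.swap,
          simp add: mat_def if_distrib if_distribR cong: if_cong)
    then show ?thesis
      by (simp add: tensor_rep_def matrix_add_ldistrib)
        (simp add: matrix_matrix_mult_def form_matrix_def transpose_def mult.commute)
  qed
  then have "transpose (R x) ** form_matrix p + form_matrix p ** R x = 0"
    by (simp add: vec_eq_iff 0)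
  then show ?thesis by (simp add: eq_neg_iff_add_eq_0)
qed

lemma tensor_form_skew:
  assumes "\<And>x. transpose (R x) ** P = - (P ** (R x :: complex^'v^'v))"
  shows "transpose (tensor_rep R R x) ** (P \<otimes> P) = - ((P \<otimes> P) ** tensor_rep R R x)"
proof -
  have t: "transpose (tensor_rep R R x) = transpose (R x) \<otimes> mat 1 + mat 1 \<otimes> transpose (R x)"
    by (auto simp: vec_eq_iff tensor_rep_def transpose_def mat_def)
  have n: "(- A) \<otimes> P = - (A \<otimes> P)" "P \<otimes> (- A) = - (P \<otimes> A)" for A :: "complex^'v^'v"
    by (simp_all add: vec_eq_iff)
  show ?thesis
    unfolding t by (simp add: tensor_rep_def matrix_add_ldistrib matrix_add_rdistrib kron_mult assms n)
qed

lemma form_inverse: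
  assumes "lunit ** (p \<otimes> mat 1) ** reassoc_inv ** (mat 1 \<otimes> b) ** runit_inv = (mat 1 :: complex^'v^'v)"
  shows "form_matrix p ** coform_matrix b = mat 1"
proof -
  have "(form_matrix p ** coform_matrix b) $ i $ j =
      (lunit ** (p \<otimes> mat 1) ** reassoc_inv ** (mat 1 \<otimes> b) ** runit_inv) $ j $ i" for i j
  proof -
    define L where "L = lunit ** (p \<otimes> mat 1) ** (reassoc_inv :: complex^('v \<times> ('v \<times> 'v))^(('v \<times> 'v) \<times> 'v))"
    define N where "N = ((mat 1 :: complex^'v^'v) \<otimes> b) ** runit_inv"
    have L: "L $ j $ (i', (a, c)) = (if j = c then p $ () $ (i', a) else 0)" for i' a c
      unfolding L_def lunit_def reassoc_inv_def reindex_mult_right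
      by (subst reindex_mult_left[where f = "Pair ()"]) (auto simp: mat_def)
    have N: "N $ (i', (a, c)) $ i = (if i = i' then b $ (a, c) $ () else 0)" for i' a c
      by (auto simp: N_def runit_inv_def reindex_mult_right mat_def)
    have "(lunit ** (p \<otimes> mat 1) ** reassoc_inv ** (mat 1 \<otimes> b) ** runit_inv) $ j $ i = (L ** N) $ j $ i"
      by (simp add: L_def N_def matrix_mul_assoc)
    also have "\<dots> = (\<Sum>i'\<in>UNIV. \<Sum>a\<in>UNIV. \<Sum>c\<in>UNIV.
        if j = c then if i = i' then p $ () $ (i', a) * b $ (a, c) $ () else 0 else 0)"
      unfolding matrix_matrix_mult_def vec_lambda_beta sum_UNIV_prod by (intro sum.cong refl) (simp add: L N)
    also have "\<dots> = (\<Sum>i'\<in>UNIV. if i = i' then (\<Sum>a\<in>UNIV. p $ () $ (i', a) * b $ (a, j) $ ()) else 0)"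
      by (intro sum.cong refl) simp
    also have "\<dots> = (form_matrix p ** coform_matrix b) $ i $ j"
      by (simp add: matrix_matrix_mult_def form_matrix_def coform_matrix_def)
    finally show ?thesis by simp
  qed
  then show ?thesis
    unfolding assms by (auto simp: vec_eq_iff mat_def)
qed

lemma form_symmetric:
  assumes "p ** flip = p"
  shows "transpose (form_matrix p) = form_matrix p"
proof -
  have "p $ () $ (j, i) = p $ () $ (i, j)" for i j
    using arg_cong[OF assms, of "\<lambda>A. A $ () $ (i, j)"] by (simp add: flip_def reindex_mult_right)
  then show ?thesis by (simp add: vec_eq_iff transpose_def form_matrix_def)
qed

lemma bil_swap: "transpose P = P \<Longrightarrow> bil P u v = bil P v u"
proof -
  assume P: "transpose P = P"
  have "bil P u v = (\<Sum>i\<in>UNIV. \<Sum>j\<in>UNIV. u $ i * P $ i $ j * v $ j)"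
    by (simp add: bil_def matrix_vector_mult_def sum_distrib_left mult.assoc)
  also have "\<dots> = (\<Sum>j\<in>UNIV. \<Sum>i\<in>UNIV. v $ j * transpose P $ j $ i * u $ i)"
    by (subst sum.swap) (simp add: transpose_def mult_ac)
  finally show ?thesis
    by (simp add: P bil_def matrix_vector_mult_def sum_distrib_left mult.assoc)
qed

lemma sum_permute6:
  fixes f :: "'i::finite \<Rightarrow> 'j::finite \<Rightarrow> 'k::finite \<Rightarrow> 'l::finite \<Rightarrow> 'm::finite \<Rightarrow> 'n::finite \<Rightarrow> 'a::comm_monoid_add"
  shows "(\<Sum>i\<in>UNIV. \<Sum>j\<in>UNIV. \<Sum>k\<in>UNIV. \<Sum>l\<in>UNIV. \<Sum>m\<in>UNIV. \<Sum>n\<in>UNIV. f i j k l m n) =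
    (\<Sum>j\<in>UNIV. \<Sum>n\<in>UNIV. \<Sum>m\<in>UNIV. \<Sum>k\<in>UNIV. \<Sum>i\<in>UNIV. \<Sum>l\<in>UNIV. f i j k l m n)"
proof -
  have "(\<Sum>t\<in>UNIV. case t of (i, j, k, l, m, n) \<Rightarrow> f i j k l m n) =
      (\<Sum>t\<in>UNIV. case t of (j, n, m, k, i, l) \<Rightarrow> f i j k l m n)"
    by (rule sum.reindex_bij_witness[where i = "\<lambda>(j, n, m, k, i, l). (i, j, k, l, m, n)"
          and j = "\<lambda>(i, j, k, l, m, n). (j, n, m, k, i, l)"]) auto
  then show ?thesis by (simp add: sum_UNIV_prod)
qed

text \<open>Crossing symmetry: rotating by 90 degrees exchanges the channels of a four-point function.\<close>

lemma rotation_crossing: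
  fixes p :: "complex^('v::finite \<times> 'v)^unit"
  assumes P_def: "P = form_matrix p" and B: "P ** coform_matrix b = mat 1" and sym: "transpose P = P"
  shows "bil (P \<otimes> P) (rotation p b M *v tens x y) (tens x' y') = bil (P \<otimes> P) (M *v tens x' x) (tens y' y)"
proof -
  let ?B = "coform_matrix b"
  have "transpose ?B ** P = mat 1"
    using arg_cong[OF B, of transpose] by (simp add: matrix_transpose_mul sym)
  then have "x' = transpose ?B *v (P *v x')"
    by (simp only: matrix_vector_mul_assoc matrix_vector_mul_lid)
  then have "x' $ a = (transpose ?B *v (P *v x')) $ a" for a
    by (rule arg_cong)
  then have x': "x' $ a = (\<Sum>i\<in>UNIV. b $ (i, a) $ () * (P *v x') $ i)" for a
    unfolding matrix_vector_mult_def[of "transpose ?B"] by (simp add: transpose_def coform_matrix_def)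
  have y: "(P *v y) $ c = (\<Sum>l\<in>UNIV. p $ () $ (c, l) * y $ l)" for c
    by (simp add: matrix_vector_mult_def P_def form_matrix_def)
  let ?t = "\<lambda>i j k l a c. b $ (i, a) $ () * M $ (j, c) $ (a, k) * p $ () $ (c, l) * x $ k * y $ l
      * (P *v x') $ i * (P *v y') $ j"
  have "bil (P \<otimes> P) (rotation p b M *v tens x y) (tens x' y') =
      (\<Sum>i\<in>UNIV. \<Sum>j\<in>UNIV. (\<Sum>k\<in>UNIV. \<Sum>l\<in>UNIV. rotation p b M $ (i, j) $ (k, l) * (x $ k * y $ l))
        * ((P *v x') $ i * (P *v y') $ j))"
    by (simp add: bil_def kron_tens sum_UNIV_prod matrix_vector_mult_def[of "rotation p b M"])
  also have "\<dots> = (\<Sum>i\<in>UNIV. \<Sum>j\<in>UNIV. \<Sum>k\<in>UNIV. \<Sum>l\<in>UNIV. \<Sum>a\<in>UNIV. \<Sum>c\<in>UNIV. ?t i j k l a c)"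
    by (simp add: rotation_nth sum_distrib_right mult.assoc)
  also have "\<dots> = (\<Sum>j\<in>UNIV. \<Sum>c\<in>UNIV. \<Sum>a\<in>UNIV. \<Sum>k\<in>UNIV. \<Sum>i\<in>UNIV. \<Sum>l\<in>UNIV. ?t i j k l a c)"
    by (rule sum_permute6)
  also have "\<dots> = (\<Sum>j\<in>UNIV. \<Sum>c\<in>UNIV. (\<Sum>a\<in>UNIV. \<Sum>k\<in>UNIV. M $ (j, c) $ (a, k) * (x' $ a * x $ k))
        * ((P *v y') $ j * (P *v y) $ c))"
  proof (intro sum.cong refl)
    fix j c
    show "(\<Sum>a\<in>UNIV. \<Sum>k\<in>UNIV. \<Sum>i\<in>UNIV. \<Sum>l\<in>UNIV. ?t i j k l a c) =
        (\<Sum>a\<in>UNIV. \<Sum>k\<in>UNIV. M $ (j, c) $ (a, k) * (x' $ a * x $ k)) * ((P *v y') $ j * (P *v y) $ c)"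
      unfolding sum_distrib_right
    proof (intro sum.cong refl)
      fix a k
      let ?m = "M $ (j, c) $ (a, k) * x $ k * (P *v y') $ j"
      have "(\<Sum>i\<in>UNIV. \<Sum>l\<in>UNIV. ?t i j k l a c) =
          (\<Sum>i\<in>UNIV. \<Sum>l\<in>UNIV. b $ (i, a) $ () * (P *v x') $ i * (p $ () $ (c, l) * y $ l) * ?m)"
        by (intro sum.cong refl) (simp only: mult_ac)
      also have "\<dots> = (\<Sum>i\<in>UNIV. b $ (i, a) $ () * (P *v x') $ i) * (\<Sum>l\<in>UNIV. p $ () $ (c, l) * y $ l) * ?m"
        by (simp only: sum_product[symmetric] sum_distrib_right[symmetric])
      also have "\<dots> = x' $ a * (P *v y) $ c * ?m"
        unfolding y using x'[of a] by simp
      also have "\<dots> = M $ (j, c) $ (a, k) * (x' $ a * x $ k) * ((P *v y') $ j * (P *v y) $ c)"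
        by (simp only: mult_ac)
      finally show "(\<Sum>i\<in>UNIV. \<Sum>l\<in>UNIV. ?t i j k l a c) =
          M $ (j, c) $ (a, k) * (x' $ a * x $ k) * ((P *v y') $ j * (P *v y) $ c)" .
    qed
  qed
  also have "\<dots> = bil (P \<otimes> P) (M *v tens x' x) (tens y' y)"
    by (simp add: bil_def kron_tens sum_UNIV_prod matrix_vector_mult_def[of M])
  finally have "bil (P \<otimes> P) (rotation p b M *v tens x y) (tens x' y') = bil (P \<otimes> P) (M *v tens x' x) (tens y' y)" .
  then show ?thesis .
qed

section \<open>Eigenvalues\<close>

lemma eigenvalue_in_span:
  fixes A :: "complex^'n^'n"
  assumes Y: "\<And>y. y \<in> Y \<Longrightarrow> \<exists>c\<in>M. A *v y = c *s y"
    and x: "x \<in> vec.span Y" "A *v x = \<kappa> *s x" "x \<noteq> 0"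
  shows "\<kappa> \<in> M"
proof -
  define op where "op c x = A *v x - c *s x" for c and x :: "complex^'n"
  have op_add: "op c (x + y) = op c x + op c y" for c x y
    by (simp add: op_def matrix_vector_right_distrib vector_add_ldistrib)
  have op_smult: "op c (a *s x) = a *s op c x" for c a x
    by (simp add: op_def matrix_vector_mult_smult vec_eq_iff algebra_simps)
  have op_comm: "op c (op d x) = op d (op c x)" for c d x
    by (simp add: op_def matrix_vector_mult_smult matrix_vector_mult_diff_distrib vec_eq_iff algebra_simps)
  have fold_add: "foldr op cs (x + y) = foldr op cs x + foldr op cs y" for cs x y
    by (induction cs) (simp_all add: op_add)
  have fold_smult: "foldr op cs (a *s x) = a *s foldr op cs x" for cs a x
    by (induction cs) (simp_all add: op_smult)
  have fold_zero: "foldr op cs 0 = 0" for cs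
    using fold_smult[of cs 0 0] by simp
  have fold_comm1: "op c (foldr op cs x) = foldr op cs (op c x)" for c cs x
    by (induction cs) (simp_all add: op_comm)
  have fold_comm: "foldr op cs (foldr op ds x) = foldr op ds (foldr op cs x)" for cs ds x
    by (induction cs) (simp_all add: fold_comm1)
  let ?P = "\<lambda>x. \<exists>cs. set cs \<subseteq> M \<and> foldr op cs x = 0"
  have "?P x"
    using x(1)
  proof (induction rule: vec.span_induct)
    show "vec.subspace {x. ?P x}"
    proof (rule vec.subspaceI)
      show "0 \<in> {x. ?P x}" by (auto intro: exI[of _ "[]"])
    next
      fix x y assume "x \<in> {x. ?P x}" "y \<in> {x. ?P x}"
      then obtain cs ds where *: "set cs \<subseteq> M" "foldr op cs x = 0" "set ds \<subseteq> M" "foldr op ds y = 0"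
        by auto
      have "foldr op (cs @ ds) (x + y) = foldr op cs (foldr op ds x) + foldr op cs (foldr op ds y)"
        by (simp add: fold_add)
      also have "\<dots> = 0"
        using * by (simp add: fold_comm[of cs ds x] fold_zero)
      finally show "x + y \<in> {x. ?P x}" using * by (auto intro!: exI[of _ "cs @ ds"])
    next
      fix c x assume "x \<in> {x. ?P x}"
      then show "c *s x \<in> {x. ?P x}" by (auto simp: fold_smult)
    qed
  next
    fix y assume "y \<in> Y"
    then obtain c where "c \<in> M" "A *v y = c *s y" using Y by blast
    then show "?P y" by (auto intro!: exI[of _ "[c]"] simp: op_def)
  qed
  then obtain cs where cs: "set cs \<subseteq> M" "foldr op cs x = 0" by blast
  have "foldr op cs x = prod_list (map (\<lambda>c. \<kappa> - c) cs) *s x" for cs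
    by (induction cs) (simp_all add: op_smult, simp add: op_def x(2) vec_eq_iff algebra_simps)
  with cs(2) x(3) have "prod_list (map (\<lambda>c. \<kappa> - c) cs) = 0" by simp
  then have "\<kappa> \<in> set cs" by (auto simp: prod_list_zero_iff)
  with cs(1) show ?thesis by blast
qed

section \<open>The generators of F4\<close>

lemma rep_bracket_vec:
  "representation br R \<Longrightarrow> R (br x y) *v z = R x *v (R y *v z) - R y *v (R x *v z)"
  by (simp add: rep_bracket matrix_vector_mult_diff_rdistrib matrix_vector_mul_assoc)

lemma minus_matrix_vector: "(- A) *v x = - (A *v (x :: 'k::ring_1^'s))"
  by (simp add: vec_eq_iff matrix_vector_mult_def sum_negf)

locale F4 =
  fixes br :: "complex^'l \<Rightarrow> complex^'l \<Rightarrow> complex^'l" and e f k :: "nat \<Rightarrow> complex^'l"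
  assumes f4: "lie_algebra_F4 br e f k"
begin

lemma lie: "lie_algebra br"
  using f4 by (simp add: lie_algebra_F4_def simple_lie_algebra_def)

lemma ideal_trivial:
  assumes "vec.subspace J" "\<And>x y. y \<in> J \<Longrightarrow> br x y \<in> J"
  shows "J = {0} \<or> J = UNIV"
proof -
  have "\<forall>J. vec.subspace J \<and> (\<forall>x. \<forall>y\<in>J. br x y \<in> J) \<longrightarrow> J = {0} \<or> J = UNIV"
    using f4 unfolding lie_algebra_F4_def simple_lie_algebra_def by (elim conjE)
  from this[rule_format, of J] show ?thesis using assms by simp
qed

lemma generated:
  assumes "vec.subspace S" "\<And>x y. x \<in> S \<Longrightarrow> y \<in> S \<Longrightarrow> br x y \<in> S"
    and "\<And>i. i < 4 \<Longrightarrow> e i \<in> S \<and> f i \<in> S \<and> k i \<in> S"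
  shows "x \<in> S"
proof -
  have "\<forall>S. vec.subspace S \<and> (\<forall>x\<in>S. \<forall>y\<in>S. br x y \<in> S) \<and>
      (\<forall>i<4. e i \<in> S \<and> f i \<in> S \<and> k i \<in> S) \<longrightarrow> S = UNIV"
    using f4 unfolding lie_algebra_F4_def by (elim conjE)
  from this[rule_format, of S] show ?thesis using assms by auto
qed

lemma brackets:
  assumes "i < 4" "j < 4"
  shows "br (e i) (f j) = (if i = j then k i else 0)"
    and "br (k i) (e j) = of_int (cartan_F4 j i) *s e j"
    and "br (k i) (f j) = - (of_int (cartan_F4 j i) *s f j)"
proof -
  note rels = f4[unfolded lie_algebra_F4_def, THEN conjunct2, THEN conjunct2, rule_format, OF assms]
  show "br (e i) (f j) = (if i = j then k i else 0)"
    by (rule rels[THEN conjunct2, THEN conjunct1])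
  show "br (k i) (e j) = of_int (cartan_F4 j i) *s e j"
    by (rule rels[THEN conjunct2, THEN conjunct2, THEN conjunct1])
  show "br (k i) (f j) = - (of_int (cartan_F4 j i) *s f j)"
    by (rule rels[THEN conjunct2, THEN conjunct2, THEN conjunct2, THEN conjunct1])
qed

lemma generated_invariant:
  assumes R: "representation br R" and S: "vec.subspace S"
    and inv: "\<And>i v. i < 4 \<Longrightarrow> v \<in> S \<Longrightarrow> R (e i) *v v \<in> S" "\<And>i v. i < 4 \<Longrightarrow> v \<in> S \<Longrightarrow> R (f i) *v v \<in> S"
    and v: "v \<in> S"
  shows "R x *v v \<in> S"
proof -
  let ?T = "{x. \<forall>v\<in>S. R x *v v \<in> S}"
  have br: "br x y \<in> ?T" if "x \<in> ?T" "y \<in> ?T" for x y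
    using that by (auto simp: rep_bracket_vec[OF R] intro!: vec.subspace_diff[OF S])
  have "x \<in> ?T"
  proof (rule generated)
    show "vec.subspace ?T"
      using S by (auto intro!: vec.subspaceI vec.subspace_add[OF S] vec.subspace_scale[OF S]
          simp: rep_zero[OF R] rep_add[OF R] rep_smult[OF R] smul_matrix_vector
          matrix_vector_mult_add_rdistrib vec.subspace_0)
    show "e i \<in> ?T \<and> f i \<in> ?T \<and> k i \<in> ?T" if "i < 4" for i
      using inv that br[of "e i" "f i"] brackets(1)[OF that that] by auto
  qed (rule br)
  with v show ?thesis by blast
qed

context
  fixes R :: "complex^'l \<Rightarrow> complex^'n^'n"
  assumes R: "representation br R"
begin

lemma e_f:
  "i < 4 \<Longrightarrow> j < 4 \<Longrightarrow>
   R (e i) *v (R (f j) *v x) = R (f j) *v (R (e i) *v x) + (if i = j then R (k i) *v x else 0)"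
  using rep_bracket_vec[OF R, of "e i" "f j" x] by (simp add: brackets rep_zero[OF R] split: if_splits)

lemma k_f:
  "i < 4 \<Longrightarrow> j < 4 \<Longrightarrow>
   R (k i) *v (R (f j) *v x) = R (f j) *v (R (k i) *v x) - of_int (cartan_F4 j i) *s (R (f j) *v x)"
  using rep_bracket_vec[OF R, of "k i" "f j" x]
  by (simp add: brackets rep_minus[OF R] rep_smult[OF R] smul_matrix_vector minus_matrix_vector algebra_simps)

end

text \<open>Half the sum of the positive coroots: it has eigenvalue 1 on every \<open>e i\<close>.\<close>

definition rho :: "complex^'l" where
  "rho = 11 *s k 0 + 21 *s k 1 + 15 *s k 2 + 8 *s k 3"

definition level :: "(nat \<Rightarrow> complex) \<Rightarrow> complex" where
  "level c = 11 * c 0 + 21 * c 1 + 15 * c 2 + 8 * c 3"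

lemma rho_eigenvector:
  assumes R: "representation br R" and "\<And>i. i < 4 \<Longrightarrow> R (k i) *v x = c i *s x"
  shows "R rho *v x = level c *s x"
  using assms(2)[of 0] assms(2)[of 1] assms(2)[of 2] assms(2)[of 3]
  by (simp add: rho_def level_def rep_add[OF R] rep_smult[OF R] matrix_vector_mult_add_rdistrib
      smul_matrix_vector vec_eq_iff algebra_simps)

inductive_set f_words :: "(complex^'l \<Rightarrow> complex^'n^'n) \<Rightarrow> complex^'n \<Rightarrow> (complex^'n) set"
  for R :: "complex^'l \<Rightarrow> complex^'n^'n" and x :: "complex^'n" where
  base: "x \<in> f_words R x"
| step: "y \<in> f_words R x \<Longrightarrow> i < 4 \<Longrightarrow> R (f i) *v y \<in> f_words R x"

lemma level_lower: "i < 4 \<Longrightarrow> level (\<lambda>l. c l - of_int (cartan_F4 i l)) = level c - 1"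
proof -
  assume "i < 4"
  then have "i = 0 \<or> i = 1 \<or> i = 2 \<or> i = 3" by linarith
  then show ?thesis by (auto simp: level_def cartan_F4_def numeral_eq_Suc)
qed

lemma matrix_vector_span_invariant:
  assumes "\<And>y. y \<in> Y \<Longrightarrow> A *v y \<in> vec.span Y" "v \<in> vec.span Y"
  shows "A *v v \<in> vec.span (Y :: (complex^'n) set)"
  using assms(2)
proof (induction rule: vec.span_induct)
  show "vec.subspace {v. A *v v \<in> vec.span Y}"
    by (auto intro!: vec.subspaceI simp: matrix_vector_right_distrib matrix_vector_mult_smult
        vec.span_add vec.span_scale vec.span_zero)
qed (rule assms(1))

lemma highest_weight_span:
  fixes R :: "complex^'l \<Rightarrow> complex^'n^'n"
  assumes R: "representation br R" and irr: "irreducible_rep R"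
    and x: "x \<noteq> 0" "\<And>i. i < 4 \<Longrightarrow> R (e i) *v x = 0" "\<And>i. i < 4 \<Longrightarrow> R (k i) *v x = c i *s x"
  shows "vec.span (f_words R x) = UNIV"
    and "y \<in> f_words R x \<Longrightarrow> \<exists>n::nat. R rho *v y = (level c - of_nat n) *s y"
proof -
  let ?Y = "f_words R x"
  have wt: "\<exists>d n. (\<forall>i<4. R (k i) *v y = d i *s y) \<and> level d = level c - of_nat n" if "y \<in> ?Y" for y
    using that
  proof induction
    case base
    show ?case using x(3) by (auto intro!: exI[of _ c] exI[of _ 0])
  next
    case (step y i)
    then obtain d n where d: "\<forall>i<4. R (k i) *v y = d i *s y" "level d = level c - of_nat n" by blast
    have "R (k l) *v (R (f i) *v y) = (d l - of_int (cartan_F4 i l)) *s (R (f i) *v y)" if "l < 4" for l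
      using d(1) that step(2) by (simp add: k_f[OF R] matrix_vector_mult_smult vec.scale_left_diff_distrib)
    moreover have "level (\<lambda>l. d l - of_int (cartan_F4 i l)) = level c - of_nat (Suc n)"
      by (simp add: level_lower[OF step(2)] d(2))
    ultimately show ?case
      by (intro exI[of _ "\<lambda>l. d l - of_int (cartan_F4 i l)"] exI[of _ "Suc n"]) simp
  qed
  show "\<exists>n::nat. R rho *v y = (level c - of_nat n) *s y" if y: "y \<in> f_words R x"
  proof -
    obtain d n where d: "\<forall>i<4. R (k i) *v y = d i *s y" "level d = level c - of_nat n"
      using wt[OF y] by blast
    have "R rho *v y = level d *s y"
      by (rule rho_eigenvector[OF R]) (simp add: d(1))
    with d(2) show ?thesis by auto
  qed
  have e: "R (e i) *v y \<in> vec.span ?Y" if "i < 4" "y \<in> ?Y" for i y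
    using that(2)
  proof induction
    case base
    show ?case using x(2) that by (simp add: vec.span_zero)
  next
    case (step y j)
    obtain d where d: "\<forall>i<4. R (k i) *v y = d i *s y" using wt[OF step(1)] by blast
    have "R (f j) *v (R (e i) *v y) \<in> vec.span ?Y"
      by (rule matrix_vector_span_invariant[OF _ step(3)])
        (auto intro: vec.span_base f_words.step step(2))
    moreover have "(if i = j then R (k i) *v y else 0) \<in> vec.span ?Y"
      using d that(1) by (auto intro!: vec.span_zero vec.span_scale[OF vec.span_base[OF step(1)]])
    ultimately show ?case
      unfolding e_f[OF R that(1) step(2)] by (rule vec.span_add)
  qed
  have "R z *v v \<in> vec.span ?Y" if v: "v \<in> vec.span ?Y" for z v
  proof (rule generated_invariant[OF R vec.subspace_span _ _ v])
    show "R (e i) *v u \<in> vec.span ?Y" if "i < 4" "u \<in> vec.span ?Y" for i u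
      by (rule matrix_vector_span_invariant[OF e[OF that(1)] that(2)])
    show "R (f i) *v u \<in> vec.span ?Y" if "i < 4" "u \<in> vec.span ?Y" for i u
      by (rule matrix_vector_span_invariant[OF vec.span_base[OF f_words.step[OF _ that(1)]] that(2)])
  qed
  then have "vec.span ?Y = {0} \<or> vec.span ?Y = UNIV"
    using irr vec.subspace_span[of ?Y] by (simp add: irreducible_rep_def)
  moreover have "x \<in> vec.span ?Y" by (intro vec.span_base base)
  ultimately show "vec.span ?Y = UNIV"
    using x(1) by auto
qed

lemma highest_weight_level:
  fixes R :: "complex^'l \<Rightarrow> complex^'n^'n"
  assumes R: "representation br R" and irr: "irreducible_rep R"
    and x: "x \<noteq> 0" "\<And>i. i < 4 \<Longrightarrow> R (e i) *v x = 0" "\<And>i. i < 4 \<Longrightarrow> R (k i) *v x = c i *s x"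
    and y: "y \<noteq> 0" "\<And>i. i < 4 \<Longrightarrow> R (e i) *v y = 0" "\<And>i. i < 4 \<Longrightarrow> R (k i) *v y = d i *s y"
  shows "level c = level d"
proof -
  have "\<exists>n::nat. level d = level c - of_nat n"
    if x': "x \<noteq> 0" "\<And>i. i < 4 \<Longrightarrow> R (e i) *v x = 0" "\<And>i. i < 4 \<Longrightarrow> R (k i) *v x = c i *s x"
      and y': "y \<noteq> 0" "\<And>i. i < 4 \<Longrightarrow> R (k i) *v y = d i *s y" for c d x y
  proof -
    have "level d \<in> {level c - of_nat n |n. True}"
    proof (rule eigenvalue_in_span)
      show "R rho *v y = level d *s y" using y'(2) by (rule rho_eigenvector[OF R])
      show "y \<in> vec.span (f_words R x)" by (simp add: highest_weight_span[OF R irr x'])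
      show "\<exists>c\<in>{level c - of_nat n |n. True}. R rho *v z = c *s z" if "z \<in> f_words R x" for z
        using highest_weight_span(2)[OF R irr x' that] by auto
    qed (rule y'(1))
    then show ?thesis by auto
  qed
  from this[OF x y(1,3)] this[OF y x(1,3)] obtain n m :: nat
    where "level d = level c - of_nat n" "level c = level d - of_nat m" by blast
  note nm = this
  have "of_nat (n + m) = level d - (level d - of_nat m - of_nat n)" by simp
  also have "level d - of_nat m - of_nat n = level d" by (simp only: nm(2)[symmetric] nm(1)[symmetric])
  finally have "of_nat (n + m) = (0 :: complex)" by simp
  then have "n = 0" by (simp only: of_nat_eq_0_iff)
  with \<open>level d = level c - of_nat n\<close> show ?thesis by simp
qed

end

section \<open>The 26-dimensional module\<close>

text \<open>
  The module has a basis of weight vectors indexed by \<open>0, \<dots>, 25\<close> in which every \<open>e i\<close> and \<open>f i\<close> maps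
  basis vectors to multiples of basis vectors. Row \<open>i\<close> of \<open>F4_lower\<close> (\<open>F4_raise\<close>) contains \<open>(j, c, t)\<close>
  if \<open>f i\<close> (\<open>e i\<close>) maps vector \<open>j\<close> to \<open>c\<close> times vector \<open>t\<close>; entry \<open>j\<close> of row \<open>i\<close> of \<open>F4_weight\<close> is the
  eigenvalue of \<open>k i\<close>. Vectors 0 and 25 are the highest and the lowest one, 12 and 13 span the zero
  weight space, and 11, 10, 14, 15 have the weights of the short simple roots and their negatives.
  \<open>F4_parent\<close> gives \<open>(j, i)\<close> such that vector \<open>t\<close> is a multiple of \<open>f i\<close> applied to vector \<open>j\<close>.
\<close>

definition F4_lower :: "nat \<Rightarrow> nat \<Rightarrow> int \<times> nat" where
  "F4_lower i j = (case map_of (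
     [[(3,1,5), (4,1,7), (6,1,9), (16,1,19), (18,1,21), (20,1,22)],
      [(2,1,3), (7,1,8), (9,1,11), (14,1,16), (17,1,18), (22,1,23)],
      [(1,1,2), (3,1,4), (5,1,7), (8,1,10), (11,1,12), (12,2,14), (13,1,14), (15,1,17), (18,1,20),
       (21,1,22), (23,1,24)],
      [(0,1,1), (4,1,6), (7,1,9), (8,1,11), (10,1,13), (12,1,15), (13,2,15), (14,1,17), (16,1,18),
       (19,1,21), (24,1,25)]] ! i) j
    of None \<Rightarrow> (0, 0) | Some p \<Rightarrow> p)"

definition F4_raise :: "nat \<Rightarrow> nat \<Rightarrow> int \<times> nat" where
  "F4_raise i j = (case map_of (
     [[(5,1,3), (7,1,4), (9,1,6), (19,1,16), (21,1,18), (22,1,20)],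
      [(3,1,2), (8,1,7), (11,1,9), (16,1,14), (18,1,17), (23,1,22)],
      [(2,1,1), (4,1,3), (7,1,5), (10,1,8), (12,2,11), (13,1,11), (14,1,12), (17,1,15), (20,1,18),
       (22,1,21), (24,1,23)],
      [(1,1,0), (6,1,4), (9,1,7), (11,1,8), (12,1,10), (13,2,10), (15,1,13), (17,1,14), (18,1,16),
       (21,1,19), (25,1,24)]] ! i) j
    of None \<Rightarrow> (0, 0) | Some p \<Rightarrow> p)"

definition F4_weight :: "nat \<Rightarrow> nat \<Rightarrow> int" where
  "F4_weight i j =
    [[0,0,0,1,1,-1,1,-1,0,-1,0,0,0,0,0,0,1,0,1,-1,1,-1,-1,0,0,0],
     [0,0,1,-1,0,0,0,1,-1,1,0,-1,0,0,1,0,-1,1,-1,0,0,0,1,-1,0,0],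
     [0,1,-1,1,-1,1,0,-1,1,0,-1,2,0,0,-2,1,0,-1,1,0,-1,1,-1,1,-1,0],
     [1,-1,0,0,1,0,-1,1,1,-1,2,-1,0,0,1,-2,1,-1,-1,1,0,-1,0,0,1,-1]] ! i ! j"

definition F4_parent :: "nat \<Rightarrow> nat \<times> nat" where
  "F4_parent t =
    [(0, 0), (0, 3), (1, 2), (2, 1), (3, 2), (3, 0), (4, 3), (4, 0), (7, 1), (6, 0), (8, 2), (8, 3),
     (11, 2), (10, 3), (12, 2), (12, 3), (14, 1), (14, 3), (16, 3), (16, 0), (18, 2), (18, 0), (20, 0),
     (22, 1), (23, 2), (24, 3)] ! t"

definition F4_commutator_check :: "nat \<Rightarrow> nat \<Rightarrow> nat \<Rightarrow> bool" where
  "F4_commutator_check i l j \<longleftrightarrow>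
    (case F4_lower i j of (c, s) \<Rightarrow> case F4_raise l s of (c', u) \<Rightarrow>
     case F4_raise l j of (d, t) \<Rightarrow> case F4_lower i t of (d', v) \<Rightarrow>
       list_all (\<lambda>m. (if u = m then c * c' else 0) =
         (if v = m then d * d' else 0) + (if i = l \<and> j = m then F4_weight l j else 0)) [u, v, j])"

lemma F4_table_commutator:
  assumes "i < 4" "l < 4" "j < 26"
  shows "F4_commutator_check i l j"
proof -
  have "list_all (\<lambda>i. list_all (\<lambda>l. list_all (F4_commutator_check i l) [0..<26]) [0..<4]) [0..<4]"
    by code_simp
  then show ?thesis using assms by (simp add: list_all_iff)
qed

lemma F4_table_range:
  assumes "i < 4" "j < 26"
  shows "snd (F4_lower i j) < 26" "snd (F4_raise i j) < 26"
    and "fst (F4_raise i j) \<noteq> 0 \<Longrightarrow> snd (F4_raise i j) < j"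
    and "fst (F4_lower i j) \<noteq> 0 \<Longrightarrow> 0 < snd (F4_lower i j) \<and> fst (F4_parent (snd (F4_lower i j))) \<le> j"
    and "fst (F4_raise i 0) = 0"
    and "11 * F4_weight 0 j + 21 * F4_weight 1 j + 15 * F4_weight 2 j + 8 * F4_weight 3 j \<le> 8"
proof -
  have "list_all (\<lambda>i. list_all (\<lambda>j. snd (F4_lower i j) < 26 \<and> snd (F4_raise i j) < 26 \<and>
      (fst (F4_raise i j) \<noteq> 0 \<longrightarrow> snd (F4_raise i j) < j) \<and>
      (fst (F4_lower i j) \<noteq> 0 \<longrightarrow> 0 < snd (F4_lower i j) \<and> fst (F4_parent (snd (F4_lower i j))) \<le> j) \<and>
      fst (F4_raise i 0) = 0 \<and>
      11 * F4_weight 0 j + 21 * F4_weight 1 j + 15 * F4_weight 2 j + 8 * F4_weight 3 j \<le> 8) [0..<26]) [0..<4]"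
    by code_simp
  then show "snd (F4_lower i j) < 26" "snd (F4_raise i j) < 26"
    "fst (F4_raise i j) \<noteq> 0 \<Longrightarrow> snd (F4_raise i j) < j"
    "fst (F4_lower i j) \<noteq> 0 \<Longrightarrow> 0 < snd (F4_lower i j) \<and> fst (F4_parent (snd (F4_lower i j))) \<le> j"
    "fst (F4_raise i 0) = 0"
    "11 * F4_weight 0 j + 21 * F4_weight 1 j + 15 * F4_weight 2 j + 8 * F4_weight 3 j \<le> 8"
    using assms by (auto simp: list_all_iff)
qed

lemma F4_table_weight:
  assumes "i < 4" "l < 4" "j < 26" "fst (F4_lower i j) \<noteq> 0"
  shows "F4_weight l (snd (F4_lower i j)) = F4_weight l j - cartan_F4 i l"
proof -
  have "list_all (\<lambda>i. list_all (\<lambda>l. list_all (\<lambda>j. fst (F4_lower i j) \<noteq> 0 \<longrightarrow>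
      F4_weight l (snd (F4_lower i j)) = F4_weight l j - cartan_F4 i l) [0..<26]) [0..<4]) [0..<4]"
    by code_simp
  then show ?thesis using assms by (simp add: list_all_iff)
qed

lemma F4_table_parent:
  assumes "0 < t" "t < 26"
  shows "fst (F4_parent t) < t" "snd (F4_parent t) < 4"
    and "fst (F4_lower (snd (F4_parent t)) (fst (F4_parent t))) \<noteq> 0"
    and "snd (F4_lower (snd (F4_parent t)) (fst (F4_parent t))) = t"
proof -
  have "list_all (\<lambda>t. fst (F4_parent t) < t \<and> snd (F4_parent t) < 4 \<and>
      fst (F4_lower (snd (F4_parent t)) (fst (F4_parent t))) \<noteq> 0 \<and>
      snd (F4_lower (snd (F4_parent t)) (fst (F4_parent t))) = t) [1..<26]"
    by code_simp
  then show "fst (F4_parent t) < t" "snd (F4_parent t) < 4"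
    "fst (F4_lower (snd (F4_parent t)) (fst (F4_parent t))) \<noteq> 0"
    "snd (F4_lower (snd (F4_parent t)) (fst (F4_parent t))) = t"
    using assms by (auto simp: list_all_iff)
qed

lemma F4_weight_injective:
  assumes "i < 26" "j < 26" "\<And>l. l < 4 \<Longrightarrow> F4_weight l i = F4_weight l j"
  shows "i = j \<or> {i, j} = {12, 13}"
proof -
  have "list_all (\<lambda>i. list_all (\<lambda>j. list_all (\<lambda>l. F4_weight l i = F4_weight l j) [0..<4] \<longrightarrow>
      i = j \<or> i = 12 \<and> j = 13 \<or> i = 13 \<and> j = 12) [0..<26]) [0..<26]"
    by code_simp
  moreover have "list_all (\<lambda>l. F4_weight l i = F4_weight l j) [0..<4]"
    using assms(3) by (simp add: list_all_iff)
  ultimately have "i = j \<or> i = 12 \<and> j = 13 \<or> i = 13 \<and> j = 12"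
    using assms(1,2) by (simp add: list_all_iff)
  then show ?thesis by auto
qed

lemma F4_commutator_combination:
  fixes X :: "nat \<Rightarrow> complex^'n"
  assumes "i < 4" "l < 4" "j < 26"
    and eq: "F4_lower i j = (c, s)" "F4_raise l s = (c', u)" "F4_raise l j = (d, t)" "F4_lower i t = (d', v)"
  shows "of_int (c * c') *s X u = of_int (d * d') *s X v + (if i = l then of_int (F4_weight l j) *s X j else 0)"
proof -
  define w where "w = (if i = l then F4_weight l j else 0)"
  have "F4_commutator_check i l j" by (rule F4_table_commutator[OF assms(1-3)])
  then have *: "c * c' = (if v = u then d * d' else 0) + (if j = u then w else 0)"
    "(if u = v then c * c' else 0) = d * d' + (if j = v then w else 0)"
    "(if u = j then c * c' else 0) = (if v = j then d * d' else 0) + w"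
    by (auto simp: F4_commutator_check_def eq w_def)
  have "of_int p *s X u = of_int q *s X v + of_int w *s X j"
    if "p = (if v = u then q else 0) + (if j = u then w else 0)"
      "(if u = v then p else 0) = q + (if j = v then w else 0)"
      "(if u = j then p else 0) = (if v = j then q else 0) + w" for p q :: int
    using that by (cases "u = v"; cases "u = j"; cases "v = j")
      (auto simp: vec.scale_left_distrib[symmetric] of_int_add[symmetric] simp del: of_int_add)
  from this[OF *] have "of_int (c * c') *s X u = of_int (d * d') *s X v + of_int w *s X j" .
  then show ?thesis by (auto simp: w_def)
qed

locale F4_module = F4 br e f k for br :: "complex^'l \<Rightarrow> complex^'l \<Rightarrow> complex^'l" and e f k +
  fixes V :: "complex^'l \<Rightarrow> complex^'v^'v"
  assumes V_rep: "representation br V"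
    and V_irreducible: "irreducible_rep V"
    and V_dim: "CARD('v) = 26"
    and V_weight: "has_highest_weight e k V [0, 0, 0, 1]"
begin

definition top_vector :: "complex^'v" where
  "top_vector = (SOME v. v \<noteq> 0 \<and> (\<forall>i<4. V (e i) *v v = 0 \<and> V (k i) *v v = of_nat ([0, 0, 0, 1] ! i) *s v))"

lemma top_vector:
  "top_vector \<noteq> 0" "i < 4 \<Longrightarrow> V (e i) *v top_vector = 0"
  "i < 4 \<Longrightarrow> V (k i) *v top_vector = of_int (F4_weight i 0) *s top_vector"
proof -
  have *: "top_vector \<noteq> 0 \<and> (\<forall>i<4. V (e i) *v top_vector = 0 \<and>
      V (k i) *v top_vector = of_nat ([0, 0, 0, 1] ! i) *s top_vector)"
    unfolding top_vector_def using V_weight[unfolded has_highest_weight_def] by (rule someI_ex)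
  show "top_vector \<noteq> 0" "i < 4 \<Longrightarrow> V (e i) *v top_vector = 0" using * by simp_all
  assume "i < 4"
  then have "of_nat ([0, 0, 0, 1] ! i) = (of_int (F4_weight i 0) :: complex)"
    by (auto simp: F4_weight_def less_Suc_eq numeral_eq_Suc)
  then show "V (k i) *v top_vector = of_int (F4_weight i 0) *s top_vector"
    using * \<open>i < 4\<close> by simp
qed

function B :: "nat \<Rightarrow> complex^'v" where
  "B t = (if 0 < t \<and> t < 26
     then inverse (of_int (fst (F4_lower (snd (F4_parent t)) (fst (F4_parent t))))) *s
       (V (f (snd (F4_parent t))) *v B (fst (F4_parent t)))
     else top_vector)"
  by auto
termination by (relation "Wellfounded.measure id") (auto dest: F4_table_parent(1))

declare B.simps [simp del]

lemma B_0: "B 0 = top_vector"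
  by (subst B.simps) simp

lemma B_parent:
  assumes "0 < t" "t < 26" "F4_parent t = (j, i)"
  shows "B t = inverse (of_int (fst (F4_lower i j))) *s (V (f i) *v B j)"
  using assms by (subst B.simps) simp

abbreviation lower_ok :: "nat \<Rightarrow> bool" where
  "lower_ok j \<equiv> \<forall>i<4. V (f i) *v B j = of_int (fst (F4_lower i j)) *s B (snd (F4_lower i j))"

lemma raise_and_weight_B:
  assumes "\<And>j. j < n \<Longrightarrow> lower_ok j" "t < 26" "t = 0 \<or> fst (F4_parent t) \<le> n" "l < 4"
  shows "V (e l) *v B t = of_int (fst (F4_raise l t)) *s B (snd (F4_raise l t))"
    and "V (k l) *v B t = of_int (F4_weight l t) *s B t"
proof -
  have "\<forall>l<4. V (e l) *v B t = of_int (fst (F4_raise l t)) *s B (snd (F4_raise l t)) \<and>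
      V (k l) *v B t = of_int (F4_weight l t) *s B t"
    using assms(2,3)
  proof (induction t rule: less_induct)
    case (less t)
    show ?case
    proof (cases "t = 0")
      case True
      have "fst (F4_raise l 0) = 0" if "l < 4" for l
        using F4_table_range(5)[OF that, of 0] by simp
      then show ?thesis by (simp add: True B_0 top_vector)
    next
      case False
      obtain j i where p: "F4_parent t = (j, i)" by fastforce
      obtain c where c: "F4_lower i j = (c, t)" "c \<noteq> 0" and ji: "j < t" "i < 4"
        using F4_table_parent[of t] False less.prems(1) p by (metis fst_conv snd_conv prod.collapse gr0I)
      have j26: "j < 26" using ji less.prems by simp
      have "j = 0 \<or> fst (F4_parent j) \<le> n"
        using F4_table_parent(1)[of j] j26 ji less.prems(2) False p by (cases "j = 0") auto
      then have IH: "V (e l) *v B j = of_int (fst (F4_raise l j)) *s B (snd (F4_raise l j))"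
        "V (k l) *v B j = of_int (F4_weight l j) *s B j" if "l < 4" for l
        using less.IH[OF ji(1) j26] that by simp_all
      have Bt: "B t = inverse (of_int c) *s (V (f i) *v B j)"
        using B_parent[OF _ less.prems(1) p] False c by simp
      have "V (e l) *v B t = of_int (fst (F4_raise l t)) *s B (snd (F4_raise l t))" if l: "l < 4" for l
      proof -
        obtain c' u d s d' v where eq: "F4_raise l t = (c', u)" "F4_raise l j = (d, s)" "F4_lower i s = (d', v)"
          by fastforce
        have "of_int d *s (V (f i) *v B s) = of_int (d * d') *s B v"
        proof (cases "d = 0")
          case False
          then have "s < j" using F4_table_range(3)[OF l j26] eq by simp
          moreover have "j \<le> n" using less.prems(2) \<open>t \<noteq> 0\<close> p by simp
          ultimately have "V (f i) *v B s = of_int d' *s B v" using assms(1)[of s] ji eq by simp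
          then show ?thesis by simp
        qed simp
        then have "V (e l) *v (V (f i) *v B j) =
            of_int (d * d') *s B v + (if i = l then of_int (F4_weight l j) *s B j else 0)"
          using l ji by (auto simp: e_f[OF V_rep] IH eq matrix_vector_mult_smult)
        also have "\<dots> = of_int (c * c') *s B u"
          by (rule F4_commutator_combination[OF ji(2) l j26 c(1) eq, symmetric])
        finally show ?thesis
          using c(2) by (simp add: Bt matrix_vector_mult_smult eq)
      qed
      moreover have "V (k l) *v B t = of_int (F4_weight l t) *s B t" if l: "l < 4" for l
      proof -
        have "F4_weight l t = F4_weight l j - cartan_F4 i l"
          using F4_table_weight[OF ji(2) l j26] c by simp
        then show ?thesis
          using l ji by (simp add: Bt k_f[OF V_rep] IH matrix_vector_mult_smult) (simp add: vec_eq_iff algebra_simps)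
      qed
      ultimately show ?thesis by blast
    qed
  qed
  then show "V (e l) *v B t = of_int (fst (F4_raise l t)) *s B (snd (F4_raise l t))"
    "V (k l) *v B t = of_int (F4_weight l t) *s B t"
    using assms(4) by blast+
qed

lemma level_of_int:
  "level (\<lambda>l. of_int (w l)) = of_int (11 * w 0 + 21 * w 1 + 15 * w 2 + 8 * w 3)"
  by (simp add: level_def)

lemma lower_B_step:
  assumes IH: "\<And>j. j < n \<Longrightarrow> lower_ok j" and n: "n < 26" and i: "i < 4"
  shows "V (f i) *v B n = of_int (fst (F4_lower i n)) *s B (snd (F4_lower i n))"
proof -
  obtain c s where cs: "F4_lower i n = (c, s)" by fastforce
  have s: "s < 26" using F4_table_range(1)[OF i n] cs by simp
  have "n = 0 \<or> fst (F4_parent n) \<le> n"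
    using F4_table_parent(1)[of n] n by fastforce
  note n' = raise_and_weight_B[OF IH n this]
  have s': "V (e l) *v B s = of_int (fst (F4_raise l s)) *s B (snd (F4_raise l s))"
    "V (k l) *v B s = of_int (F4_weight l n - cartan_F4 i l) *s B s" if "l < 4" "c \<noteq> 0" for l
  proof -
    have "fst (F4_parent s) \<le> n"
      using F4_table_range(4)[OF i n] cs that by simp
    then show "V (e l) *v B s = of_int (fst (F4_raise l s)) *s B (snd (F4_raise l s))"
      using raise_and_weight_B(1)[OF IH s _ that(1)] by simp
    have "F4_weight l s = F4_weight l n - cartan_F4 i l"
      using F4_table_weight[OF i that(1) n] cs that(2) by simp
    then show "V (k l) *v B s = of_int (F4_weight l n - cartan_F4 i l) *s B s"
      using raise_and_weight_B(2)[OF IH s _ that(1)] \<open>fst (F4_parent s) \<le> n\<close> by simp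
  qed
  define x where "x = V (f i) *v B n - of_int c *s B s"
  have "x = 0"
  proof (rule ccontr)
    assume x0: "x \<noteq> 0"
    have k: "V (k l) *v x = of_int (F4_weight l n - cartan_F4 i l) *s x" if l: "l < 4" for l
    proof -
      have "V (k l) *v (of_int c *s B s) = of_int (F4_weight l n - cartan_F4 i l) *s (of_int c *s B s)"
        using s'(2)[OF l] by (cases "c = 0") (simp_all add: matrix_vector_mult_smult mult.commute vec.scale_left_diff_distrib right_diff_distrib)
      moreover have "V (k l) *v (V (f i) *v B n) = of_int (F4_weight l n - cartan_F4 i l) *s (V (f i) *v B n)"
        using l i by (simp add: k_f[OF V_rep] n'(2) matrix_vector_mult_smult vec.scale_left_diff_distrib)
      ultimately show ?thesis
        by (simp add: x_def matrix_vector_mult_diff_distrib vec.scale_right_diff_distrib)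
    qed
    have e: "V (e l) *v x = 0" if l: "l < 4" for l
    proof -
      obtain c' u d t d' v where eq: "F4_raise l s = (c', u)" "F4_raise l n = (d, t)" "F4_lower i t = (d', v)"
        by fastforce
      have "of_int d *s (V (f i) *v B t) = of_int (d * d') *s B v"
      proof (cases "d = 0")
        case False
        then have "t < n" using F4_table_range(3)[OF l n] eq by simp
        then have "V (f i) *v B t = of_int d' *s B v" using IH[of t] i eq by simp
        then show ?thesis by simp
      qed simp
      then have "V (e l) *v (V (f i) *v B n) =
          of_int (d * d') *s B v + (if i = l then of_int (F4_weight l n) *s B n else 0)"
        using l i by (auto simp: e_f[OF V_rep] n' eq matrix_vector_mult_smult)
      also have "\<dots> = of_int (c * c') *s B u"
        by (rule F4_commutator_combination[OF i l n cs eq, symmetric])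
      also have "\<dots> = V (e l) *v (of_int c *s B s)"
        using s'(1)[OF l] eq by (cases "c = 0") (simp_all add: matrix_vector_mult_smult)
      finally show ?thesis by (simp add: x_def matrix_vector_mult_diff_distrib)
    qed
    have "level (\<lambda>l. of_int (F4_weight l 0)) = level (\<lambda>l. of_int (F4_weight l n - cartan_F4 i l))"
      by (rule highest_weight_level[OF V_rep V_irreducible top_vector x0 e k])
    also have "\<dots> = level (\<lambda>l. of_int (F4_weight l n)) - 1"
      using level_lower[OF i, of "\<lambda>l. of_int (F4_weight l n)"] by simp
    finally have "of_int 8 = (of_int (11 * F4_weight 0 n + 21 * F4_weight 1 n + 15 * F4_weight 2 n
        + 8 * F4_weight 3 n - 1) :: complex)"
      unfolding level_of_int by (simp add: F4_weight_def)
    then have "8 = 11 * F4_weight 0 n + 21 * F4_weight 1 n + 15 * F4_weight 2 n + 8 * F4_weight 3 n - 1"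
      by (simp only: of_int_eq_iff)
    then show False using F4_table_range(6)[OF i n] by linarith
  qed
  then show ?thesis by (simp add: x_def cs)
qed

lemma lower_B:
  assumes "j < 26" "i < 4"
  shows "V (f i) *v B j = of_int (fst (F4_lower i j)) *s B (snd (F4_lower i j))"
proof -
  have "j < 26 \<longrightarrow> lower_ok j"
  proof (induction j rule: less_induct)
    case (less n)
    have "lower_ok n" if n: "n < 26"
    proof (intro allI impI)
      fix i :: nat assume "i < 4"
      moreover have "lower_ok j" if "j < n" for j using less that n by simp
      ultimately show "V (f i) *v B n = of_int (fst (F4_lower i n)) *s B (snd (F4_lower i n))"
        using lower_B_step n by blast
    qed
    then show ?case by simp
  qed
  then show ?thesis using assms by simp
qed

lemma raise_B:
  assumes "j < 26" "i < 4"
  shows "V (e i) *v B j = of_int (fst (F4_raise i j)) *s B (snd (F4_raise i j))"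
proof -
  have "j = 0 \<or> fst (F4_parent j) \<le> 26" using F4_table_parent(1)[of j] assms by fastforce
  then show ?thesis using raise_and_weight_B(1)[of 26 j i] lower_B assms by simp
qed

lemma weight_B:
  assumes "j < 26" "i < 4"
  shows "V (k i) *v B j = of_int (F4_weight i j) *s B j"
proof -
  have "j = 0 \<or> fst (F4_parent j) \<le> 26" using F4_table_parent(1)[of j] assms by fastforce
  then show ?thesis using raise_and_weight_B(2)[of 26 j i] lower_B assms by simp
qed

lemma span_B: "vec.span (B ` {..<26}) = UNIV"
proof -
  let ?S = "vec.span (B ` {..<26})"
  have B: "B j \<in> ?S" if "j < 26" for j using that by (intro vec.span_base) auto
  have inv: "V (e i) *v u \<in> ?S" "V (f i) *v u \<in> ?S" if i: "i < 4" and u: "u \<in> ?S" for i u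
    using F4_table_range(1,2)[OF i] u i
    by (auto elim!: matrix_vector_span_invariant[rotated] intro!: vec.span_scale B simp: raise_B lower_B)
  have "\<forall>x. \<forall>v\<in>?S. V x *v v \<in> ?S"
    using generated_invariant[OF V_rep vec.subspace_span inv] by blast
  then have "?S = {0} \<or> ?S = UNIV"
    using V_irreducible vec.subspace_span[of "B ` {..<26}"] by (simp add: irreducible_rep_def)
  moreover have "B 0 \<in> ?S" by (intro vec.span_base) auto
  ultimately show ?thesis using top_vector(1) B_0 by auto
qed

lemma B_independent: "vec.independent (B ` {..<26})" "inj_on B {..<26}"
proof -
  have dim: "card (cart_basis :: (complex^'v) set) = 26"
    using V_dim by (simp add: card_cart_basis)
  have "26 \<le> card (B ` {..<26})"
    using vec.dim_le_card[of UNIV "B ` {..<26}"] span_B by (simp add: vec.dim_UNIV dim)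
  then have card: "card (B ` {..<26}) = 26"
    using card_image_le[of "{..<26}" B] by simp
  then show "inj_on B {..<26}"
    by (intro eq_card_imp_inj_on) simp_all
  show "vec.independent (B ` {..<26})"
    by (rule vec.card_le_dim_spanning[of _ UNIV]) (simp_all add: span_B vec.dim_UNIV dim card)
qed

lemma B_expansion: "\<exists>a. x = (\<Sum>j<26. a j *s B j)"
proof -
  have "x \<in> vec.span (B ` {..<26})" by (simp add: span_B)
  then obtain u where "x = (\<Sum>v\<in>B ` {..<26}. u v *s v)"
    by (auto simp: vec.span_finite)
  then have "x = (\<Sum>j<26. u (B j) *s B j)"
    by (simp add: sum.reindex[OF B_independent(2)])
  then show ?thesis by (rule exI[of _ "\<lambda>j. u (B j)"])
qed

lemma B_coefficients_zero:
  assumes "(\<Sum>j<26. a j *s B j) = 0" "j < 26"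
  shows "a j = 0"
proof -
  let ?u = "\<lambda>v. a (the_inv_into {..<26} B v)"
  have "(\<Sum>v\<in>B ` {..<26}. ?u v *s v) = 0"
    using assms(1) by (simp add: sum.reindex[OF B_independent(2)] the_inv_into_f_f[OF B_independent(2)])
  then have "?u (B j) = 0"
    using vec.independentD[OF B_independent(1), of "B ` {..<26}" ?u "B j"] assms(2) by auto
  then show ?thesis using assms(2) by (simp add: the_inv_into_f_f[OF B_independent(2)])
qed

lemma weight_expansion:
  assumes "\<And>l. l < 4 \<Longrightarrow> V (k l) *v x = c l *s x"
  shows "\<exists>a. x = (\<Sum>j<26. a j *s B j) \<and>
    (\<forall>j<26. a j \<noteq> 0 \<longrightarrow> (\<forall>l<4. c l = of_int (F4_weight l j)))"
proof -
  obtain a where a: "x = (\<Sum>j<26. a j *s B j)" using B_expansion by blast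
  have "c l = of_int (F4_weight l j)" if "j < 26" "a j \<noteq> 0" "l < 4" for j l
  proof -
    have "V (k l) *v x = (\<Sum>j<26. (a j * of_int (F4_weight l j)) *s B j)"
    proof -
      have "V (k l) *v (\<Sum>j\<in>J. a j *s B j) = (\<Sum>j\<in>J. a j *s (V (k l) *v B j))" for J
        by (induction J rule: infinite_finite_induct)
          (simp_all add: matrix_vector_right_distrib matrix_vector_mult_smult)
      then show ?thesis unfolding a using that(3) by (auto intro!: sum.cong simp: weight_B)
    qed
    then have "(\<Sum>j<26. (a j * of_int (F4_weight l j) - c l * a j) *s B j) = 0"
      using assms[OF that(3)] by (simp add: a vec.scale_sum_right vec.scale_left_diff_distrib sum_subtractf)
    from B_coefficients_zero[OF this that(1)] that(2) show ?thesis by simp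
  qed
  with a show ?thesis by blast
qed

lemma not_a_weight:
  assumes "\<And>l. l < 4 \<Longrightarrow> V (k l) *v x = c l *s x"
    and "\<And>j. j < 26 \<Longrightarrow> \<exists>l<4. c l \<noteq> of_int (F4_weight l j)"
  shows "x = 0"
proof -
  obtain a where a: "x = (\<Sum>j<26. a j *s B j)"
    "\<forall>j<26. a j \<noteq> 0 \<longrightarrow> (\<forall>l<4. c l = of_int (F4_weight l j))"
    using weight_expansion[of x c] assms(1) by blast
  have "a j = 0" if "j < 26" for j using a(2) assms(2)[OF that] that by blast
  then show ?thesis by (simp add: a(1))
qed

lemma simple_weight:
  assumes j: "j < 26" "j \<noteq> 12" "j \<noteq> 13"
    and "\<And>l. l < 4 \<Longrightarrow> V (k l) *v x = of_int (F4_weight l j) *s x"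
  shows "\<exists>a. x = a *s B j"
proof -
  obtain a where a: "x = (\<Sum>j<26. a j *s B j)"
    "\<forall>i<26. a i \<noteq> 0 \<longrightarrow> (\<forall>l<4. of_int (F4_weight l j) = (of_int (F4_weight l i) :: complex))"
    using weight_expansion[of x "\<lambda>l. of_int (F4_weight l j)"] assms(4) by blast
  have "a i = 0" if "i < 26" "i \<noteq> j" for i
  proof (rule ccontr)
    assume "a i \<noteq> 0"
    then have "F4_weight l j = F4_weight l i" if "l < 4" for l
      using a(2) that \<open>i < 26\<close> by simp
    then have "j = i \<or> {j, i} = {12, 13}" by (rule F4_weight_injective[OF j(1) that(1)])
    with that j show False by (auto simp: doubleton_eq_iff)
  qed
  then have "x = (\<Sum>i<26. if i = j then a j *s B j else 0)"
    unfolding a(1) by (intro sum.cong) auto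
  then show ?thesis using j(1) by auto
qed

lemma zero_weight:
  assumes "\<And>l. l < 4 \<Longrightarrow> V (k l) *v x = 0"
  shows "\<exists>a b. x = a *s B 12 + b *s B 13"
proof -
  have *: "V (k l) *v x = 0 *s x" if "l < 4" for l
    using assms[OF that] by simp
  have w12: "F4_weight l 12 = 0" if "l < 4" for l
    using that by (auto simp: F4_weight_def less_Suc_eq numeral_eq_Suc)
  obtain a where a: "x = (\<Sum>j<26. a j *s B j)"
    "\<forall>i<26. a i \<noteq> 0 \<longrightarrow> (\<forall>l<4. 0 = (of_int (F4_weight l i) :: complex))"
    using weight_expansion[of x "\<lambda>l. 0"] * by blast
  have "a i = 0" if "i < 26" "i \<noteq> 12" "i \<noteq> 13" for i
  proof (rule ccontr)
    assume "a i \<noteq> 0"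
    then have "F4_weight l 12 = F4_weight l i" if "l < 4" for l
      using a(2) that \<open>i < 26\<close> by (simp add: w12)
    then have "12 = i \<or> {12, i} = {12, 13}" by (intro F4_weight_injective) (use that in auto)
    with that show False by (auto simp: doubleton_eq_iff)
  qed
  then have "x = (\<Sum>i\<in>{..<26::nat}. (if i = 12 then a 12 *s B 12 else 0) + (if i = 13 then a 13 *s B 13 else 0))"
    unfolding a(1) by (intro sum.cong) auto
  also have "\<dots> = a 12 *s B 12 + a 13 *s B 13"
    by (simp add: sum.distrib)
  finally show ?thesis by blast
qed

end

lemma less_4_cases: "i < (4::nat) \<Longrightarrow> (i = 0 \<Longrightarrow> Q) \<Longrightarrow> (i = 1 \<Longrightarrow> Q) \<Longrightarrow> (i = 2 \<Longrightarrow> Q) \<Longrightarrow> (i = 3 \<Longrightarrow> Q) \<Longrightarrow> Q"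
  by linarith

lemma intertwiner_vec: "intertwiner R T A \<Longrightarrow> A *v (R g *v x) = T g *v (A *v x)"
  by (simp add: intertwiner_def matrix_vector_mul_assoc)

lemma tens_minus: "tens (- x) y = - tens x (y :: 'k::ring_1^'b)" "tens x (- y) = - tens x (y :: 'k::ring_1^'b)"
  by (simp_all add: vec_eq_iff)

lemma tens_axis: "tens (axis k 1) (axis l 1) = axis (k, l) (1 :: 'k::semiring_1)"
  by (auto simp: vec_eq_iff axis_def)

lemma matrix_vector_mult_axis: "(A *v axis k 1) $ i = A $ i $ k"
  by (simp add: matrix_vector_mult_def axis_def if_distrib cong: if_cong)

lemma tens_span_all:
  assumes "vec.subspace S" "\<And>x y. tens x y \<in> S"
  shows "u \<in> (S :: (complex^('a::finite \<times> 'b::finite)) set)"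
proof -
  have "u = (\<Sum>i\<in>UNIV. u $ i *s axis i 1)" by (simp add: basis_expansion)
  also have "\<dots> \<in> S"
    using assms(2) by (intro vec.subspace_sum[OF assms(1)] vec.subspace_scale[OF assms(1)])
      (metis tens_axis prod.collapse)
  finally show ?thesis .
qed

context F4_module
begin

abbreviation VV :: "complex^'l \<Rightarrow> complex^('v \<times> 'v)^('v \<times> 'v)" where
  "VV \<equiv> tensor_rep V V"

lemma VV_rep: "representation br VV"
  by (rule representation_tensor[OF V_rep V_rep])

lemma B_nonzero: "j < 26 \<Longrightarrow> B j \<noteq> 0"
proof
  assume j: "j < 26" "B j = 0"
  have "(\<Sum>i\<in>{..<26::nat}. (if i = j then 1 else 0) *s B i) = (\<Sum>i\<in>{..<26::nat}. 0)"
    by (intro sum.cong) (auto simp: j)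
  then show False
    using B_coefficients_zero[of "\<lambda>i. if i = j then 1 else 0" j] j by simp
qed

lemma B_13_not_multiple: "a *s B 12 + b *s B 13 = 0 \<Longrightarrow> a = 0 \<and> b = 0"
proof -
  assume *: "a *s B 12 + b *s B 13 = 0"
  have "(\<Sum>i\<in>{..<26::nat}. (if i = 12 then a else if i = 13 then b else 0) *s B i) =
      (\<Sum>i\<in>{..<26::nat}. (if i = 12 then a *s B 12 else 0) + (if i = 13 then b *s B 13 else 0))"
    by (intro sum.cong) auto
  also have "\<dots> = 0" using * by (simp add: sum.distrib)
  finally show ?thesis
    using B_coefficients_zero[of "\<lambda>i. if i = 12 then a else if i = 13 then b else 0" 12]
      B_coefficients_zero[of "\<lambda>i. if i = 12 then a else if i = 13 then b else 0" 13] by simp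
qed

lemma top_bottom:
  "i < 4 \<Longrightarrow> V (e i) *v B 0 = 0" "i < 4 \<Longrightarrow> V (f i) *v B 25 = 0"
  "i < 3 \<Longrightarrow> V (f i) *v B 0 = 0" "i < 3 \<Longrightarrow> V (e i) *v B 25 = 0"
proof -
  show "i < 4 \<Longrightarrow> V (e i) *v B 0 = 0" by (simp add: B_0 top_vector)
  show "i < 4 \<Longrightarrow> V (f i) *v B 25 = 0" by (erule less_4_cases) (simp_all add: lower_B F4_lower_def)
  show "i < 3 \<Longrightarrow> V (f i) *v B 0 = 0" "i < 3 \<Longrightarrow> V (e i) *v B 25 = 0"
    by (rule less_4_cases[of i]; simp add: lower_B F4_lower_def raise_B F4_raise_def)+
qed

definition s_vec :: "complex^('v \<times> 'v)" where
  "s_vec = tens (B 25) (B 0)"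

lemma s_vec_generates:
  assumes S: "vec.subspace S" and inv: "\<And>g u. u \<in> S \<Longrightarrow> VV g *v u \<in> S" and s: "s_vec \<in> S"
  shows "u \<in> S"
proof -
  have 1: "tens (B 25) y \<in> S" for y
  proof -
    have "y \<in> vec.span (f_words V (B 0))"
      using highest_weight_span(1)[OF V_rep V_irreducible, of "B 0"] top_vector by (simp add: B_0)
    then show ?thesis
    proof (induction rule: vec.span_induct)
      show "vec.subspace {y. tens (B 25) y \<in> S}"
        by (auto intro!: vec.subspaceI simp: tens_add_right tens_smult_right
            vec.subspace_0[OF S] vec.subspace_add[OF S] vec.subspace_scale[OF S])
    next
      fix y assume "y \<in> f_words V (B 0)"
      then show "tens (B 25) y \<in> S"
      proof induction
        case base
        show ?case using s by (simp add: s_vec_def)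
      next
        case (step y i)
        have "VV (f i) *v tens (B 25) y = tens (B 25) (V (f i) *v y)"
          by (simp add: tensor_rep_tens top_bottom step(2))
        then show ?case using inv[OF step.IH, of "f i"] by simp
      qed
    qed
  qed
  let ?S2 = "{x. \<forall>y. tens x y \<in> S}"
  have "vec.subspace ?S2"
    by (auto intro!: vec.subspaceI simp: tens_add_left tens_smult_left
        vec.subspace_0[OF S] vec.subspace_add[OF S] vec.subspace_scale[OF S])
  moreover have "V g *v x \<in> ?S2" if x: "x \<in> ?S2" for g x
  proof -
    have "tens (V g *v x) y = VV g *v tens x y - tens x (V g *v y)" for y
      by (simp add: tensor_rep_tens)
    then show ?thesis using x inv by (auto intro!: vec.subspace_diff[OF S])
  qed
  ultimately have "?S2 = {0} \<or> ?S2 = UNIV"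
    using V_irreducible by (simp add: irreducible_rep_def)
  moreover have "B 25 \<in> ?S2" using 1 by simp
  moreover have "B 25 \<noteq> 0" by (rule B_nonzero) simp
  ultimately have "?S2 = UNIV" by blast
  then have "tens x y \<in> S" for x y by blast
  then show ?thesis by (rule tens_span_all[OF S])
qed

lemma intertwiner_determined:
  assumes A: "intertwiner VV T A" and "A *v s_vec = 0"
  shows "A = 0"
proof -
  have "u \<in> {u. A *v u = 0}" for u
  proof (rule s_vec_generates)
    show "vec.subspace {u. A *v u = 0}"
      by (auto intro!: vec.subspaceI simp: matrix_vector_right_distrib matrix_vector_mult_smult)
  qed (use assms(2) in \<open>auto simp: intertwiner_vec[OF A]\<close>)
  then have "(A *v axis k 1) $ i = 0" for i k by simp
  then show ?thesis by (simp add: matrix_vector_mult_axis vec_eq_iff)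
qed

lemma s_vec_invariant:
  "l < 4 \<Longrightarrow> VV (k l) *v s_vec = 0" "i < 3 \<Longrightarrow> VV (e i) *v s_vec = 0" "i < 3 \<Longrightarrow> VV (f i) *v s_vec = 0"
  "VV (e 3) *v (VV (e 3) *v s_vec) = 0"
proof -
  show "VV (k l) *v s_vec = 0" if "l < 4"
    using that by (rule less_4_cases)
      (simp_all add: s_vec_def tensor_rep_tens weight_B F4_weight_def tens_smult_left tens_smult_right tens_minus)
  show "i < 3 \<Longrightarrow> VV (e i) *v s_vec = 0" "i < 3 \<Longrightarrow> VV (f i) *v s_vec = 0"
    by (simp_all add: s_vec_def tensor_rep_tens top_bottom)
  show "VV (e 3) *v (VV (e 3) *v s_vec) = 0"
    by (simp add: s_vec_def tensor_rep_tens top_bottom raise_B F4_raise_def)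
qed

end

locale F4_pairing = F4_module br e f k V
  for br :: "complex^'l \<Rightarrow> complex^'l \<Rightarrow> complex^'l" and e f k and V :: "complex^'l \<Rightarrow> complex^'v^'v" +
  fixes p :: "complex^('v \<times> 'v)^unit" and b :: "complex^unit^('v \<times> 'v)"
  assumes pairing: "invariant_pairing V p b"
begin

abbreviation P :: "complex^'v^'v" where "P \<equiv> form_matrix p"

lemma p_intertwiner: "intertwiner VV trivial_rep p" and b_intertwiner: "intertwiner trivial_rep VV b"
  using pairing by (simp_all add: invariant_pairing_def)

lemma P_inverse: "P ** coform_matrix b = mat 1"
  using pairing by (intro form_inverse) (simp add: invariant_pairing_def)

lemma P_symmetric: "transpose P = P"
  using pairing by (intro form_symmetric) (simp add: invariant_pairing_def)

lemma P_skew: "transpose (V g) ** P = - (P ** V g)"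
  by (rule form_skew[OF p_intertwiner])

lemma form_invariant: "bil P (V g *v x) y = - bil P x (V g *v y)"
  by (rule bil_skew[OF P_skew])

lemma form2_invariant: "bil (P \<otimes> P) (VV g *v x) y = - bil (P \<otimes> P) x (VV g *v y)"
  by (rule bil_skew[OF tensor_form_skew[OF P_skew]])

lemma form_nondegenerate: "(\<And>v. bil P u v = 0) \<Longrightarrow> u = 0"
  by (rule bil_nondegenerate[OF P_inverse])

lemma form2_nondegenerate:
  assumes "\<And>v. bil (P \<otimes> P) u v = 0"
  shows "u = 0"
proof (rule bil_nondegenerate[OF _ assms])
  show "(P \<otimes> P) ** (coform_matrix b \<otimes> coform_matrix b) = mat 1"
    by (simp add: kron_mult P_inverse kron_one)
qed

lemma form_weights:
  assumes "V g *v x = c *s x" "V g *v y = d *s y" "c + d \<noteq> 0"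
  shows "bil P x y = 0"
proof -
  have "c * bil P x y = - (d * bil P x y)"
    using form_invariant[of g x y] by (simp add: assms bil_smult)
  then have "(c + d) * bil P x y = 0" by (simp add: distrib_right)
  with assms(3) show ?thesis by simp
qed

lemma form_B_zero:
  assumes "i < 26" "j < 26" "l < 4" "F4_weight l i + F4_weight l j \<noteq> 0"
  shows "bil P (B i) (B j) = 0"
  using assms(4) by (intro form_weights[OF weight_B[OF assms(1,3)] weight_B[OF assms(2,3)]])
    (metis of_int_add of_int_eq_0_iff)

lemma form_B_nonzero:
  assumes x: "x \<noteq> 0" and "\<And>i. i < 26 \<Longrightarrow> i \<noteq> j \<Longrightarrow> bil P x (B i) = 0"
  shows "bil P x (B j) \<noteq> 0"
proof
  assume 0: "bil P x (B j) = 0"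
  have "bil P x v = 0" for v
  proof -
    obtain a where v: "v = (\<Sum>i<26. a i *s B i)" using B_expansion by blast
    have "bil P x (\<Sum>i\<in>I. a i *s B i) = (\<Sum>i\<in>I. a i * bil P x (B i))" for I
      by (induction I rule: infinite_finite_induct) (simp_all add: bil_add bil_smult)
    moreover have "bil P x (B i) = 0" if "i < 26" for i
      using assms(2) 0 that by (cases "i = j") auto
    ultimately show ?thesis by (simp add: v)
  qed
  then have "x = 0" by (rule form_nondegenerate)
  with x show False by simp
qed

lemma form_B_opposite:
  assumes "i < 26" "j < 26" "j \<noteq> 12" "j \<noteq> 13" and opp: "\<And>l. l < 4 \<Longrightarrow> F4_weight l i = - F4_weight l j"
  shows "bil P (B i) (B j) \<noteq> 0"
proof (rule form_B_nonzero[OF B_nonzero[OF assms(1)]])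
  fix m assume m: "m < 26" "m \<noteq> j"
  have "\<exists>l<4. F4_weight l i + F4_weight l m \<noteq> 0"
  proof (rule ccontr)
    assume "\<not> ?thesis"
    then have "F4_weight l m = F4_weight l j" if "l < 4" for l
      using opp[OF that] that by force
    then have "m = j \<or> {m, j} = {12, 13}" by (rule F4_weight_injective[OF m(1) assms(2)])
    with m assms(3,4) show False by (auto simp: doubleton_eq_iff)
  qed
  then show "bil P (B i) (B m) = 0" using form_B_zero[OF assms(1) m(1)] by blast
qed

lemma form_opposite_pairs:
  "bil P (B 0) (B 25) \<noteq> 0" "bil P (B 25) (B 0) \<noteq> 0" "bil P (B 1) (B 24) \<noteq> 0" "bil P (B 6) (B 19) \<noteq> 0"
proof -
  show "bil P (B 0) (B 25) \<noteq> 0"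
    by (rule form_B_opposite) (simp_all, erule less_4_cases, simp_all add: F4_weight_def)
  show "bil P (B 25) (B 0) \<noteq> 0"
    by (rule form_B_opposite) (simp_all, erule less_4_cases, simp_all add: F4_weight_def)
  show "bil P (B 1) (B 24) \<noteq> 0"
    by (rule form_B_opposite) (simp_all, erule less_4_cases, simp_all add: F4_weight_def)
  show "bil P (B 6) (B 19) \<noteq> 0"
    by (rule form_B_opposite) (simp_all, erule less_4_cases, simp_all add: F4_weight_def)
qed

text \<open>The zero weight vector that is invariant under the subalgebra \<open>B\<^sub>3\<close> of the first three nodes.\<close>

definition z0 :: "complex^'v" where
  "z0 = B 12 - 2 *s B 13"

lemma z0: "V (e 2) *v z0 = 0" "V (f 2) *v z0 = 0" "V (e 3) *v z0 = -3 *s B 10" "V (f 3) *v z0 = -3 *s B 15"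
  "z0 \<noteq> 0"
proof -
  show "V (e 2) *v z0 = 0" "V (f 2) *v z0 = 0" "V (e 3) *v z0 = -3 *s B 10" "V (f 3) *v z0 = -3 *s B 15"
    by (simp_all add: z0_def matrix_vector_mult_diff_distrib matrix_vector_mult_smult raise_B lower_B
        F4_raise_def F4_lower_def) (simp_all add: vec_eq_iff)
  show "z0 \<noteq> 0"
    using B_13_not_multiple[of 1 "-2"] by (auto simp: z0_def)
qed

lemma z0_multiple:
  assumes "\<And>l. l < 4 \<Longrightarrow> V (k l) *v x = 0" "V (e 2) *v x = 0"
  shows "\<exists>a. x = a *s z0"
proof -
  obtain c d where x: "x = c *s B 12 + d *s B 13" using zero_weight assms(1) by blast
  have "(2 * c + d) *s B 11 = 0"
    using assms(2) by (simp add: x matrix_vector_right_distrib matrix_vector_mult_smult raise_B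
        F4_raise_def vec.scale_left_distrib mult.commute)
  then have "2 * c + d = 0 \<or> B 11 = 0" by (simp only: vec.scale_eq_0_iff)
  then have "d = - 2 * c" using B_nonzero[of 11] by (simp add: eq_neg_iff_add_eq_0 add.commute)
  then have "x = c *s z0"
    by (simp add: x z0_def vec.scale_right_diff_distrib mult.commute)
  then show ?thesis by blast
qed

lemma form_z0: "bil P z0 (B 13) \<noteq> 0"
proof (rule form_B_nonzero[OF z0(5)])
  fix i assume i: "i < 26" "i \<noteq> (13 :: nat)"
  show "bil P z0 (B i) = 0"
  proof (cases "i = 12")
    case True
    have "B 12 = V (f 2) *v B 11" by (simp add: lower_B F4_lower_def)
    then have "bil P z0 (B 12) = - bil P (V (f 2) *v z0) (B 11)"
      by (simp add: form_invariant)
    then show ?thesis by (simp add: True z0)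
  next
    case False
    have "\<exists>l<4. F4_weight l i \<noteq> 0"
    proof (rule ccontr)
      assume *: "\<not> ?thesis"
      have "F4_weight l i = F4_weight l 12" if "l < 4" for l
        using * that by (auto elim!: less_4_cases simp: F4_weight_def)
      then have "i = 12 \<or> {i, 12} = {12, 13}" by (intro F4_weight_injective[OF i(1)]) auto
      with i False show False by (auto simp: doubleton_eq_iff)
    qed
    then obtain l where l: "l < 4" "F4_weight l i \<noteq> 0" by blast
    have "V (k l) *v z0 = 0 *s z0"
      using l(1) by (rule less_4_cases)
        (simp_all add: z0_def matrix_vector_mult_diff_distrib matrix_vector_mult_smult weight_B F4_weight_def)
    from form_weights[OF this weight_B[OF i(1) l(1)]] l(2) show ?thesis by simp
  qed
qed

end

section \<open>The commutant of the tensor square\<close>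

lemma underdetermined_system:
  fixes \<phi> :: "nat \<Rightarrow> 'i \<Rightarrow> 'k::field"
  assumes "finite K" "n < card K"
  shows "\<exists>c. (\<exists>m\<in>K. c m \<noteq> 0) \<and> (\<forall>i<n. (\<Sum>m\<in>K. c m * \<phi> i m) = 0)"
  using assms
proof (induction n arbitrary: K \<phi>)
  case 0
  then obtain m where "m \<in> K" by fastforce
  then show ?case by (intro exI[of _ "\<lambda>_. 1"]) auto
next
  case (Suc n)
  show ?case
  proof (cases "\<exists>j\<in>K. \<phi> n j \<noteq> 0")
    case False
    obtain c where c: "\<exists>m\<in>K. c m \<noteq> 0" "\<forall>i<n. (\<Sum>m\<in>K. c m * \<phi> i m) = 0"
      using Suc.IH[of K \<phi>] Suc.prems by auto
    have "(\<Sum>m\<in>K. c m * \<phi> n m) = 0" using False by (intro sum.neutral) auto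
    with c show ?thesis by (auto simp: less_Suc_eq)
  next
    case True
    then obtain j where j: "j \<in> K" "\<phi> n j \<noteq> 0" by blast
    define K' where "K' = K - {j}"
    have K': "finite K'" "n < card K'" "K = insert j K'" "j \<notin> K'"
      using Suc.prems j by (auto simp: K'_def)
    obtain c where c: "\<exists>m\<in>K'. c m \<noteq> 0"
      "\<forall>i<n. (\<Sum>m\<in>K'. c m * (\<phi> i m - \<phi> i j * \<phi> n m / \<phi> n j)) = 0"
      using Suc.IH[of K' "\<lambda>i m. \<phi> i m - \<phi> i j * \<phi> n m / \<phi> n j"] K' by blast
    define d where "d m = (if m = j then - (\<Sum>m\<in>K'. c m * \<phi> n m) / \<phi> n j else c m)" for m
    have d: "(\<Sum>m\<in>K. d m * \<phi> i m) = d j * \<phi> i j + (\<Sum>m\<in>K'. c m * \<phi> i m)" for i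
    proof -
      have "(\<Sum>m\<in>K'. d m * \<phi> i m) = (\<Sum>m\<in>K'. c m * \<phi> i m)"
        using K'(4) by (intro sum.cong) (auto simp: d_def)
      then show ?thesis using K' by simp
    qed
    have "(\<Sum>m\<in>K. d m * \<phi> i m) = 0" if "i < Suc n" for i
    proof (cases "i = n")
      case True
      then show ?thesis using j(2) unfolding d by (simp add: d_def)
    next
      case False
      have "(\<Sum>m\<in>K'. c m * (\<phi> i m - \<phi> i j * \<phi> n m / \<phi> n j)) =
          (\<Sum>m\<in>K'. c m * \<phi> i m) - (\<Sum>m\<in>K'. c m * \<phi> n m) / \<phi> n j * \<phi> i j"
        by (simp add: algebra_simps sum_subtractf sum_distrib_left sum_divide_distrib)
      then show ?thesis using c(2) False that unfolding d by (simp add: d_def)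
    qed
    moreover have "\<exists>m\<in>K. d m \<noteq> 0" using c(1) K' by (auto simp: d_def)
    ultimately show ?thesis by blast
  qed
qed

context F4_pairing
begin

text \<open>The form identifies \<open>V \<otimes> V\<close> with the endomorphisms of \<open>V\<close>.\<close>

definition endo :: "complex^('v \<times> 'v) \<Rightarrow> complex^'v^'v" where
  "endo u = (\<chi> i j. u $ (i, j)) ** P"

lemma endo_add: "endo (u + v) = endo u + endo v"
  by (simp add: endo_def matrix_add_rdistrib[symmetric]) (simp add: vec_eq_iff matrix_matrix_mult_def)

lemma endo_smult: "endo (c *s u) = c \<odot> endo u"
  by (simp add: endo_def smul_mult_left[symmetric]) (simp add: vec_eq_iff matrix_matrix_mult_def)

lemma endo_rep: "endo (VV g *v u) = V g ** endo u - endo u ** V g"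
proof -
  let ?U = "\<chi> i j. u $ (i, j)"
  have "(VV g *v u) $ (i, j) = (V g ** ?U + ?U ** transpose (V g)) $ i $ j" for i j
  proof -
    have "((V g \<otimes> mat 1) *v u) $ (i, j) = (\<Sum>k\<in>UNIV. V g $ i $ k * u $ (k, j))"
      by (simp add: matrix_vector_mult_def sum_UNIV_prod mat_def if_distrib if_distribR cong: if_cong)
    moreover have "((mat 1 \<otimes> V g) *v u) $ (i, j) = (\<Sum>l\<in>UNIV. V g $ j $ l * u $ (i, l))"
      by (simp add: matrix_vector_mult_def sum_UNIV_prod)
        (subst sum.swap, simp add: mat_def if_distrib if_distribR cong: if_cong)
    ultimately show ?thesis
      by (simp add: tensor_rep_def matrix_vector_mult_add_rdistrib)
        (simp add: matrix_matrix_mult_def transpose_def mult.commute)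
  qed
  then have "(\<chi> i j. (VV g *v u) $ (i, j)) = V g ** ?U + ?U ** transpose (V g)"
    by (simp add: vec_eq_iff)
  then have "endo (VV g *v u) = (V g ** ?U) ** P + ?U ** (transpose (V g) ** P)"
    by (simp add: endo_def matrix_add_rdistrib matrix_mul_assoc)
  also have "\<dots> = V g ** endo u - endo u ** V g"
  proof -
    have "?U ** (- (P ** V g)) = - (?U ** (P ** V g))"
      by (simp add: vec_eq_iff matrix_matrix_mult_def[of ?U] sum_negf)
    then show ?thesis by (simp add: endo_def P_skew matrix_mul_assoc)
  qed
  finally show ?thesis .
qed

lemma endo_eq_0: "endo u = 0 \<Longrightarrow> u = 0"
proof -
  assume "endo u = 0"
  then have "(\<chi> i j. u $ (i, j)) ** (P ** coform_matrix b) = 0"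
    by (simp add: endo_def matrix_mul_assoc)
  then show ?thesis by (simp add: P_inverse vec_eq_iff)
qed

definition functional :: "nat \<Rightarrow> complex^('v \<times> 'v) \<Rightarrow> complex" where
  "functional i u = bil P (endo u *v (if i = 4 then z0 else B ([0, 25, 1, 6] ! i))) (B ([25, 0, 24, 19, 13] ! i))"

lemma functional_linear: "functional i (\<Sum>m\<in>K. c m *s u m) = (\<Sum>m\<in>K. c m * functional i (u m))"
proof -
  have "functional i 0 = 0"
    by (simp add: functional_def endo_def) (simp add: bil_def matrix_vector_mult_def matrix_matrix_mult_def)
  then show ?thesis
    by (induction K rule: infinite_finite_induct)
      (simp_all add: functional_def endo_add endo_smult matrix_vector_mult_add_rdistrib bil_add
        smul_matrix_vector bil_smult)
qed

lemma functionals_separate: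
  assumes k: "\<And>l. l < 4 \<Longrightarrow> VV (k l) *v u = 0"
    and e: "\<And>i. i < 3 \<Longrightarrow> VV (e i) *v u = 0" and f: "\<And>i. i < 3 \<Longrightarrow> VV (f i) *v u = 0"
    and e3: "VV (e 3) *v (VV (e 3) *v u) = 0"
    and fn: "\<And>i. i < 5 \<Longrightarrow> functional i u = 0"
  shows "u = 0"
proof -
  define M where "M = endo u"
  have comm: "M *v (V g *v x) = V g *v (M *v x)" if "VV g *v u = 0" for g x
  proof -
    have "endo 0 = 0" using endo_smult[of 0 0] by (simp add: vec_eq_iff)
    then have "V g ** M = M ** V g" using endo_rep[of g u] that by (simp add: M_def)
    then show ?thesis by (simp add: matrix_vector_mul_assoc)
  qed
  have weight: "V (k l) *v (M *v x) = c *s (M *v x)" if "V (k l) *v x = c *s x" "l < 4" for l x c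
    using comm[OF k[OF that(2)], of x] that(1) by (simp add: matrix_vector_mult_smult)
  have M_B: "\<exists>a. M *v B j = a *s B j" if "j < 26" "j \<noteq> 12" "j \<noteq> 13" for j
    by (rule simple_weight[OF that]) (rule weight[OF weight_B[OF that(1)]])
  have M_0: "M *v B j = 0"
    if j: "j < 26" "j \<noteq> 12" "j \<noteq> 13" and "bil P (B j) y \<noteq> 0" "bil P (M *v B j) y = 0" for j y
  proof -
    obtain a where "M *v B j = a *s B j" using M_B[OF j] by blast
    with that(4,5) show ?thesis by (simp add: bil_smult)
  qed
  have fn': "bil P (M *v B 0) (B 25) = 0" "bil P (M *v B 25) (B 0) = 0" "bil P (M *v B 1) (B 24) = 0"
    "bil P (M *v B 6) (B 19) = 0" "bil P (M *v z0) (B 13) = 0"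
    using fn[of 0] fn[of 1] fn[of 2] fn[of 3] fn[of 4] by (simp_all add: functional_def M_def numeral_eq_Suc)
  have step: "M *v B t = 0" if "M *v B j = 0" "i < 3" "F4_lower i j = (c, t)" "c \<noteq> 0" "j < 26" for i j c t
  proof -
    have "V (f i) *v B j = of_int c *s B t" using lower_B[of j i] that by simp
    then have "of_int c *s (M *v B t) = 0"
      using comm[OF f[OF that(2)], of "B j"] that(1) by (simp add: matrix_vector_mult_smult)
    then show ?thesis using that(4) by (simp add: vec.scale_eq_0_iff)
  qed
  have 0: "M *v B 0 = 0" by (rule M_0[OF _ _ _ form_opposite_pairs(1) fn'(1)]) simp_all
  have 25: "M *v B 25 = 0" by (rule M_0[OF _ _ _ form_opposite_pairs(2) fn'(2)]) simp_all
  have 1: "M *v B 1 = 0" by (rule M_0[OF _ _ _ form_opposite_pairs(3) fn'(3)]) simp_all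
  have 6: "M *v B 6 = 0" by (rule M_0[OF _ _ _ form_opposite_pairs(4) fn'(4)]) simp_all
  have 2: "M *v B 2 = 0" by (rule step[OF 1, of 2 1]) (simp_all add: F4_lower_def)
  have 3: "M *v B 3 = 0" by (rule step[OF 2, of 1 1]) (simp_all add: F4_lower_def)
  have 4: "M *v B 4 = 0" by (rule step[OF 3, of 2 1]) (simp_all add: F4_lower_def)
  have 5: "M *v B 5 = 0" by (rule step[OF 3, of 0 1]) (simp_all add: F4_lower_def)
  have 7: "M *v B 7 = 0" by (rule step[OF 4, of 0 1]) (simp_all add: F4_lower_def)
  have 8: "M *v B 8 = 0" by (rule step[OF 7, of 1 1]) (simp_all add: F4_lower_def)
  have 10: "M *v B 10 = 0" by (rule step[OF 8, of 2 1]) (simp_all add: F4_lower_def)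
  have 9: "M *v B 9 = 0" by (rule step[OF 6, of 0 1]) (simp_all add: F4_lower_def)
  have 11: "M *v B 11 = 0" by (rule step[OF 9, of 1 1]) (simp_all add: F4_lower_def)
  have 12: "M *v B 12 = 0" by (rule step[OF 11, of 2 1]) (simp_all add: F4_lower_def)
  have 14: "M *v B 14 = 0" by (rule step[OF 12, of 2 2]) (simp_all add: F4_lower_def)
  have 16: "M *v B 16 = 0" by (rule step[OF 14, of 1 1]) (simp_all add: F4_lower_def)
  have 19: "M *v B 19 = 0" by (rule step[OF 16, of 0 1]) (simp_all add: F4_lower_def)
  have "M *v z0 = 0"
  proof -
    have "\<exists>a. M *v z0 = a *s z0"
    proof (rule z0_multiple)
      show "V (k l) *v (M *v z0) = 0" if "l < 4" for l
        using weight[of l z0 0] that by (auto elim!: less_4_cases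
            simp: z0_def matrix_vector_mult_diff_distrib matrix_vector_mult_smult weight_B F4_weight_def)
      show "V (e 2) *v (M *v z0) = 0"
        using comm[OF e, of 2 z0] by (simp add: z0)
    qed
    with fn'(5) form_z0 show ?thesis by (auto simp: bil_smult)
  qed
  then have 13: "M *v B 13 = 0"
    by (simp add: z0_def matrix_vector_mult_diff_distrib matrix_vector_mult_smult 12 vec.scale_eq_0_iff)
  have 15: "M *v B 15 = 0"
  proof -
    obtain a where a: "M *v B 15 = a *s B 15" using M_B[of 15] by auto
    let ?E = "V (e 3)"
    have E: "?E *v B 15 = B 13" "?E *v B 13 = 2 *s B 10" by (simp_all add: raise_B F4_raise_def)
    have "endo 0 = 0" using endo_smult[of 0 0] by (simp add: vec_eq_iff)
    then have "(?E ** (?E ** M - M ** ?E) - (?E ** M - M ** ?E) ** ?E) *v B 15 = 0"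
      using e3 endo_rep[of "e 3" "VV (e 3) *v u"] by (simp add: endo_rep M_def)
    then have "?E *v (?E *v (M *v B 15)) = 0"
      by (simp add: matrix_vector_mult_diff_rdistrib matrix_vector_mult_diff_distrib
          matrix_vector_mul_assoc[symmetric] E 13 10 matrix_vector_mult_smult)
    then have "(a * 2) *s B 10 = 0" by (simp add: a E matrix_vector_mult_smult)
    then have "a = 0" using B_nonzero[of 10] by (simp add: vec.scale_eq_0_iff)
    with a show ?thesis by simp
  qed
  have 17: "M *v B 17 = 0" by (rule step[OF 15, of 2 1]) (simp_all add: F4_lower_def)
  have 18: "M *v B 18 = 0" by (rule step[OF 17, of 1 1]) (simp_all add: F4_lower_def)
  have 20: "M *v B 20 = 0" by (rule step[OF 18, of 2 1]) (simp_all add: F4_lower_def)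
  have 21: "M *v B 21 = 0" by (rule step[OF 18, of 0 1]) (simp_all add: F4_lower_def)
  have 22: "M *v B 22 = 0" by (rule step[OF 20, of 0 1]) (simp_all add: F4_lower_def)
  have 23: "M *v B 23 = 0" by (rule step[OF 22, of 1 1]) (simp_all add: F4_lower_def)
  have 24: "M *v B 24 = 0" by (rule step[OF 23, of 2 1]) (simp_all add: F4_lower_def)
  have "M *v B j = 0" if "j < 26" for j
  proof -
    have "\<forall>j\<in>{0,1,2,3,4,5,6,7,8,9,10,11,12,13,14,15,16,17,18,19,20,21,22,23,24,25}. M *v B j = 0"
      by (simp add: 0 1 2 3 4 5 6 7 8 9 10 11 12 13 14 15 16 17 18 19 20 21 22 23 24 25 del: One_nat_def)
    moreover have "j \<in> {0,1,2,3,4,5,6,7,8,9,10,11,12,13,14,15,16,17,18,19,20,21,22,23,24,25}"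
      using that by (simp, presburger)
    ultimately show ?thesis by (rule bspec)
  qed
  then have "vec.span (B ` {..<26}) \<subseteq> {x. M *v x = 0}"
    by (intro vec.span_minimal)
      (auto intro!: vec.subspaceI simp: matrix_vector_right_distrib matrix_vector_mult_smult)
  then have "M *v x = 0" for x
    by (auto simp: span_B)
  then have "(M *v axis j 1) $ i = 0" for i j
    by simp
  then have "M = 0" by (simp add: matrix_vector_mult_axis vec_eq_iff)
  then show ?thesis unfolding M_def by (rule endo_eq_0)
qed

lemma matrix_vector_sum_left: "(\<Sum>m\<in>K. c m \<odot> A m) *v x = (\<Sum>m\<in>K. c m *s (A m *v (x :: complex^'n)))"
  by (induction K rule: infinite_finite_induct)
    (simp_all add: matrix_vector_mult_add_rdistrib smul_matrix_vector)

lemma commutant_spanned: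
  fixes A :: "nat \<Rightarrow> complex^('v \<times> 'v)^('v \<times> 'v)"
  assumes A: "\<And>m. m < 5 \<Longrightarrow> intertwiner VV VV (A m)" and X: "intertwiner VV VV X"
    and indep: "\<And>c m. (\<Sum>m<5. c m \<odot> A m) = 0 \<Longrightarrow> m < 5 \<Longrightarrow> c m = 0"
  shows "\<exists>c. X = (\<Sum>m<5. c m \<odot> A m)"
proof -
  define A' where "A' m = (if m < 5 then A m else X)" for m
  have A': "intertwiner VV VV (A' m)" for m using A X by (simp add: A'_def)
  obtain c where c: "\<exists>m\<in>{..<6}. c m \<noteq> 0"
    "\<forall>i<5. (\<Sum>m\<in>{..<6}. c m * functional i (A' m *v s_vec)) = 0"
    using underdetermined_system[of "{..<6::nat}" 5 "\<lambda>i m. functional i (A' m *v s_vec)"] by auto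
  define Z where "Z = (\<Sum>m\<in>{..<6}. c m \<odot> A' m)"
  have Z: "intertwiner VV VV Z" unfolding Z_def by (intro intertwiner_sum intertwiner_smul A')
  have "functional i (Z *v s_vec) = 0" if "i < 5" for i
    unfolding Z_def matrix_vector_sum_left functional_linear using c(2) that by simp
  then have "Z *v s_vec = 0"
    by (rule functionals_separate[rotated -1]) (simp_all add: intertwiner_vec[OF Z, symmetric] s_vec_invariant)
  then have "Z = 0" by (rule intertwiner_determined[OF Z])
  moreover have "Z = (\<Sum>m<5. c m \<odot> A m) + c 5 \<odot> X"
  proof -
    have "{..<6::nat} = insert 5 {..<5}" by auto
    then show ?thesis by (simp add: Z_def A'_def add.commute)
  qed
  ultimately have Z0: "(\<Sum>m<5. c m \<odot> A m) + c 5 \<odot> X = 0" by simp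
  have "c 5 \<noteq> 0"
  proof
    assume c5: "c 5 = 0"
    then have "(\<Sum>m<5. c m \<odot> A m) = 0" using Z0 by (simp add: vec_eq_iff)
    then have "c m = 0" if "m < 5" for m using indep that by blast
    moreover have "m < 5 \<or> m = 5" if "m < 6" for m :: nat using that by linarith
    ultimately show False using c(1) c5 by auto
  qed
  have "X = (- 1 / c 5) \<odot> (\<Sum>m<5. c m \<odot> A m)"
  proof -
    have "(\<Sum>m<5. c m \<odot> A m) = - (c 5 \<odot> X)" using Z0 by (simp add: eq_neg_iff_add_eq_0)
    then show ?thesis using \<open>c 5 \<noteq> 0\<close> by (simp add: vec_eq_iff)
  qed
  then have "X = (\<Sum>m<5. (- 1 / c 5 * c m) \<odot> A m)" by (simp add: smul_sum_right smul_smul)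
  then show ?thesis by (rule exI[of _ "\<lambda>m. - 1 / c 5 * c m"])
qed

end

section \<open>Summands of the tensor square\<close>

lemma matrix_vector_mult_minus: "A *v (- x) = - (A *v (x :: 'k::ring_1^'s))"
  by (simp add: vec_eq_iff matrix_vector_mult_def sum_negf)

lemma summand_projection_factor:
  assumes "summand_projection R T Q"
  obtains \<iota> \<psi> where "intertwiner R T \<iota>" "inj ((*v) \<iota>)" "\<And>u. Q *v u = \<iota> *v \<psi> u"
    "\<And>g u. \<psi> (T g *v u) = R g *v \<psi> u" "\<And>u v. \<psi> (u + v) = \<psi> u + \<psi> v" "\<And>c u. \<psi> (c *s u) = c *s \<psi> u"
    "\<And>y. Q *v (\<iota> *v y) = \<iota> *v y"
proof -
  obtain \<iota> where \<iota>: "intertwiner R T \<iota>" "inj ((*v) \<iota>)" "range ((*v) Q) = range ((*v) \<iota>)"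
    and Q: "intertwiner T T Q" "Q ** Q = Q"
    using assms unfolding summand_projection_def by (elim conjE exE)
  define \<psi> where "\<psi> u = inv ((*v) \<iota>) (Q *v u)" for u
  have \<psi>: "\<iota> *v \<psi> u = Q *v u" for u
  proof -
    have "Q *v u \<in> range ((*v) \<iota>)" using \<iota>(3) by auto
    then show ?thesis unfolding \<psi>_def by (rule f_inv_into_f)
  qed
  have \<psi>_eqI: "\<psi> u = y" if "Q *v u = \<iota> *v y" for u y
    using \<iota>(2) that by (simp add: \<psi>_def)
  show ?thesis
  proof (rule that[OF \<iota>(1,2), of \<psi>])
    show "Q *v u = \<iota> *v \<psi> u" for u by (simp add: \<psi>)
    show "\<psi> (T g *v u) = R g *v \<psi> u" for g u
      by (rule \<psi>_eqI) (simp add: intertwiner_vec[OF Q(1)] intertwiner_vec[OF \<iota>(1)] \<psi>)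
    show "\<psi> (u + v) = \<psi> u + \<psi> v" for u v
      by (rule \<psi>_eqI) (simp add: matrix_vector_right_distrib \<psi>)
    show "\<psi> (c *s u) = c *s \<psi> u" for c u
      by (rule \<psi>_eqI) (simp add: matrix_vector_mult_smult \<psi>)
    show "Q *v (\<iota> *v y) = \<iota> *v y" for y
    proof -
      have "\<iota> *v y \<in> range ((*v) Q)" using \<iota>(3) by auto
      then obtain u where "\<iota> *v y = Q *v u" by auto
      then show ?thesis by (simp add: matrix_vector_mul_assoc Q(2))
    qed
  qed
qed

lemma F4_table_raise_from_below:
  assumes "t < 25"
  shows "\<exists>i<4. \<exists>j<26. t < j \<and> F4_raise i j = (1, t)"
proof -
  have "list_all (\<lambda>t. list_ex (\<lambda>i. list_ex (\<lambda>j. F4_raise i j = (1, t)) [Suc t..<26]) [0..<4]) [0..<25]"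
    by code_simp
  then have "list_ex (\<lambda>i. list_ex (\<lambda>j. F4_raise i j = (1, t)) [Suc t..<26]) [0..<4]"
    using assms by (simp add: list_all_iff)
  then obtain i j where "i < 4" "F4_raise i j = (1, t)" "t < j" "j < 26"
    by (auto simp: list_ex_iff Suc_le_eq)
  then show ?thesis by blast
qed

lemma F4_not_weights:
  assumes "j < 26"
  shows "\<exists>l<4. F4_weight l j \<noteq> [0, 0, 0, 2] ! l" "\<exists>l<4. F4_weight l j \<noteq> [0, 0, 1, 0] ! l"
    and "\<exists>l<4. F4_weight l j \<noteq> [2, -1, 0, 0] ! l" "\<exists>l<4. F4_weight l j \<noteq> [0, -1, 2, 0] ! l"
    and "\<exists>l<4. F4_weight l j \<noteq> [0, -1, 1, -1] ! l"
proof -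
  have "list_all (\<lambda>w. list_all (\<lambda>j. list_ex (\<lambda>l. F4_weight l j \<noteq> w ! l) [0..<4]) [0..<26])
    [[0, 0, 0, 2], [0, 0, 1, 0], [2, -1, 0, 0], [0, -1, 2, 0], [0, -1, 1, -1]]"
    by code_simp
  then have all: "\<forall>w\<in>set [[0, 0, 0, 2], [0, 0, 1, 0], [2, -1, 0, 0], [0, -1, 2, 0], [0, -1, 1, -1]].
      \<forall>j\<in>set [0..<26]. \<exists>l\<in>set [0..<4]. F4_weight l j \<noteq> w ! l"
    by (simp only: list_all_iff list_ex_iff)
  have *: "\<exists>l<4. F4_weight l j \<noteq> w ! l"
    if "w \<in> set [[0, 0, 0, 2], [0, 0, 1, 0], [2, -1, 0, 0], [0, -1, 2, 0], [0, -1, 1, -1]]" for w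
    using bspec[OF bspec[OF all that], of j] assms by (simp only: set_upt atLeastLessThan_iff bex_simps) auto
  show "\<exists>l<4. F4_weight l j \<noteq> [0, 0, 0, 2] ! l" "\<exists>l<4. F4_weight l j \<noteq> [0, 0, 1, 0] ! l"
    "\<exists>l<4. F4_weight l j \<noteq> [2, -1, 0, 0] ! l" "\<exists>l<4. F4_weight l j \<noteq> [0, -1, 2, 0] ! l"
    "\<exists>l<4. F4_weight l j \<noteq> [0, -1, 1, -1] ! l"
    by (rule *; simp)+
qed

context F4_module
begin

lemma not_a_weight_list:
  assumes "\<And>l. l < 4 \<Longrightarrow> V (k l) *v x = of_int (w ! l) *s x"
    and "\<And>j. j < 26 \<Longrightarrow> \<exists>l<4. F4_weight l j \<noteq> w ! l"
  shows "x = 0"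
proof (rule not_a_weight)
  show "\<And>l. l < 4 \<Longrightarrow> V (k l) *v x = of_int (w ! l) *s x" by (rule assms(1))
  show "\<exists>l<4. of_int (w ! l) \<noteq> (of_int (F4_weight l j) :: complex)" if "j < 26" for j
    using assms(2)[OF that] by (metis of_int_eq_iff)
qed

lemma V_faithful:
  assumes "V m = 0"
  shows "m = 0"
proof -
  let ?J = "{x. V x = 0}"
  have "?J = {0} \<or> ?J = UNIV"
  proof (rule ideal_trivial)
    show "vec.subspace ?J"
      by (rule vec.subspaceI)
        (auto simp: rep_zero[OF V_rep] rep_add[OF V_rep] rep_smult[OF V_rep] vec_eq_iff)
    show "br x y \<in> ?J" if "y \<in> ?J" for x y
      using that by (simp add: rep_bracket[OF V_rep])
  qed
  moreover have "V (k 3) *v B 0 = B 0" by (simp add: weight_B F4_weight_def)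
  then have "V (k 3) \<noteq> 0" using B_nonzero[of 0] by auto
  ultimately show ?thesis using assms by auto
qed

lemma e_0_nonzero: "e 0 \<noteq> 0"
proof
  assume "e 0 = 0"
  moreover have "V (e 0) *v B 5 = B 3" by (simp add: raise_B F4_raise_def)
  ultimately show False using B_nonzero[of 3] by (simp add: rep_zero[OF V_rep])
qed

lemma raising_commutant_zero:
  assumes comm: "\<And>i x. i < 4 \<Longrightarrow> V (e i) *v (M *v x) = M *v (V (e i) *v x)" and "M *v B 25 = 0"
  shows "M = 0"
proof -
  have "t < 26 \<longrightarrow> M *v B t = 0" for t
  proof (induction "26 - t" arbitrary: t rule: less_induct)
    case less
    show ?case
    proof
      assume t: "t < 26"
      show "M *v B t = 0"
      proof (cases "t = 25")
        case False
        then obtain i j where ij: "i < 4" "j < 26" "t < j" "F4_raise i j = (1, t)"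
          using F4_table_raise_from_below[of t] t by auto
        then have "M *v B j = 0" using less[of j] t by simp
        then show ?thesis using comm[OF ij(1), of "B j"] ij by (simp add: raise_B)
      qed (simp add: assms(2))
    qed
  qed
  then have "vec.span (B ` {..<26}) \<subseteq> {x. M *v x = 0}"
    by (intro vec.span_minimal)
      (auto intro!: vec.subspaceI simp: matrix_vector_right_distrib matrix_vector_mult_smult)
  then have "M *v x = 0" for x
    by (auto simp: span_B)
  then have "(M *v axis j 1) $ i = 0" for i j
    by simp
  then show ?thesis by (simp add: matrix_vector_mult_axis vec_eq_iff)
qed

lemma V_weight_shift:
  assumes "br (k l) m = of_int c *s m" "V (k l) *v x = of_int d *s x" "c + d = r"
  shows "V (k l) *v (V m *v x) = of_int r *s (V m *v x)"
  using rep_bracket_vec[OF V_rep, of "k l" m x] assms(3)[symmetric]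
  by (simp add: assms(1,2) rep_smult[OF V_rep] smul_matrix_vector matrix_vector_mult_smult vec.scale_left_distrib
      algebra_simps)

end

locale F4_product = F4_pairing br e f k V p b
  for br :: "complex^'l \<Rightarrow> complex^'l \<Rightarrow> complex^'l" and e f k and V :: "complex^'l \<Rightarrow> complex^'v^'v" and p b +
  fixes \<pi>V :: "complex^('v \<times> 'v)^('v \<times> 'v)" and embed :: "complex^'v^('v \<times> 'v)"
    and product :: "complex^('v \<times> 'v) \<Rightarrow> complex^'v"
  assumes proj_V: "summand_projection V VV \<pi>V"
    and product: "intertwiner V VV embed" "inj ((*v) embed)" "\<And>u. \<pi>V *v u = embed *v product u"
      "\<And>g u. product (VV g *v u) = V g *v product u" "\<And>u v. product (u + v) = product u + product v"
      "\<And>c u. product (c *s u) = c *s product u" "\<And>y. \<pi>V *v (embed *v y) = embed *v y"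
begin

lemma product_zero: "product 0 = 0"
  using product(6)[of 0 0] by simp

lemma pi_V_intertwiner: "intertwiner VV VV \<pi>V"
  using proj_V by (simp add: summand_projection_def)

lemma embed_eq_0: "embed *v y = 0 \<Longrightarrow> y = 0"
  using injD[OF product(2), of y 0] by simp

lemma pi_V_nonzero: "\<pi>V \<noteq> 0"
proof
  assume "\<pi>V = 0"
  then have "embed *v B 0 = 0" using product(7)[of "B 0"] by simp
  from embed_eq_0[OF this] show False using B_nonzero[of 0] by simp
qed

lemma product_s_vec: "\<exists>a. a \<noteq> 0 \<and> product s_vec = a *s z0"
proof -
  have "\<exists>a. product s_vec = a *s z0"
    by (rule z0_multiple) (simp_all add: product(4)[symmetric] s_vec_invariant product_zero)
  moreover have "product s_vec \<noteq> 0"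
  proof
    assume "product s_vec = 0"
    then have "\<pi>V *v s_vec = 0" by (simp add: product(3))
    from intertwiner_determined[OF pi_V_intertwiner this] pi_V_nonzero show False by simp
  qed
  ultimately show ?thesis by auto
qed

lemma product_flipped_s_vec: "\<exists>a. a \<noteq> 0 \<and> product (tens (B 0) (B 25)) = a *s z0"
proof -
  have fl: "flip *v s_vec = tens (B 0) (B 25)" by (simp add: s_vec_def flip_tens)
  have inv: "VV g *v (flip *v s_vec) = flip *v (VV g *v s_vec)" for g
    by (rule intertwiner_vec[OF intertwiner_flip, symmetric])
  have "\<exists>a. product (flip *v s_vec) = a *s z0"
    by (rule z0_multiple) (simp_all add: product(4)[symmetric] inv s_vec_invariant product_zero)
  moreover have "product (flip *v s_vec) \<noteq> 0"
  proof
    assume "product (flip *v s_vec) = 0"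
    then have "(\<pi>V ** flip) *v s_vec = 0" by (simp add: product(3) matrix_vector_mul_assoc[symmetric])
    then have 0: "\<pi>V ** flip = 0"
      by (rule intertwiner_determined[OF intertwiner_comp[OF intertwiner_flip pi_V_intertwiner]])
    have "flip ** flip = (mat 1 :: complex^('v \<times> 'v)^('v \<times> 'v))"
      by (simp add: flip_def reindex_comp reindex_id[symmetric] o_def)
    then have "\<pi>V = (\<pi>V ** flip) ** flip" by (simp add: matrix_mul_assoc[symmetric])
    with 0 pi_V_nonzero show False by simp
  qed
  ultimately show ?thesis unfolding fl by auto
qed

lemma product_B_1_B_23: "product (tens (B 1) (B 23)) \<noteq> 0"
proof -
  note [simp del] = One_nat_def
  obtain a where a: "a \<noteq> 0" "product (tens (B 0) (B 25)) = a *s z0"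
    using product_flipped_s_vec by blast
  have "VV (f 3) *v tens (B 0) (B 25) = tens (B 1) (B 25)"
    by (simp add: tensor_rep_tens top_bottom lower_B F4_lower_def)
  then have 1: "product (tens (B 1) (B 25)) = (-3 * a) *s B 15"
    using product(4)[of "f 3" "tens (B 0) (B 25)"] by (simp add: a(2) matrix_vector_mult_smult matrix_vector_mult_minus z0 mult.commute)
  have "VV (e 3) *v tens (B 1) (B 25) = tens (B 0) (B 25) + tens (B 1) (B 24)"
    by (simp add: tensor_rep_tens raise_B F4_raise_def)
  then have "a *s z0 + product (tens (B 1) (B 24)) = (-3 * a) *s B 13"
    using product(4)[of "e 3" "tens (B 1) (B 25)"]
    by (simp add: 1 a(2) product(5) matrix_vector_mult_smult matrix_vector_mult_minus raise_B F4_raise_def)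
  then have 2: "product (tens (B 1) (B 24)) = (-3 * a) *s B 13 - a *s z0"
    by (simp add: eq_diff_eq add.commute)
  have "VV (e 2) *v tens (B 1) (B 24) = tens (B 1) (B 23)"
    by (simp add: tensor_rep_tens raise_B F4_raise_def)
  then have "product (tens (B 1) (B 23)) = (-3 * a) *s B 11"
    using product(4)[of "e 2" "tens (B 1) (B 24)"]
    by (simp add: 2 matrix_vector_mult_diff_distrib matrix_vector_mult_smult matrix_vector_mult_minus raise_B F4_raise_def z0)
  then show ?thesis using a(1) B_nonzero[of 11] by (simp add: vec.scale_eq_0_iff)
qed

text \<open>
  A highest weight vector \<open>m\<close> of the adjoint representation of weight \<open>2 \<omega>\<^sub>4\<close> would map the lowest weight
  vector to a multiple of the highest one, which contradicts the skewness of \<open>V m\<close>.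
\<close>

lemma no_highest_weight_U:
  assumes e: "\<And>i. i < 4 \<Longrightarrow> br (e i) m = 0" and k: "\<And>l. l < 4 \<Longrightarrow> br (k l) m = of_int ([0, 0, 0, 2] ! l) *s m"
  shows "m = 0"
proof -
  have comm: "V (e i) *v (V m *v x) = V m *v (V (e i) *v x)" if "i < 4" for i x
    using rep_bracket_vec[OF V_rep, of "e i" m x] e[OF that] by (simp add: rep_zero[OF V_rep])
  have "\<exists>a. V m *v B 25 = a *s B 0"
  proof (rule simple_weight)
    show "V (k l) *v (V m *v B 25) = of_int (F4_weight l 0) *s (V m *v B 25)" if l: "l < 4" for l
      by (rule V_weight_shift[OF k[OF l] weight_B[OF _ l]], simp)
        (rule less_4_cases[OF l]; simp add: F4_weight_def)
  qed simp_all
  then obtain a where a: "V m *v B 25 = a *s B 0" by blast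
  have "bil P (V m *v B 25) (B 25) = - bil P (V m *v B 25) (B 25)"
    using form_invariant[of m "B 25" "B 25"] bil_swap[OF P_symmetric] by metis
  then have "a * bil P (B 0) (B 25) = 0" by (simp add: a bil_smult)
  then have "a = 0" using form_opposite_pairs(1) by simp
  then have "V m = 0" by (intro raising_commutant_zero comm) (simp_all add: a)
  then show ?thesis by (rule V_faithful)
qed

text \<open>
  One of weight \<open>\<omega>\<^sub>3\<close> would act by \<open>B 25 \<mapsto> a B 1\<close> and \<open>B 23 \<mapsto> 0\<close>, which is not a derivation of the product.
\<close>

lemma no_highest_weight_W:
  assumes e: "\<And>i. i < 4 \<Longrightarrow> br (e i) m = 0" and k: "\<And>l. l < 4 \<Longrightarrow> br (k l) m = of_int ([0, 0, 1, 0] ! l) *s m"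
  shows "m = 0"
proof -
  have comm: "V (e i) *v (V m *v x) = V m *v (V (e i) *v x)" if "i < 4" for i x
    using rep_bracket_vec[OF V_rep, of "e i" m x] e[OF that] by (simp add: rep_zero[OF V_rep])
  have "\<exists>a. V m *v B 25 = a *s B 1"
  proof (rule simple_weight)
    show "V (k l) *v (V m *v B 25) = of_int (F4_weight l 1) *s (V m *v B 25)" if l: "l < 4" for l
      by (rule V_weight_shift[OF k[OF l] weight_B[OF _ l]], simp)
        (rule less_4_cases[OF l]; simp add: F4_weight_def)
  qed simp_all
  then obtain a where a: "V m *v B 25 = a *s B 1" by blast
  have 23: "V m *v B 23 = 0"
  proof (rule not_a_weight_list)
    show "V (k l) *v (V m *v B 23) = of_int ([0, -1, 2, 0] ! l) *s (V m *v B 23)" if l: "l < 4" for l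
      by (rule V_weight_shift[OF k[OF l] weight_B[OF _ l]], simp)
        (rule less_4_cases[OF l]; simp add: F4_weight_def)
  qed (rule F4_not_weights(4))
  have "product (tens (B 25) (B 23)) = 0"
  proof (rule not_a_weight_list)
    show "V (k l) *v product (tens (B 25) (B 23)) = of_int ([0, -1, 1, -1] ! l) *s product (tens (B 25) (B 23))"
      if l: "l < 4" for l
    proof -
      have "VV (k l) *v tens (B 25) (B 23) = of_int ([0, -1, 1, -1] ! l) *s tens (B 25) (B 23)"
        by (rule less_4_cases[OF l]; simp add: tensor_rep_tens weight_B F4_weight_def
            tens_smult_left tens_smult_right tens_minus)
      then show ?thesis by (simp add: product(4)[symmetric] product(6))
    qed
  qed (rule F4_not_weights(5))
  then have "product (VV m *v tens (B 25) (B 23)) = 0" by (simp add: product(4))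
  then have "a *s product (tens (B 1) (B 23)) = 0"
    by (simp add: tensor_rep_tens a 23 tens_smult_left product(6))
  then have "a = 0" using product_B_1_B_23 by (simp add: vec.scale_eq_0_iff)
  then have "V m = 0" by (intro raising_commutant_zero comm) (simp_all add: a)
  then show ?thesis by (rule V_faithful)
qed

end

context F4_product
begin

abbreviation t :: "complex^('v \<times> 'v)^('v \<times> 'v)" where "t \<equiv> rotation p b \<pi>V"
abbreviation form2 where "form2 \<equiv> bil (P \<otimes> P)"

lemma crossing: "form2 (t *v tens x y) (tens x' y') = form2 (\<pi>V *v tens x' x) (tens y' y)"
  by (rule rotation_crossing[OF refl P_inverse P_symmetric])

lemma pi_V_swap: "\<pi>V *v (VV g *v u) = VV g *v (\<pi>V *v u)"
  by (rule intertwiner_vec[OF pi_V_intertwiner])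

lemma embed_swap: "embed *v (V g *v x) = VV g *v (embed *v x)"
  by (rule intertwiner_vec[OF product(1)])

lemma form2_embed_B_13: "form2 (embed *v B 13) s_vec \<noteq> 0"
proof
  assume 13: "form2 (embed *v B 13) s_vec = 0"
  have 12: "form2 (embed *v B 12) s_vec = 0"
  proof -
    have "B 12 = V (f 2) *v B 11" by (simp add: lower_B F4_lower_def)
    then show ?thesis by (simp add: embed_swap form2_invariant s_vec_invariant)
  qed
  have B: "form2 (embed *v B j) s_vec = 0" if j: "j < 26" for j
  proof (cases "j = 12 \<or> j = 13")
    case False
    have "\<exists>l<4. F4_weight l j \<noteq> 0"
    proof (rule ccontr)
      assume *: "\<not> ?thesis"
      have "F4_weight l j = F4_weight l 12" if "l < 4" for l
        using * that by (auto elim!: less_4_cases simp: F4_weight_def)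
      then have "j = 12 \<or> {j, 12} = {12, 13}" by (intro F4_weight_injective[OF j]) auto
      with False show False by (auto simp: doubleton_eq_iff)
    qed
    then obtain l where l: "l < 4" "F4_weight l j \<noteq> 0" by blast
    have "form2 (VV (k l) *v (embed *v B j)) s_vec = 0"
      by (simp add: form2_invariant s_vec_invariant l)
    then have "of_int (F4_weight l j) * form2 (embed *v B j) s_vec = 0"
      by (simp add: embed_swap[symmetric] weight_B[OF j l(1)] matrix_vector_mult_smult bil_smult)
    with l(2) show ?thesis by simp
  qed (use 12 13 in auto)
  let ?S = "{u. \<forall>y. form2 (embed *v y) u = 0}"
  have "s_vec \<in> ?S"
  proof -
    have "form2 (embed *v y) s_vec = 0" for y
    proof -
      obtain a where y: "y = (\<Sum>i<26. a i *s B i)" using B_expansion by blast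
      have "form2 (embed *v (\<Sum>i\<in>I. a i *s B i)) s_vec = (\<Sum>i\<in>I. a i * form2 (embed *v B i) s_vec)" for I
        by (induction I rule: infinite_finite_induct)
          (simp_all add: matrix_vector_right_distrib matrix_vector_mult_smult bil_add bil_smult)
      then show ?thesis by (simp add: y B)
    qed
    then show ?thesis by simp
  qed
  then have "u \<in> ?S" for u
  proof (rule s_vec_generates[rotated 2])
    show "vec.subspace ?S"
      by (auto intro!: vec.subspaceI simp: bil_add bil_smult)
    show "VV g *v u \<in> ?S" if "u \<in> ?S" for g u
    proof -
      have "form2 (embed *v y) (VV g *v u) = - form2 (embed *v (V g *v y)) u" for y
        by (simp add: embed_swap form2_invariant)
      with that show ?thesis by simp
    qed
  qed
  then have "form2 (embed *v B 0) u = 0" for u by simp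
  then have "embed *v B 0 = 0" by (rule form2_nondegenerate)
  from embed_eq_0[OF this] show False using B_nonzero[of 0] by simp
qed

lemma lower_raise_form_nonzero: "form2 (VV (f 3) *v (VV (e 3) *v (\<pi>V *v s_vec))) s_vec \<noteq> 0"
proof -
  obtain a where a: "a \<noteq> 0" "product s_vec = a *s z0" using product_s_vec by blast
  have "V (f 3) *v (V (e 3) *v product s_vec) = (-3 * a) *s B 13"
    by (simp add: a(2) matrix_vector_mult_smult z0 lower_B F4_lower_def matrix_vector_mult_minus mult.commute)
  then have "VV (f 3) *v (VV (e 3) *v (\<pi>V *v s_vec)) = (-3 * a) *s (embed *v B 13)"
    by (simp add: product(3) embed_swap[symmetric] matrix_vector_mult_smult matrix_vector_mult_minus)
  then show ?thesis
    using a(1) form2_embed_B_13 by (simp add: bil_smult bil_minus)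
qed

definition u_vec :: "complex^('v \<times> 'v)" where "u_vec = tens (B 0) (B 0)"
definition w_vec :: "complex^('v \<times> 'v)" where "w_vec = tens (B 0) (B 1) - tens (B 1) (B 0)"

lemma rotation_u_vec: "form2 (t *v u_vec) (tens (B 25) (B 25)) = form2 (\<pi>V *v s_vec) s_vec"
  by (simp add: u_vec_def crossing s_vec_def)

lemma rotation_w_vec: "form2 (t *v w_vec) (tens (B 25) (B 24)) =
  2 * form2 (VV (f 3) *v (VV (e 3) *v (\<pi>V *v s_vec))) s_vec - form2 (\<pi>V *v s_vec) s_vec"
proof -
  note [simp del] = One_nat_def
  let ?n = "form2 (VV (f 3) *v (VV (e 3) *v (\<pi>V *v s_vec))) s_vec"
  have f: "tens (B 25) (B 1) = VV (f 3) *v s_vec"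
    by (simp add: s_vec_def tensor_rep_tens lower_B F4_lower_def)
  have e: "tens (B 24) (B 0) = VV (e 3) *v s_vec"
    by (simp add: s_vec_def tensor_rep_tens raise_B F4_raise_def)
  have ef: "tens (B 24) (B 1) = VV (e 3) *v (VV (f 3) *v s_vec) - s_vec"
    by (simp add: f[symmetric], simp add: s_vec_def tensor_rep_tens raise_B F4_raise_def)
  have swap: "VV (e 3) *v (VV (f 3) *v (\<pi>V *v s_vec)) = VV (f 3) *v (VV (e 3) *v (\<pi>V *v s_vec))"
    by (simp add: e_f[OF VV_rep] pi_V_swap[symmetric] s_vec_invariant)
  have "form2 (t *v tens (B 0) (B 1)) (tens (B 25) (B 24)) = form2 (\<pi>V *v s_vec) (tens (B 24) (B 1))"
    by (simp add: crossing s_vec_def)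
  also have "\<dots> = ?n - form2 (\<pi>V *v s_vec) s_vec"
    using form2_invariant[of "e 3" "\<pi>V *v s_vec" "VV (f 3) *v s_vec"]
      form2_invariant[of "f 3" "VV (e 3) *v (\<pi>V *v s_vec)" s_vec]
    by (simp add: ef bil_diff)
  finally have 1: "form2 (t *v tens (B 0) (B 1)) (tens (B 25) (B 24)) = ?n - form2 (\<pi>V *v s_vec) s_vec" .
  have "form2 (t *v tens (B 1) (B 0)) (tens (B 25) (B 24)) = form2 (\<pi>V *v tens (B 25) (B 1)) (tens (B 24) (B 0))"
    by (rule crossing)
  also have "\<dots> = - ?n"
    using form2_invariant[of "e 3" "VV (f 3) *v (\<pi>V *v s_vec)" s_vec]
    by (simp add: f e pi_V_swap swap)
  finally show ?thesis
    by (simp add: w_vec_def matrix_vector_mult_diff_distrib bil_diff 1)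
qed

lemma form2_u_w:
  "form2 u_vec (tens (B 25) (B 25)) = (bil P (B 0) (B 25))\<^sup>2"
  "form2 w_vec (tens (B 25) (B 24)) = - (bil P (B 0) (B 25))\<^sup>2"
proof -
  note [simp del] = One_nat_def
  show "form2 u_vec (tens (B 25) (B 25)) = (bil P (B 0) (B 25))\<^sup>2"
    by (simp add: u_vec_def bil_tens power2_eq_square)
  have "B 1 = V (f 3) *v B 0" by (simp add: lower_B F4_lower_def)
  then have "bil P (B 1) (B 24) = - bil P (B 0) (V (f 3) *v B 24)"
    by (simp add: form_invariant)
  also have "V (f 3) *v B 24 = B 25" by (simp add: lower_B F4_lower_def)
  finally have "bil P (B 1) (B 24) = - bil P (B 0) (B 25)" .
  moreover have "bil P (B 1) (B 25) = 0"
    by (rule form_B_zero[of _ _ 2]) (simp_all add: F4_weight_def)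
  ultimately show "form2 w_vec (tens (B 25) (B 24)) = - (bil P (B 0) (B 25))\<^sup>2"
    by (simp add: w_vec_def bil_diff bil_tens power2_eq_square)
qed

lemma u_vec_highest:
  "i < 4 \<Longrightarrow> VV (e i) *v u_vec = 0" "l < 4 \<Longrightarrow> VV (k l) *v u_vec = of_int ([0, 0, 0, 2] ! l) *s u_vec"
proof -
  show "i < 4 \<Longrightarrow> VV (e i) *v u_vec = 0" by (simp add: u_vec_def tensor_rep_tens top_bottom)
  show "VV (k l) *v u_vec = of_int ([0, 0, 0, 2] ! l) *s u_vec" if "l < 4"
    by (rule less_4_cases[OF that]; simp add: u_vec_def tensor_rep_tens weight_B F4_weight_def
        tens_smult_left tens_smult_right) (simp add: vec_eq_iff)
qed

lemma w_vec_highest: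
  "i < 4 \<Longrightarrow> VV (e i) *v w_vec = 0" "l < 4 \<Longrightarrow> VV (k l) *v w_vec = of_int ([0, 0, 1, 0] ! l) *s w_vec"
proof -
  note [simp del] = One_nat_def
  show "VV (e i) *v w_vec = 0" if "i < 4"
    by (rule less_4_cases[OF that]; simp add: w_vec_def tensor_rep_tens top_bottom raise_B F4_raise_def
        matrix_vector_mult_diff_distrib)
  show "VV (k l) *v w_vec = of_int ([0, 0, 1, 0] ! l) *s w_vec" if "l < 4"
    by (rule less_4_cases[OF that]; simp add: w_vec_def tensor_rep_tens weight_B F4_weight_def
        matrix_vector_mult_diff_distrib tens_smult_left tens_smult_right tens_minus)
qed

lemma trivial_projection_kills:
  assumes C: "summand_projection trivial_rep VV \<pi>C" and u: "VV g *v u = c *s u" "c \<noteq> 0"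
  shows "\<pi>C *v u = 0"
proof -
  obtain \<iota> \<psi> where \<psi>: "\<And>u. \<pi>C *v u = \<iota> *v \<psi> u" "\<And>g u. \<psi> (VV g *v u) = trivial_rep g *v \<psi> u"
    "\<And>c u. \<psi> (c *s u) = c *s \<psi> u"
    using summand_projection_factor[OF C] by metis
  have "c *s \<psi> u = 0" using \<psi>(2)[of g u] by (simp add: u(1) \<psi>(3) trivial_rep_def)
  then have "\<psi> u = 0" using u(2) by (simp add: vec.scale_eq_0_iff)
  then show ?thesis by (simp add: \<psi>(1))
qed

lemma adjoint_projection_kills:
  assumes L: "summand_projection (adjoint_rep br) VV \<pi>L"
    and e: "\<And>i. i < 4 \<Longrightarrow> VV (e i) *v u = 0" and k: "\<And>l. l < 4 \<Longrightarrow> VV (k l) *v u = of_int (w ! l) *s u"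
    and w: "w = [0, 0, 0, 2] \<or> w = [0, 0, 1, 0]"
  shows "\<pi>L *v u = 0"
proof -
  obtain \<iota> \<psi> where \<psi>: "\<And>u. \<pi>L *v u = \<iota> *v \<psi> u" "\<And>g u. \<psi> (VV g *v u) = adjoint_rep br g *v \<psi> u"
    "\<And>c u. \<psi> (c *s u) = c *s \<psi> u"
    using summand_projection_factor[OF L] by metis
  have "\<psi> 0 = 0" using \<psi>(3)[of 0 0] by simp
  then have e': "br (e i) (\<psi> u) = 0" if "i < 4" for i
    using \<psi>(2)[of "e i" u] e[OF that] by (simp add: adjoint_rep_apply[OF lie])
  have k': "br (k l) (\<psi> u) = of_int (w ! l) *s \<psi> u" if "l < 4" for l
    using \<psi>(2)[of "k l" u] k[OF that] by (simp add: adjoint_rep_apply[OF lie] \<psi>(3))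
  from w have "\<psi> u = 0"
  proof
    assume "w = [0, 0, 0, 2]"
    from no_highest_weight_U[OF e' k'[unfolded this]] show ?thesis by simp
  next
    assume "w = [0, 0, 1, 0]"
    from no_highest_weight_W[OF e' k'[unfolded this]] show ?thesis by simp
  qed
  then show ?thesis by (simp add: \<psi>(1))
qed

lemma V_projection_kills:
  assumes "\<And>l. l < 4 \<Longrightarrow> VV (k l) *v u = of_int (w ! l) *s u"
    and "\<And>j. j < 26 \<Longrightarrow> \<exists>l<4. F4_weight l j \<noteq> w ! l"
  shows "\<pi>V *v u = 0"
proof -
  have "product u = 0"
    using assms(2) by (rule not_a_weight_list[rotated]) (simp_all add: product(4)[symmetric] assms(1) product(6))
  then show ?thesis by (simp add: product(3))
qed

lemma commutant_basis_independent:
  assumes C: "summand_projection trivial_rep VV \<pi>C" and L: "summand_projection (adjoint_rep br) VV \<pi>L"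
    and sum: "c0 \<odot> mat 1 + c1 \<odot> \<pi>C + c2 \<odot> \<pi>V + c3 \<odot> \<pi>L + c4 \<odot> t = 0"
  shows "c0 = 0" "c1 = 0" "c2 = 0" "c3 = 0" "c4 = 0"
proof -
  have sum': "c0 *s u + c1 *s (\<pi>C *v u) + c2 *s (\<pi>V *v u) + c3 *s (\<pi>L *v u) + c4 *s (t *v u) = 0" for u
    using arg_cong[OF sum, of "\<lambda>A. A *v u"] by (simp add: matrix_vector_mult_add_rdistrib smul_matrix_vector)
  have "\<pi>C *v u_vec = 0"
    by (rule trivial_projection_kills[OF C u_vec_highest(2)[of 3]]) simp_all
  moreover have "\<pi>V *v u_vec = 0"
    by (rule V_projection_kills[OF u_vec_highest(2)]) (simp_all add: F4_not_weights)
  moreover have "\<pi>L *v u_vec = 0"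
    by (rule adjoint_projection_kills[OF L u_vec_highest]) simp_all
  ultimately have u: "c0 *s u_vec + c4 *s (t *v u_vec) = 0" using sum'[of u_vec] by simp
  have "\<pi>C *v w_vec = 0"
    by (rule trivial_projection_kills[OF C w_vec_highest(2)[of 2]]) simp_all
  moreover have "\<pi>V *v w_vec = 0"
    by (rule V_projection_kills[OF w_vec_highest(2)]) (simp_all add: F4_not_weights)
  moreover have "\<pi>L *v w_vec = 0"
    by (rule adjoint_projection_kills[OF L w_vec_highest]) simp_all
  ultimately have w: "c0 *s w_vec + c4 *s (t *v w_vec) = 0" using sum'[of w_vec] by simp
  let ?a = "(bil P (B 0) (B 25))\<^sup>2" and ?n = "form2 (\<pi>V *v s_vec) s_vec"
    and ?n' = "form2 (VV (f 3) *v (VV (e 3) *v (\<pi>V *v s_vec))) s_vec"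
  have 1: "c0 * ?a + c4 * ?n = 0"
    using arg_cong[OF u, of "\<lambda>x. form2 x (tens (B 25) (B 25))"]
    by (simp add: bil_add bil_smult form2_u_w rotation_u_vec)
  have 2: "c0 * (- ?a) + c4 * (2 * ?n' - ?n) = 0"
    using arg_cong[OF w, of "\<lambda>x. form2 x (tens (B 25) (B 24))"]
    by (simp only: bil_add bil_smult form2_u_w rotation_w_vec bil_zero)
  have "2 * (c4 * ?n') = (c0 * ?a + c4 * ?n) + (c0 * (- ?a) + c4 * (2 * ?n' - ?n))"
    by (simp add: algebra_simps)
  then have "c4 * ?n' = 0" by (simp only: 1 2) simp
  with lower_raise_form_nonzero show c4: "c4 = 0" by simp
  then show c0: "c0 = 0" using 1 form_opposite_pairs(1) by simp
  have sum'': "c1 *s (\<pi>C *v u) + c2 *s (\<pi>V *v u) + c3 *s (\<pi>L *v u) = 0" for u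
    using sum'[of u] by (simp add: c0 c4)
  show c3: "c3 = 0"
  proof -
    obtain \<iota> where \<iota>: "intertwiner (adjoint_rep br) VV \<iota>" "inj ((*v) \<iota>)" "\<And>y. \<pi>L *v (\<iota> *v y) = \<iota> *v y"
      using summand_projection_factor[OF L] by metis
    define u where "u = \<iota> *v e 0"
    have k: "VV (k l) *v u = of_int ([2, -1, 0, 0] ! l) *s u" if l: "l < 4" for l
    proof -
      have "cartan_F4 0 l = [2, -1, 0, 0] ! l" by (simp add: cartan_F4_def)
      then show ?thesis
        using brackets(2)[OF l, of 0]
        by (simp add: u_def intertwiner_vec[OF \<iota>(1), symmetric] adjoint_rep_apply[OF lie] matrix_vector_mult_smult)
    qed
    have "\<pi>C *v u = 0"
      by (rule trivial_projection_kills[OF C k[of 0]]) simp_all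
    moreover have "\<pi>V *v u = 0"
      by (rule V_projection_kills[OF k]) (simp_all add: F4_not_weights)
    moreover have "u \<noteq> 0"
      using injD[OF \<iota>(2), of "e 0" 0] e_0_nonzero by (auto simp: u_def)
    ultimately show ?thesis
      using sum''[of u] \<iota>(3)[of "e 0"] by (simp add: u_def[symmetric] vec.scale_eq_0_iff)
  qed
  show c2: "c2 = 0"
  proof -
    define u where "u = embed *v B 0"
    have "VV (k 3) *v u = 1 *s u"
      by (simp add: u_def embed_swap[symmetric] weight_B F4_weight_def)
    then have "\<pi>C *v u = 0" by (rule trivial_projection_kills[OF C]) simp
    moreover have "u \<noteq> 0" using embed_eq_0 B_nonzero[of 0] by (auto simp: u_def)
    ultimately show ?thesis
      using sum''[of u] product(7)[of "B 0"] c3 by (simp add: u_def[symmetric] vec.scale_eq_0_iff)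
  qed
  show "c1 = 0"
  proof -
    obtain \<iota> where \<iota>: "inj ((*v) \<iota>)" "\<And>y :: complex^unit. \<pi>C *v (\<iota> *v y) = \<iota> *v y"
      using summand_projection_factor[OF C] by metis
    have "\<iota> *v (axis () 1) \<noteq> 0"
      using injD[OF \<iota>(1), of "axis () 1" 0] by (auto simp: axis_eq_0_iff)
    then show ?thesis
      using sum''[of "\<iota> *v axis () 1"] \<iota>(2) c2 c3 by (simp add: vec.scale_eq_0_iff)
  qed
qed

lemma rotation_intertwiner: "intertwiner VV VV t"
proof -
  note id = intertwiner_id[of V]
  note c = intertwiner_comp[rotated]
  show ?thesis
    unfolding rotation_def
    by (rule c[OF c[OF c[OF c[OF c[OF c[OF c[OF c[OF intertwiner_runit
      intertwiner_kron[OF intertwiner_id[of VV] p_intertwiner]] intertwiner_reassoc_inv]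
      intertwiner_kron[OF id intertwiner_reassoc]] intertwiner_kron[OF id intertwiner_kron[OF pi_V_intertwiner id]]]
      intertwiner_kron[OF id intertwiner_reassoc_inv]] intertwiner_reassoc]
      intertwiner_kron[OF b_intertwiner intertwiner_id[of VV]]] intertwiner_lunit_inv])
qed

definition commutant_basis ::
  "complex^('v \<times> 'v)^('v \<times> 'v) \<Rightarrow> complex^('v \<times> 'v)^('v \<times> 'v) \<Rightarrow> nat \<Rightarrow> complex^('v \<times> 'v)^('v \<times> 'v)" where
  "commutant_basis \<pi>C \<pi>L m = [mat 1, \<pi>C, \<pi>V, \<pi>L, t] ! m"

lemma sum_lessThan_5: "(\<Sum>m<5. g m) = g 0 + g 1 + g 2 + g 3 + g 4" for g :: "nat \<Rightarrow> 'b::comm_monoid_add"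
  by (simp add: eval_nat_numeral ac_simps)

lemma commutant_basis_sum:
  "(\<Sum>m<5. c m \<odot> commutant_basis \<pi>C \<pi>L m) =
    c 0 \<odot> mat 1 + c 1 \<odot> \<pi>C + c 2 \<odot> \<pi>V + c 3 \<odot> \<pi>L + c 4 \<odot> t"
  by (simp add: sum_lessThan_5 commutant_basis_def)

context
  fixes \<pi>C \<pi>L
  assumes C: "summand_projection trivial_rep VV \<pi>C" and L: "summand_projection (adjoint_rep br) VV \<pi>L"
begin

abbreviation A where "A \<equiv> commutant_basis \<pi>C \<pi>L"

lemma commutant_expansion:
  assumes "intertwiner VV VV X"
  shows "\<exists>c. X = (\<Sum>m<5. c m \<odot> A m)"
proof (rule commutant_spanned[OF _ assms])
  show "intertwiner VV VV (A m)" if "m < 5" for m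
  proof -
    have "m = 0 \<or> m = 1 \<or> m = 2 \<or> m = 3 \<or> m = 4" using that by linarith
    then show ?thesis
      using C L by (auto simp: commutant_basis_def intertwiner_id pi_V_intertwiner rotation_intertwiner
          summand_projection_def)
  qed
  show "c m = 0" if "(\<Sum>m<5. c m \<odot> A m) = 0" "m < 5" for c m
  proof -
    have "m = 0 \<or> m = 1 \<or> m = 2 \<or> m = 3 \<or> m = 4" using that(2) by linarith
    then show ?thesis
      using commutant_basis_independent[OF C L that(1)[unfolded commutant_basis_sum]] by auto
  qed
qed

lemma equivariant_expansion:
  assumes N: "equivariant VV VV N"
  shows "\<exists>\<alpha>. N = (\<Sum>m<5. \<alpha> m \<odot> fps_mat (A m)) \<and> coefm 0 N = (\<Sum>m<5. fps_nth (\<alpha> m) 0 \<odot> A m)"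
proof -
  have "\<exists>c. coefm n N = (\<Sum>m<5. c m \<odot> A m)" for n
    using N by (intro commutant_expansion) (simp add: equivariant_def)
  then obtain c where c: "\<And>n. coefm n N = (\<Sum>m<5. c n m \<odot> A m)" by metis
  define \<alpha> where "\<alpha> m = Abs_fps (\<lambda>n. c n m)" for m
  have "N = (\<Sum>m<5. \<alpha> m \<odot> fps_mat (A m))"
  proof (rule coefm_eqI)
    fix n
    have "coefm n (\<alpha> m \<odot> fps_mat (A m)) = c n m \<odot> A m" for m
      by (simp add: vec_eq_iff \<alpha>_def fps_mat_def)
    then show "coefm n N = coefm n (\<Sum>m<5. \<alpha> m \<odot> fps_mat (A m))"
      by (simp add: c coefm_sum)
  qed
  moreover have "coefm 0 N = (\<Sum>m<5. fps_nth (\<alpha> m) 0 \<odot> A m)"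
    by (simp add: c \<alpha>_def)
  ultimately show ?thesis by blast
qed

end

end

lemma fls_mat_add: "fls_mat (M + N) = fls_mat M + fls_mat N"
  by (simp add: vec_eq_iff fls_mat_def)

lemma fls_mat_smul: "fls_mat (c \<odot> M) = fps_to_fls c \<odot> fls_mat M"
  by (simp add: vec_eq_iff fls_mat_def fls_times_fps_to_fls)

theorem mainTheorem2:
  fixes br :: "complex^'l \<Rightarrow> complex^'l \<Rightarrow> complex^'l"
    and e f k :: "nat \<Rightarrow> complex^'l"
    and V :: "complex^'l \<Rightarrow> complex^'v^'v"
    and h :: complex
    and x y :: "'l \<Rightarrow> complex^'l"
    and p :: "complex^('v \<times> 'v)^unit"
    and b :: "complex^unit^('v \<times> 'v)"
    and c q r s :: "complex fps"
    and \<pi>C \<pi>V \<pi>L :: "complex^('v \<times> 'v)^('v \<times> 'v)"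
    and I :: "elementary_tangle \<Rightarrow> complex fps^('v \<times> 'v)^('v \<times> 'v)"
  assumes f4: "lie_algebra_F4 br e f k"
    and V_rep: "representation br V"
    and V_irreducible: "irreducible_rep V"
    and V_dim: "CARD('v) = 26"
    and V_weight: "has_highest_weight e k V [0, 0, 0, 1]"
    and h_nonzero: "h \<noteq> 0"
    and dual: "dual_bases br x y"
    and pairing: "invariant_pairing V p b"
    and c_scalar: "zigzag h x y V p b = inverse c \<odot> mat 1"
    and c_sqrt: "q\<^sup>2 = c"
    and r_nonzero: "r \<noteq> 0"
    and s_nonzero: "s \<noteq> 0"
    and proj_C: "summand_projection trivial_rep (tensor_rep V V) \<pi>C"
    and proj_V: "summand_projection V (tensor_rep V V) \<pi>V"
    and proj_L: "summand_projection (adjoint_rep br) (tensor_rep V V) \<pi>L"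
    and I_eq: "I = tangle_invariant h x y V p b c q r s \<pi>C \<pi>V \<pi>L"
  shows "\<exists>lam \<mu> \<nu> \<rho> \<sigma> :: complex fls.
           fls_mat (I X_plus) =
             lam \<odot> fls_mat (I Id_tangle) + \<mu> \<odot> fls_mat (I S_tangle) + \<nu> \<odot> fls_mat (I H_tangle)
             + \<rho> \<odot> fls_mat (I I_tangle) + \<sigma> \<odot> fls_mat (I H_da)"
proof -
  obtain embed "product" where prod: "intertwiner V (tensor_rep V V) embed" "inj ((*v) embed)"
    "\<And>u. \<pi>V *v u = embed *v product u" "\<And>g u. product (tensor_rep V V g *v u) = V g *v product u"
    "\<And>u v. product (u + v) = product u + product v" "\<And>c u. product (c *s u) = c *s product u"
    "\<And>y. \<pi>V *v (embed *v y) = embed *v y"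
    by (rule summand_projection_factor[OF proj_V], rule that, assumption+)
  interpret F4_product br e f k V p b \<pi>V embed "product"
    by unfold_locales (fact f4 V_rep V_irreducible V_dim V_weight pairing proj_V prod)+
  note expansion = equivariant_expansion[OF proj_C proj_L]
  let ?A = "commutant_basis \<pi>C \<pi>L"
  have c0: "fps_nth c 0 = 1"
  proof -
    have "coefm 0 (zigzag h x y V p b) = lunit ** (p \<otimes> mat 1) ** reassoc_inv ** (mat 1 \<otimes> b) ** runit_inv"
      by (simp add: zigzag_def coefm_0_mult coefm_0_kron associator_inverse coefm_fps_mat coefm_mat
          lunit_def runit_inv_def)
    also have "\<dots> = mat 1" using pairing by (simp add: invariant_pairing_def)
    finally have "fps_nth (inverse c) 0 \<odot> mat 1 = (mat 1 :: complex^'v^'v)"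
      by (simp add: c_scalar coefm_0_smul coefm_mat)
    then have "(fps_nth (inverse c) 0 \<odot> mat 1 :: complex^'v^'v) $ i $ i = mat 1 $ i $ i" for i
      by (simp only:)
    then have "fps_nth (inverse c) 0 = 1" by (simp add: mat_def)
    then show ?thesis by (simp add: inverse_eq_1_iff)
  qed
  have "equivariant VV VV (I X_plus)"
    unfolding I_eq tangle_invariant.simps
    by (intro equivariant_comp[OF equivariant_flip] equivariant_mat_exp equivariant_smul
        equivariant_chord[OF lie dual V_rep V_rep])
  then obtain \<beta> where \<beta>: "I X_plus = (\<Sum>m<5. \<beta> m \<odot> fps_mat (?A m))" using expansion by blast
  let ?R = "rotate_endo h x y V p b q (fps_mat \<pi>V)"
  have "equivariant VV VV ?R"
    by (rule equivariant_rotate_endo[OF lie dual V_rep p_intertwiner b_intertwiner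
        equivariant_fps_mat[OF pi_V_intertwiner]])
  then obtain \<alpha> where \<alpha>: "?R = (\<Sum>m<5. \<alpha> m \<odot> fps_mat (?A m))"
    "coefm 0 ?R = (\<Sum>m<5. fps_nth (\<alpha> m) 0 \<odot> ?A m)" using expansion by blast
  have "fps_nth (\<alpha> 4) 0 = 1"
  proof -
    have "(fps_nth q 0)\<^sup>2 = 1" using c0 by (simp add: c_sqrt[symmetric] power2_eq_square)
    then have "t = (\<Sum>m<5. fps_nth (\<alpha> m) 0 \<odot> ?A m)"
      using \<alpha>(2) by (simp add: coefm_0_rotate_endo)
    then have "fps_nth (\<alpha> 0) 0 \<odot> mat 1 + fps_nth (\<alpha> 1) 0 \<odot> \<pi>C + fps_nth (\<alpha> 2) 0 \<odot> \<pi>V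
        + fps_nth (\<alpha> 3) 0 \<odot> \<pi>L + (fps_nth (\<alpha> 4) 0 - 1) \<odot> t = 0"
      unfolding commutant_basis_sum by (simp add: vec_eq_iff algebra_simps)
    from commutant_basis_independent(5)[OF proj_C proj_L this] show ?thesis by simp
  qed
  then have \<alpha>4: "fps_to_fls (\<alpha> 4) \<noteq> 0" by auto
  have r: "fps_to_fls r \<noteq> 0" and s: "fps_to_fls s \<noteq> 0" using r_nonzero s_nonzero by simp_all
  have c: "fps_to_fls (26 * c) \<noteq> 0"
  proof -
    have "fps_nth (26 * c) 0 = 26" by (simp add: c0)
    then have "26 * c \<noteq> 0" by (metis fps_zero_nth zero_neq_numeral)
    then show ?thesis by simp
  qed
  define a b' where "a m = fps_to_fls (\<alpha> m)" and "b' m = fps_to_fls (\<beta> m)" for m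
  let ?M = "\<lambda>m. fls_mat (fps_mat (?A m))"
  have X: "fls_mat (I X_plus) = b' 0 \<odot> ?M 0 + b' 1 \<odot> ?M 1 + b' 2 \<odot> ?M 2 + b' 3 \<odot> ?M 3 + b' 4 \<odot> ?M 4"
    by (simp add: \<beta> sum_lessThan_5 fls_mat_add fls_mat_smul b'_def)
  have R: "fls_mat (I I_tangle) = fps_to_fls r \<odot>
      (a 0 \<odot> ?M 0 + a 1 \<odot> ?M 1 + a 2 \<odot> ?M 2 + a 3 \<odot> ?M 3 + a 4 \<odot> ?M 4)"
    by (simp add: I_eq rotate_endo_smul \<alpha>(1) sum_lessThan_5 fls_mat_add fls_mat_smul a_def)
  have others: "fls_mat (I Id_tangle) = ?M 0" "fls_mat (I S_tangle) = fps_to_fls (26 * c) \<odot> ?M 1"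
    "fls_mat (I H_tangle) = fps_to_fls r \<odot> ?M 2" "fls_mat (I H_da) = fps_to_fls s \<odot> ?M 3"
  proof -
    have A: "?A 0 = mat 1" "?A 1 = \<pi>C" "?A 2 = \<pi>V" "?A 3 = \<pi>L"
      by (simp_all add: commutant_basis_def)
    show "fls_mat (I Id_tangle) = ?M 0" "fls_mat (I S_tangle) = fps_to_fls (26 * c) \<odot> ?M 1"
      "fls_mat (I H_tangle) = fps_to_fls r \<odot> ?M 2" "fls_mat (I H_da) = fps_to_fls s \<odot> ?M 3"
      by (simp_all only: I_eq tangle_invariant.simps A fps_mat_mat fls_mat_smul)
  qed
  define d where "d m = b' m - b' 4 * a m / a 4" for m
  have "fls_mat (I X_plus) = d 0 \<odot> fls_mat (I Id_tangle) + (d 1 / fps_to_fls (26 * c)) \<odot> fls_mat (I S_tangle)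
      + (d 2 / fps_to_fls r) \<odot> fls_mat (I H_tangle) + (b' 4 / (fps_to_fls r * a 4)) \<odot> fls_mat (I I_tangle)
      + (d 3 / fps_to_fls s) \<odot> fls_mat (I H_da)"
  proof -
    have "a 4 \<noteq> 0" using \<alpha>4 by (simp add: a_def)
    have 1: "(d 1 / fps_to_fls (26 * c)) \<odot> fls_mat (I S_tangle) = d 1 \<odot> ?M 1"
      "(d 2 / fps_to_fls r) \<odot> fls_mat (I H_tangle) = d 2 \<odot> ?M 2"
      "(d 3 / fps_to_fls s) \<odot> fls_mat (I H_da) = d 3 \<odot> ?M 3"
      unfolding others smul_smul using r s c by simp_all
    have 2: "(b' 4 / (fps_to_fls r * a 4)) \<odot> fls_mat (I I_tangle) =
        (b' 4 / a 4) \<odot> (a 0 \<odot> ?M 0 + a 1 \<odot> ?M 1 + a 2 \<odot> ?M 2 + a 3 \<odot> ?M 3 + a 4 \<odot> ?M 4)"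
      unfolding R smul_smul using r by simp
    show ?thesis
      unfolding 1 2 others(1) X unfolding d_def using \<open>a 4 \<noteq> 0\<close>
      by (simp add: vec_eq_iff algebra_simps)
  qed
  then show ?thesis by blast
qed

end
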